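(* For any $c\in\mathbb{R}$ and $\delta>0$ the following holds, for every sufficiently small value (depending on $c,\delta$) of the parameter $\epsilon>0$ in the definition of the Littlewood-Paley cutoff $\varphi$ and every such cutoff $\varphi$. There exists a divergence-free vector field $U:\mathbb{T}^3\to\mathbb{R}^3$, $U\in B^{5/6}_{2,\infty}(\mathbb{T}^3)$, such that $$\liminf_{q\to\infty}\Pi_q(U)>c-\delta\qquad\text{and}\qquad \limsup_{q\to\infty}\Pi_q(U)<c+\delta .$$ In fact, this $U$ belongs to $B^{\frac3p-\frac23}_{p,\infty}(\mathbb{T}^3)$ for every $p\in(1,\frac92)$ and to $\dot B^{\frac3p-\frac23}_{p,\infty}(\mathbb{T}^3)$ for every $p\in(1,\infty]$.
   Context: $\mathbb{T}^3=(\mathbb{R}/2\pi\mathbb{Z})^3$, so Fourier coefficients $\hat u(k)$ are indexed by $k\in\mathbb{Z}^3$; $\lambda_q=2^q$. Divergence-free is understood in the distributional sense. Littlewood-Paley projections. Given a small $\epsilon>0$ (in particular $\frac{\sqrt5}{2}+2\epsilon<2-4\epsilon$), let $\varphi:[0,\infty)\to[0,1]$ be a smooth function with $\varphi(\xi)=1$ for $\xi\le\frac{\sqrt5}{2}+2\epsilon$ and $\varphi(\xi)=0$ for $\xi\ge 2-4\epsilon$. Let $\psi(\xi)=\varphi(2\xi)-\varphi(\xi)$. Define $$\widehat{S_qu}(k)=\varphi(\lambda_q^{-1}|k|)\,\hat u(k),\qquad \widehat{\Delta_qu}(k)=\psi(\lambda_q^{-1}|k|)\,\hat u(k).$$ Energy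 flux. For a (distributionally) divergence-free vector field $u:\mathbb{T}^3\to\mathbb{R}^3$, $$\Pi_q(u)=\int_{\mathbb{T}^3}S_q(u\otimes u):\nabla S_q(u)\,dx,$$ where $S_q$ acts componentwise, $A:B=\sum_{i,j}A_{ij}B_{ij}$ and $(\nabla v)_{ij}=\partial_jv_i$. Besov spaces (standard). The homogeneous space $\dot B^s_{p,\infty}(\mathbb{T}^3)$ is given by finiteness of $\|u\|_{\dot B^s_{p,\infty}}=\sup_{q\in\mathbb{Z}}\lambda_q^s\|\Delta_qu\|_{L^p(\mathbb{T}^3)}$ for distributions $u$ on $\mathbb{T}^3$. For $s>0$, the inhomogeneous space $B^s_{p,\infty}(\mathbb{T}^3)$ is given by finiteness of $\|u\|_{L^p(\mathbb{T}^3)}+\|u\|_{\dot B^s_{p,\infty}}$. (Note $\frac3p-\frac23>0$ exactly for $p<\frac92$.) *)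

theory Defs
  imports "HOL-Probability.Essential_Supremum"
begin

text \<open>
  Objects on the torus (R / 2 pi Z)^3 are represented by functions on \<^typ>\<open>real^3\<close> that are
  \<open>2 * pi\<close>-periodic in each coordinate; integrals over the torus are taken over the
  fundamental cell, with unnormalised Lebesgue measure.
\<close>

definition torus_periodic :: "(real^3 \<Rightarrow> 'a) \<Rightarrow> bool" where
  "torus_periodic f \<longleftrightarrow> (\<forall>x i. f (x + (2 * pi) *\<^sub>R axis i 1) = f x)"

definition torus :: "(real^3) measure" where
  "torus = restrict_space lborel {x. \<forall>i. 0 \<le> x $ i \<and> x $ i < 2 * pi}"

definition torus_field :: "(real^3 \<Rightarrow> real^3) \<Rightarrow> bool" where
  "torus_field u \<longleftrightarrow> torus_periodic u \<and> integrable torus u"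

primrec C_k :: "nat \<Rightarrow> (real^3 \<Rightarrow> real) \<Rightarrow> bool" where
  "C_k 0 f \<longleftrightarrow> continuous_on UNIV f"
| "C_k (Suc n) f \<longleftrightarrow> (\<forall>x. f differentiable (at x)) \<and>
     (\<forall>j. C_k n (\<lambda>x. frechet_derivative f (at x) (axis j 1)))"

definition test_function :: "(real^3 \<Rightarrow> real) \<Rightarrow> bool" where
  "test_function \<eta> \<longleftrightarrow> torus_periodic \<eta> \<and> (\<forall>n. C_k n \<eta>)"

definition divergence_free :: "(real^3 \<Rightarrow> real^3) \<Rightarrow> bool" where
  "divergence_free u \<longleftrightarrow> (\<forall>\<eta>. test_function \<eta> \<longrightarrow>
     (LINT x|torus. (\<Sum>j\<in>UNIV. u x $ j * frechet_derivative \<eta> (at x) (axis j 1))) = 0)"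

definition freq :: "int^3 \<Rightarrow> real^3" where
  "freq k = (\<chi> i. real_of_int (k $ i))"

definition fourier_coeff :: "(real^3 \<Rightarrow> real) \<Rightarrow> int^3 \<Rightarrow> complex" where
  "fourier_coeff f k =
     (LINT x|torus. complex_of_real (f x) * cis (- (freq k \<bullet> x))) / (2 * pi) ^ 3"

text \<open>
  Only radial multipliers \<open>m |k|\<close> with real values and acting on real functions are used, so the
  Fourier series below is real and \<^const>\<open>Re\<close> merely changes its type. The multipliers used have
  bounded support, so the sum has only finitely many nonzero terms.
\<close>

definition radial_multiplier :: "(real \<Rightarrow> real) \<Rightarrow> (real^3 \<Rightarrow> real) \<Rightarrow> real^3 \<Rightarrow> real" where
  "radial_multiplier m f x =
     Re (\<Sum>\<^sub>\<infinity>k. complex_of_real (m (norm (freq k))) * fourier_coeff f k * cis (freq k \<bullet> x))"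

definition smooth_on_nonneg :: "(real \<Rightarrow> real) \<Rightarrow> bool" where
  "smooth_on_nonneg f \<longleftrightarrow> (\<exists>D :: nat \<Rightarrow> real \<Rightarrow> real. (\<forall>x\<ge>0. D 0 x = f x) \<and>
     (\<forall>n. \<forall>x\<ge>0. (D n has_real_derivative D (Suc n) x) (at x within {0..})))"

definition lp_cutoff :: "real \<Rightarrow> (real \<Rightarrow> real) \<Rightarrow> bool" where
  "lp_cutoff \<epsilon> \<phi> \<longleftrightarrow> 0 < \<epsilon> \<and> sqrt 5 / 2 + 2 * \<epsilon> < 2 - 4 * \<epsilon> \<and> smooth_on_nonneg \<phi> \<and>
     (\<forall>\<xi>\<ge>0. 0 \<le> \<phi> \<xi> \<and> \<phi> \<xi> \<le> 1) \<and>
     (\<forall>\<xi>. 0 \<le> \<xi> \<and> \<xi> \<le> sqrt 5 / 2 + 2 * \<epsilon> \<longrightarrow> \<phi> \<xi> = 1) \<and>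
     (\<forall>\<xi>. 2 - 4 * \<epsilon> \<le> \<xi> \<longrightarrow> \<phi> \<xi> = 0)"

definition lp_lambda :: "int \<Rightarrow> real" where
  "lp_lambda q = 2 powi q"

definition lp_S :: "(real \<Rightarrow> real) \<Rightarrow> int \<Rightarrow> (real^3 \<Rightarrow> real) \<Rightarrow> real^3 \<Rightarrow> real" where
  "lp_S \<phi> q = radial_multiplier (\<lambda>r. \<phi> (inverse (lp_lambda q) * r))"

definition lp_psi :: "(real \<Rightarrow> real) \<Rightarrow> real \<Rightarrow> real" where
  "lp_psi \<phi> \<xi> = \<phi> (2 * \<xi>) - \<phi> \<xi>"

definition lp_Delta :: "(real \<Rightarrow> real) \<Rightarrow> int \<Rightarrow> (real^3 \<Rightarrow> real) \<Rightarrow> real^3 \<Rightarrow> real" where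
  "lp_Delta \<phi> q = radial_multiplier (\<lambda>r. lp_psi \<phi> (inverse (lp_lambda q) * r))"

definition componentwise ::
  "((real^3 \<Rightarrow> real) \<Rightarrow> real^3 \<Rightarrow> real) \<Rightarrow> (real^3 \<Rightarrow> real^3) \<Rightarrow> real^3 \<Rightarrow> real^3" where
  "componentwise T u x = (\<chi> i. T (\<lambda>y. u y $ i) x)"

text \<open>The entry \<open>(i, j)\<close> of \<^const>\<open>jacobian\<close> is the \<open>j\<close>-th partial derivative of the \<open>i\<close>-th
  component.\<close>

definition energy_flux :: "(real \<Rightarrow> real) \<Rightarrow> int \<Rightarrow> (real^3 \<Rightarrow> real^3) \<Rightarrow> real" where
  "energy_flux \<phi> q u = (LINT x|torus. (\<Sum>i\<in>UNIV. \<Sum>j\<in>UNIV.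
     lp_S \<phi> q (\<lambda>y. u y $ i * u y $ j) x *
     jacobian (componentwise (lp_S \<phi> q) u) (at x) $ i $ j))"

definition Lp_norm :: "ereal \<Rightarrow> (real^3 \<Rightarrow> real^3) \<Rightarrow> ennreal" where
  "Lp_norm p u =
     (if p = \<infinity> then esssup torus (\<lambda>x. ennreal (norm (u x)))
      else let I = (\<integral>\<^sup>+x. ennreal (norm (u x) powr real_of_ereal p) \<partial>torus)
           in if I = \<infinity> then \<infinity> else ennreal (enn2real I powr (1 / real_of_ereal p)))"

definition hom_besov_norm ::
  "(real \<Rightarrow> real) \<Rightarrow> real \<Rightarrow> ereal \<Rightarrow> (real^3 \<Rightarrow> real^3) \<Rightarrow> ennreal" where
  "hom_besov_norm \<phi> s p u =
     (SUP q. ennreal (lp_lambda q powr s) * Lp_norm p (componentwise (lp_Delta \<phi> q) u))"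

text \<open>
  Both spaces are restricted to distributions given by an integrable field. For \<open>besov\<close>
  (meant for \<open>s > 0\<close> and \<open>p \<ge> 1\<close>) this is no restriction, since the torus has finite measure.
  For \<open>hom_besov\<close> it only makes membership a stronger assertion.
\<close>

definition hom_besov :: "(real \<Rightarrow> real) \<Rightarrow> real \<Rightarrow> ereal \<Rightarrow> (real^3 \<Rightarrow> real^3) set" where
  "hom_besov \<phi> s p = {u. torus_field u \<and> hom_besov_norm \<phi> s p u < \<infinity>}"

definition besov :: "(real \<Rightarrow> real) \<Rightarrow> real \<Rightarrow> ereal \<Rightarrow> (real^3 \<Rightarrow> real^3) set" where
  "besov \<phi> s p = {u. torus_field u \<and> Lp_norm p u + hom_besov_norm \<phi> s p u < \<infinity>}"

end

theory Submission
  imports Defs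
begin

text \<open>
  The velocity field is \<open>U = \<Sum>n. u\<^sub>n\<close> with \<open>u\<^sub>n = (- \<partial>\<^sub>2 g\<^sub>n, \<partial>\<^sub>1 g\<^sub>n, 0)\<close> and stream functions
  \<open>g\<^sub>n = t powr (- 10 / 3) F(x\<^sub>1) F(x\<^sub>2) F(x\<^sub>3) (a\<^sub>n cos (136 t x\<^sub>2) + cos (130 t x\<^sub>1) sin (20 t x\<^sub>2)
    + sin (130 t x\<^sub>1) cos (54 t x\<^sub>2))\<close>,
  where \<open>t = 4 ^ n\<close>, \<open>F\<close> is the Fejer kernel of degree below \<open>t\<close> and \<open>a\<^sub>n\<close> is a bounded sequence that remains
  to be chosen. It turns out that \<open>a\<^sub>n\<close> can be chosen so that the flux is equal to \<open>c\<close> at every level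
  from \<open>7\<close> on.

  The cutoff acts trivially on this field. The frequencies of \<open>u\<^sub>n\<close> have modulus between \<open>128 t\<close> and
  \<open>128 t * sqrt 5 / 2\<close>, so \<open>S\<^sub>q\<close> keeps or deletes \<open>u\<^sub>n\<close> entirely, and \<open>\<Delta>\<^sub>q U\<close> is \<open>- u\<^sub>n\<close> for \<open>q = 2 n + 7\<close> and zero for
  all other \<open>q\<close> (lemmas \<open>cutoff_on_shell\<close>, \<open>psi_on_shell\<close>). As \<open>S\<^sub>q\<close> is self-adjoint, the flux is
  \<open>\<integral> \<Sum>i j. U\<^sub>i U\<^sub>j \<partial>\<^sub>j V\<^sub>i\<close> with the sharp truncation \<open>V = S\<^sub>q U\<close>.

  Regularity. The kernel has height \<open>t\<close> and bounded mass, and its derivative costs a factor \<open>t\<close>. Thus \<open>u\<^sub>n\<close> is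
  dominated by a function of height of order \<open>t powr (2 / 3)\<close> and mass of order \<open>t powr (- 7 / 3)\<close>, and
  interpolation bounds its \<open>L\<^sup>p\<close> norm by a multiple of \<open>t powr (2 / 3 - 3 / p)\<close> (lemma \<open>envelope_integral\<close>).
  This is the homogeneous Besov bound; for \<open>p < 9 / 2\<close> the exponent is negative and the series
  converges in \<open>L\<^sup>p\<close> (lemma \<open>geometric_series_Lp\<close>).

  Flux. Expanding \<open>U\<close> and \<open>V\<close> gives a sum over triads of waves. All waves are products of functions of
  one variable and only \<open>x\<^sub>1\<close> and \<open>x\<^sub>2\<close> are differentiated, so the integrals factorise. Reflections in
  \<open>x\<^sub>1\<close> and \<open>x\<^sub>2\<close> annihilate every triad that does not contain each of the three kinds of waves once; this
  also removes the nonlocal interactions of a low wave with two nearly opposite high waves, which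
  frequency alone would admit. Among the rest, the frequencies add up to zero only if the first kind
  has scale \<open>n\<close> and the two others have scale \<open>n + 1\<close> (lemma \<open>wave_transfer_nonzero\<close>). A triad contributes to the
  flux only if it lies on both sides of the level, by conservation of energy
  (lemma \<open>planar_transfer_antisym\<close>). Hence exactly one triad contributes to each level, and its transfer can be
  computed in closed form: it is \<open>a\<^sub>n\<close> times a negative constant times the cube of the normalised integral
  of a product of three kernels (lemmas \<open>planar_transfer_exact\<close>, \<open>transfer_resonant\<close>). That integral is bounded
  below, so prescribing the flux determines a bounded sequence \<open>a\<^sub>n\<close> (lemma \<open>exact_flux_velocity\<close>).
\<close>

section \<open>Integration over one period and over the torus\<close>

text \<open>
  Most integrals below split into integrals over one period of a single coordinate; this measure
  is the one-dimensional counterpart of \<^const>\<open>torus\<close>.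
\<close>

definition circle :: "real measure" where
  "circle = restrict_space lborel {0..<2*pi}"

abbreviation cube :: "(real^3) set" where
  "cube \<equiv> {x. \<forall>i. 0 \<le> x $ i \<and> x $ i < 2 * pi}"

lemma sum_UNIV3: "(\<Sum>i\<in>(UNIV::3 set). f i) = f 1 + f 2 + f 3"
  by (rule sum_3)

lemma prod_UNIV3: "(\<Prod>i\<in>(UNIV::3 set). f i) = f 1 * f 2 * f 3" for f :: "3 \<Rightarrow> 'a::comm_monoid_mult"
  unfolding UNIV_3 by (simp add: mult.assoc)

lemma measurable_vec_lambda3 [measurable]:
  "(\<lambda>f. \<chi> i. f i) \<in> (\<Pi>\<^sub>M i\<in>(UNIV::3 set). (lborel::real measure)) \<rightarrow>\<^sub>M borel"
proof -
  have "(\<lambda>f. \<chi> i. f i) = (\<lambda>f::3\<Rightarrow>real. f 1 *\<^sub>R axis 1 1 + f 2 *\<^sub>R axis 2 1 + f 3 *\<^sub>R axis 3 1)"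
    by (auto simp: fun_eq_iff vec_eq_iff forall_3 axis_def)
  also have "\<dots> \<in> (\<Pi>\<^sub>M i\<in>(UNIV::3 set). (lborel::real measure)) \<rightarrow>\<^sub>M borel"
    by measurable
  finally show ?thesis .
qed

text \<open>
  Coordinates are indexed by the type \<open>3\<close> here, while Lebesgue measure on a Euclidean space is
  built from its basis vectors; this identification is what gives access to Fubini's theorem.
\<close>

lemma lborel_vec3:
  "(lborel :: (real^3) measure) = distr (\<Pi>\<^sub>M i\<in>UNIV. lborel) borel (\<lambda>f. \<chi> i. f i)"
proof (rule lborel_eqI)
  interpret product_sigma_finite "\<lambda>_::3. lborel :: real measure" ..
  fix l u :: "real^3" assume lu: "\<And>b. b \<in> Basis \<Longrightarrow> l \<bullet> b \<le> u \<bullet> b"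
  have le: "l $ i \<le> u $ i" for i
    using lu[of "axis i 1"] by (simp add: inner_axis axis_in_Basis_iff)
  have B: "(Basis::(real^3) set) = (\<lambda>i. axis i 1) ` UNIV"
    by (auto simp: Basis_vec_def)
  have inj: "inj (\<lambda>i::3. axis i (1::real))"
    by (auto simp: inj_on_def axis_eq_axis)
  have vim: "(\<lambda>f. \<chi> i. f i) -` box l u \<inter> space (\<Pi>\<^sub>M i\<in>(UNIV::3 set). (lborel::real measure))
      = (\<Pi>\<^sub>E i\<in>UNIV. {l $ i <..< u $ i})"
    by (auto simp: space_PiM box_def B inner_axis PiE_def Pi_def)
  have "emeasure (distr (\<Pi>\<^sub>M i\<in>UNIV. lborel) borel (\<lambda>f. \<chi> i. f i)) (box l u)
     = emeasure (\<Pi>\<^sub>M i\<in>(UNIV::3 set). (lborel::real measure)) (\<Pi>\<^sub>E i\<in>UNIV. {l $ i <..< u $ i})"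
    by (subst emeasure_distr) (auto simp: vim)
  also have "\<dots> = (\<Prod>i\<in>UNIV. emeasure lborel {l $ i <..< u $ i})"
    by (subst emeasure_PiM) auto
  also have "\<dots> = (\<Prod>i\<in>UNIV. ennreal (u $ i - l $ i))"
    using le by simp
  also have "\<dots> = ennreal (\<Prod>i\<in>UNIV. (u $ i - l $ i))"
    using le by (simp add: prod_ennreal)
  also have "(\<Prod>i\<in>UNIV. (u $ i - l $ i)) = (\<Prod>b\<in>Basis. (u - l) \<bullet> b)"
    unfolding B by (subst prod.reindex[OF inj]) (simp add: inner_axis)
  finally show "emeasure (distr (\<Pi>\<^sub>M i\<in>UNIV. lborel) borel (\<lambda>f. \<chi> i. f i)) (box l u)
     = ennreal (\<Prod>b\<in>Basis. (u - l) \<bullet> b)" .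
qed simp

lemma cube_sets [measurable]: "cube \<in> sets lborel"
  by measurable

lemma space_torus: "space torus = cube"
  by (simp add: torus_def space_restrict_space)

lemma borel_measurable_torusI:
  "f \<in> borel_measurable borel \<Longrightarrow> f \<in> borel_measurable torus"
  unfolding torus_def by (rule measurable_restrict_space1) simp

lemma circle_integral_lborel:
  fixes f :: "real \<Rightarrow> 'a::{banach, second_countable_topology}"
  shows "(LINT x|circle. f x) = (LINT x|lborel. indicator {0..<2*pi} x *\<^sub>R f x)"
  unfolding circle_def by (subst integral_restrict_space) auto

lemma circle_integrable_lborel:
  fixes f :: "real \<Rightarrow> 'a::{banach, second_countable_topology}"
  shows "integrable circle f \<longleftrightarrow> integrable lborel (\<lambda>x. indicator {0..<2*pi} x *\<^sub>R f x)"
  unfolding circle_def by (subst integrable_restrict_space) auto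

lemma torus_integral_lborel:
  fixes f :: "real^3 \<Rightarrow> 'a::{banach, second_countable_topology}"
  shows "(LINT x|torus. f x) = (LINT x|lborel. indicator cube x *\<^sub>R f x)"
  unfolding torus_def by (subst integral_restrict_space) auto

lemma torus_integrable_lborel:
  fixes f :: "real^3 \<Rightarrow> 'a::{banach, second_countable_topology}"
  shows "integrable torus f \<longleftrightarrow> integrable lborel (\<lambda>x. indicator cube x *\<^sub>R f x)"
  unfolding torus_def by (subst integrable_restrict_space) auto

lemma continuous_integrable_restrict:
  fixes f :: "'b::euclidean_space \<Rightarrow> 'a::{banach, second_countable_topology}"
  assumes "continuous_on UNIV f" "S \<in> sets borel" "S \<subseteq> K" "compact K"
  shows "integrable (restrict_space lborel S) f"
proof -
  have "integrable lborel (\<lambda>x. indicator K x *\<^sub>R f x)"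
    by (rule borel_integrable_compact) (auto intro: continuous_on_subset assms)
  then have "integrable lborel (\<lambda>x. indicator S x *\<^sub>R (indicator K x *\<^sub>R f x))"
    by (rule integrable_mult_indicator[rotated]) (use assms in simp)
  also have "(\<lambda>x. indicator S x *\<^sub>R (indicator K x *\<^sub>R f x)) = (\<lambda>x. indicator S x *\<^sub>R f x)"
    using assms(3) by (auto simp: fun_eq_iff split: split_indicator)
  finally show ?thesis using assms(2) by (subst integrable_restrict_space) auto
qed

lemma continuous_integrable_circle:
  fixes f :: "real \<Rightarrow> 'a::{banach, second_countable_topology}"
  assumes "continuous_on UNIV f" shows "integrable circle f"
  unfolding circle_def by (rule continuous_integrable_restrict[OF assms, where K = "{0..2*pi}"]) auto

lemma continuous_integrable_torus:
  fixes f :: "real^3 \<Rightarrow> 'a::{banach, second_countable_topology}"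
  assumes "continuous_on UNIV f" shows "integrable torus f"
  unfolding torus_def
  by (rule continuous_integrable_restrict[OF assms, where K = "cbox 0 (\<chi> i. 2 * pi)"])
    (use cube_sets in \<open>auto simp: mem_box_cart less_imp_le\<close>)

lemma indicator_cube:
  "(indicator cube x :: real) = (\<Prod>i\<in>UNIV. indicator {0..<2*pi} (x $ i))"
  by (auto simp: indicator_def prod_zero_iff)

lemma torus_integral_prod:
  fixes f :: "3 \<Rightarrow> real \<Rightarrow> 'a::{real_normed_field, banach, second_countable_topology}"
  assumes f: "\<And>i. integrable circle (f i)" and m: "\<And>i. f i \<in> borel_measurable borel"
  shows "(LINT x|torus. (\<Prod>i\<in>UNIV. f i (x $ i))) = (\<Prod>i\<in>UNIV. LINT x|circle. f i x)"
proof -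
  interpret product_sigma_finite "\<lambda>_::3. lborel :: real measure" ..
  note m [measurable]
  have "(LINT x|torus. (\<Prod>i\<in>UNIV. f i (x $ i)))
      = (LINT x|lborel. indicator cube x *\<^sub>R (\<Prod>i\<in>UNIV. f i (x $ i)))"
    by (rule torus_integral_lborel)
  also have "\<dots> = (LINT x|lborel. (\<Prod>i\<in>UNIV. indicator {0..<2*pi} (x $ i) *\<^sub>R f i (x $ i)))"
    by (simp add: indicator_cube scaleR_conv_of_real prod.distrib)
  also have "\<dots> = (LINT g|(\<Pi>\<^sub>M i\<in>UNIV. lborel).
      (\<Prod>i\<in>(UNIV::3 set). indicator {0..<2*pi} (g i) *\<^sub>R f i (g i)))"
    by (subst lborel_vec3, subst integral_distr) auto
  also have "\<dots> = (\<Prod>i\<in>UNIV. LINT x|lborel. indicator {0..<2*pi} x *\<^sub>R f i x)"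
    by (rule product_integral_prod) (use f in \<open>auto simp: circle_integrable_lborel\<close>)
  finally show ?thesis by (simp add: circle_integral_lborel)
qed

lemma torus_integral_prod3:
  fixes f g h :: "real \<Rightarrow> 'a::{real_normed_field, banach, second_countable_topology}"
  assumes "continuous_on UNIV f" "continuous_on UNIV g" "continuous_on UNIV h"
  shows "(LINT x|torus. f (x $ 1) * g (x $ 2) * h (x $ 3))
     = (LINT x|circle. f x) * (LINT x|circle. g x) * (LINT x|circle. h x)"
proof -
  define F where "F = (\<lambda>i::3. if i = 1 then f else if i = 2 then g else h)"
  have "continuous_on UNIV (F i)" for i
    using assms by (simp add: F_def)
  then have "(LINT x|torus. (\<Prod>i\<in>UNIV. F i (x $ i))) = (\<Prod>i\<in>UNIV. LINT x|circle. F i x)"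
    by (intro torus_integral_prod continuous_integrable_circle borel_measurable_continuous_onI)
  then show ?thesis by (simp add: prod_UNIV3 F_def)
qed

text \<open>
  Fubini: it is enough that the integral vanishes along every line parallel to one axis.
\<close>

lemma torus_integral_slice_zero:
  fixes f :: "real^3 \<Rightarrow> real"
  assumes f: "continuous_on UNIV f"
    and z: "\<And>x. (LINT y|circle. f (\<chi> j. if j = i then y else x $ j)) = 0"
  shows "(LINT x|torus. f x) = 0"
proof -
  interpret product_sigma_finite "\<lambda>_::3. lborel :: real measure" ..
  have [measurable]: "f \<in> borel_measurable borel"
    by (rule borel_measurable_continuous_onI[OF f])
  let ?F = "\<lambda>g::3\<Rightarrow>real. indicator cube (\<chi> j. g j) *\<^sub>R f (\<chi> j. g j)"
  have U: "(UNIV::3 set) = insert i (UNIV - {i})" by auto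
  have int: "integrable (\<Pi>\<^sub>M i\<in>UNIV. lborel) ?F"
  proof -
    have "integrable lborel (\<lambda>x. indicator cube x *\<^sub>R f x)"
      using continuous_integrable_torus[OF f] by (simp add: torus_integrable_lborel)
    then show ?thesis
      by (subst (asm) lborel_vec3, subst (asm) integrable_distr_eq) auto
  qed
  have "(LINT x|torus. f x) = (LINT g|(\<Pi>\<^sub>M i\<in>UNIV. lborel). ?F g)"
    by (subst torus_integral_lborel, subst lborel_vec3, subst integral_distr) auto
  also have "\<dots> = (LINT g|(\<Pi>\<^sub>M j\<in>UNIV - {i}. lborel). LINT y|lborel. ?F (g(i := y)))"
    using product_integral_insert[of "UNIV - {i}" i ?F] int by (simp flip: U)
  also have "\<dots> = 0"
  proof -
    have "(LINT y|lborel. ?F (g(i := y))) = 0" for g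
    proof -
      let ?r = "\<Prod>j\<in>UNIV - {i}. indicator {0..<2*pi} (g j) :: real"
      have "indicator cube (\<chi> j. (g(i := y)) j) = indicator {0..<2*pi} y * ?r" for y
      proof -
        have "(indicator cube (\<chi> j. (g(i := y)) j) :: real)
            = (\<Prod>j\<in>insert i (UNIV - {i}). indicator {0..<2*pi} ((g(i := y)) j))"
          by (subst indicator_cube) (simp flip: U)
        also have "\<dots> = indicator {0..<2*pi} y * ?r"
          by (subst prod.insert) (auto intro!: prod.cong)
        finally show ?thesis .
      qed
      then have "(LINT y|lborel. ?F (g(i := y)))
          = ?r * (LINT y|lborel. indicator {0..<2*pi} y *\<^sub>R f (\<chi> j. (g(i := y)) j))"
        by (simp add: mult_ac flip: integral_mult_right_zero)
      also have "(LINT y|lborel. indicator {0..<2*pi} y *\<^sub>R f (\<chi> j. (g(i := y)) j)) = 0"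
        using z[of "\<chi> j. g j"] by (simp add: circle_integral_lborel fun_upd_def cong del: if_weak_cong)
      finally show ?thesis by simp
    qed
    then show ?thesis by simp
  qed
  finally show ?thesis .
qed

lemma circle_integral_FTC:
  fixes F :: "real \<Rightarrow> real"
  assumes "\<And>x. (F has_real_derivative f x) (at x)" "continuous_on UNIV f"
  shows "(LINT x|circle. f x) = F (2 * pi) - F 0"
proof -
  have [measurable]: "f \<in> borel_measurable borel"
    using assms(2) by (rule borel_measurable_continuous_onI)
  have "(LINT x|circle. f x) = (LINT x|lborel. indicator {0..<2*pi} x *\<^sub>R f x)"
    by (rule circle_integral_lborel)
  also have "\<dots> = (LINT x|lborel. indicator {0..2*pi} x *\<^sub>R f x)"
  proof (rule integral_cong_AE)
    show "AE x in lborel. indicator {0..<2*pi} x *\<^sub>R f x = indicator {0..2*pi} x *\<^sub>R f x"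
      using AE_lborel_singleton[of "2*pi"] by eventually_elim (auto simp: indicator_def)
  qed auto
  also have "\<dots> = F (2 * pi) - F 0"
  proof (rule integral_FTC_Icc)
    show "continuous_on {0..2*pi} f" using assms(2) continuous_on_subset by blast
  qed (use assms(1) in \<open>auto simp: has_real_derivative_iff_has_vector_derivative intro: has_vector_derivative_at_within\<close>)
  finally show ?thesis .
qed

section \<open>Trigonometric polynomials\<close>

text \<open>
  One notion covers trigonometric polynomials on the circle and on the torus: \<open>e\<close> is the family of
  characters and \<open>K\<close> a finite set outside which there are no frequencies. The set need not be
  minimal, so that only bounds for spectra have to be propagated.
\<close>

definition spectrum_in :: "('k \<Rightarrow> 'x \<Rightarrow> complex) \<Rightarrow> 'k set \<Rightarrow> ('x \<Rightarrow> complex) \<Rightarrow> bool" where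
  "spectrum_in e K f \<longleftrightarrow> finite K \<and> (\<exists>c. \<forall>x. f x = (\<Sum>k\<in>K. c k * e k x))"

lemma spectrum_in_finite: "spectrum_in e K f \<Longrightarrow> finite K"
  by (simp add: spectrum_in_def)

lemma spectrum_inE:
  assumes "spectrum_in e K f"
  obtains c where "finite K" "\<And>x. f x = (\<Sum>k\<in>K. c k * e k x)"
  using assms by (auto simp: spectrum_in_def)

lemma spectrum_in_mono:
  assumes "spectrum_in e K f" "K \<subseteq> L" "finite L"
  shows "spectrum_in e L f"
proof -
  obtain c where c: "finite K" "\<And>x. f x = (\<Sum>k\<in>K. c k * e k x)"
    by (rule spectrum_inE[OF assms(1)]) blast
  have "f x = (\<Sum>k\<in>L. (if k \<in> K then c k else 0) * e k x)" for x
    unfolding c(2) using assms(2,3) by (intro sum.mono_neutral_cong_left) auto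
  then show ?thesis using assms(3) by (auto simp: spectrum_in_def intro!: exI[of _ "\<lambda>k. if k \<in> K then c k else 0"])
qed

lemma spectrum_in_char: "finite K \<Longrightarrow> k \<in> K \<Longrightarrow> spectrum_in e K (e k)"
  by (auto simp: spectrum_in_def if_distrib[of "\<lambda>c. c * _"] sum.delta cong: if_cong
      intro!: exI[of _ "\<lambda>j. if j = k then 1 else 0"])

lemma spectrum_in_zero: "finite K \<Longrightarrow> spectrum_in e K (\<lambda>x. 0)"
  by (auto simp: spectrum_in_def intro!: exI[of _ "\<lambda>_. 0"])

lemma spectrum_in_cmult:
  assumes "spectrum_in e K f" shows "spectrum_in e K (\<lambda>x. a * f x)"
proof -
  obtain c where c: "finite K" "\<And>x. f x = (\<Sum>k\<in>K. c k * e k x)"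
    by (rule spectrum_inE[OF assms(1)]) blast
  show ?thesis unfolding spectrum_in_def c(2)
    using c(1) by (auto simp: sum_distrib_left mult.assoc intro!: exI[of _ "\<lambda>k. a * c k"])
qed

lemma spectrum_in_add:
  assumes "spectrum_in e K f" "spectrum_in e K g" shows "spectrum_in e K (\<lambda>x. f x + g x)"
proof -
  obtain c where c: "finite K" "\<And>x. f x = (\<Sum>k\<in>K. c k * e k x)"
    by (rule spectrum_inE[OF assms(1)]) blast
  obtain d where d: "\<And>x. g x = (\<Sum>k\<in>K. d k * e k x)"
    by (rule spectrum_inE[OF assms(2)]) blast
  show ?thesis unfolding spectrum_in_def c(2) d
    using c(1) by (auto simp: sum.distrib distrib_right intro!: exI[of _ "\<lambda>k. c k + d k"])
qed

lemma spectrum_in_sum: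
  assumes "finite K" "\<And>i. i \<in> I \<Longrightarrow> spectrum_in e K (f i)"
  shows "spectrum_in e K (\<lambda>x. \<Sum>i\<in>I. f i x)"
  using assms(2)
  by (induction I rule: infinite_finite_induct) (auto intro: spectrum_in_zero spectrum_in_add assms(1))

lemma spectrum_in_mult:
  assumes e: "\<And>k l x. e (k + l) x = e k x * e l x"
    and "spectrum_in e K f" "spectrum_in e L g" and M: "finite M" "\<And>k l. k \<in> K \<Longrightarrow> l \<in> L \<Longrightarrow> k + l \<in> M"
  shows "spectrum_in e M (\<lambda>x. f x * g x)"
proof -
  obtain c where c: "finite K" "\<And>x. f x = (\<Sum>k\<in>K. c k * e k x)"
    by (rule spectrum_inE[OF assms(2)]) blast
  obtain d where d: "finite L" "\<And>x. g x = (\<Sum>k\<in>L. d k * e k x)"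
    by (rule spectrum_inE[OF assms(3)]) blast
  have "(\<lambda>x. f x * g x) = (\<lambda>x. \<Sum>k\<in>K. \<Sum>l\<in>L. (c k * d l) * e (k + l) x)"
    unfolding c(2) d(2) e by (simp add: sum_product mult_ac)
  moreover have "spectrum_in e M \<dots>"
    by (intro spectrum_in_sum spectrum_in_cmult spectrum_in_char M)
  ultimately show ?thesis by (simp only:)
qed

abbreviation char1 :: "int \<Rightarrow> real \<Rightarrow> complex" where
  "char1 k x \<equiv> cis (of_int k * x)"

abbreviation char3 :: "int^3 \<Rightarrow> real^3 \<Rightarrow> complex" where
  "char3 k x \<equiv> cis (freq k \<bullet> x)"

lemma char1_add: "char1 (k + l) x = char1 k x * char1 l x"
  by (simp add: cis_mult ring_distribs)

lemma freq_add: "freq (k + l) = freq k + freq l"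
  by (simp add: freq_def vec_eq_iff)

lemma freq_minus: "freq (- k) = - freq k"
  by (simp add: freq_def vec_eq_iff)

lemma char3_add: "char3 (k + l) x = char3 k x * char3 l x"
  by (simp add: cis_mult freq_add inner_add_left)

lemma inner_freq: "freq k \<bullet> x = of_int (k $ 1) * x $ 1 + of_int (k $ 2) * x $ 2 + of_int (k $ 3) * x $ 3"
  by (simp add: freq_def inner_vec_def sum_UNIV3)

lemma char3_prod: "char3 k x = char1 (k $ 1) (x $ 1) * char1 (k $ 2) (x $ 2) * char1 (k $ 3) (x $ 3)"
  by (simp add: inner_freq cis_mult)

abbreviation trig1 :: "int set \<Rightarrow> (real \<Rightarrow> real) \<Rightarrow> bool" where
  "trig1 K f \<equiv> spectrum_in char1 K (\<lambda>x. complex_of_real (f x))"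

abbreviation trig3 :: "(int^3) set \<Rightarrow> (real^3 \<Rightarrow> real) \<Rightarrow> bool" where
  "trig3 K f \<equiv> spectrum_in char3 K (\<lambda>x. complex_of_real (f x))"

lemma trig1_mult:
  assumes "trig1 K f" "trig1 L g" "finite M" "\<And>k l. k \<in> K \<Longrightarrow> l \<in> L \<Longrightarrow> k + l \<in> M"
  shows "trig1 M (\<lambda>x. f x * g x)"
  using spectrum_in_mult[of char1, OF char1_add assms] by simp

lemma trig3_mult:
  assumes "trig3 K f" "trig3 L g" "finite M" "\<And>k l. k \<in> K \<Longrightarrow> l \<in> L \<Longrightarrow> k + l \<in> M"
  shows "trig3 M (\<lambda>x. f x * g x)"
  using spectrum_in_mult[of char3, OF char3_add assms] by simp

lemma spectrum_in_real_cmult: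
  assumes "spectrum_in e K (\<lambda>x. complex_of_real (f x))"
  shows "spectrum_in e K (\<lambda>x. complex_of_real (a * f x))"
  using spectrum_in_cmult[OF assms, of "of_real a"] by simp

lemma spectrum_in_real_sum:
  assumes "finite K" "\<And>i. i \<in> I \<Longrightarrow> spectrum_in e K (\<lambda>x. complex_of_real (f i x))"
  shows "spectrum_in e K (\<lambda>x. complex_of_real (\<Sum>i\<in>I. f i x))"
  using spectrum_in_sum[OF assms] by simp

lemma trig1_cos: "trig1 {m, -m} (\<lambda>x. cos (of_int m * x))"
proof -
  have "(\<lambda>x. complex_of_real (cos (of_int m * x))) = (\<lambda>x. 1/2 * char1 m x + 1/2 * char1 (-m) x)"
    by (auto simp: fun_eq_iff complex_eq_iff)
  moreover have "spectrum_in char1 {m, -m} \<dots>"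
    by (intro spectrum_in_add spectrum_in_cmult spectrum_in_char) auto
  ultimately show ?thesis by (simp only:)
qed

lemma trig1_sin: "trig1 {m, -m} (\<lambda>x. sin (of_int m * x))"
proof -
  have "(\<lambda>x. complex_of_real (sin (of_int m * x))) = (\<lambda>x. (-\<i>/2) * char1 m x + (\<i>/2) * char1 (-m) x)"
    by (auto simp: fun_eq_iff complex_eq_iff)
  moreover have "spectrum_in char1 {m, -m} \<dots>"
    by (intro spectrum_in_add spectrum_in_cmult spectrum_in_char) auto
  ultimately show ?thesis by (simp only:)
qed

lemma continuous_on_cis: "continuous_on A f \<Longrightarrow> continuous_on A (\<lambda>x. cis (f x))"
  by (simp add: cis_conv_exp) (intro continuous_intros)

lemma spectrum_in_continuous:
  fixes e :: "'k \<Rightarrow> 'x::topological_space \<Rightarrow> complex"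
  assumes "spectrum_in e K f" "\<And>k. continuous_on UNIV (e k)"
  shows "continuous_on UNIV f"
proof -
  obtain c where c: "\<And>x. f x = (\<Sum>k\<in>K. c k * e k x)"
    by (rule spectrum_inE[OF assms(1)]) blast
  have "continuous_on UNIV (\<lambda>x. \<Sum>k\<in>K. c k * e k x)"
    by (intro continuous_intros assms(2))
  then show ?thesis by (simp add: c[abs_def])
qed

lemma continuous_char1: "continuous_on A (char1 k)"
  by (intro continuous_on_cis continuous_intros)

lemma continuous_char3: "continuous_on A (char3 k)"
  by (intro continuous_on_cis continuous_intros)

lemma continuous_of_real_iff:
  "continuous_on A (\<lambda>x. complex_of_real (f x)) \<longleftrightarrow> continuous_on A f"
proof
  assume "continuous_on A (\<lambda>x. complex_of_real (f x))"
  from continuous_on_Re[OF this] show "continuous_on A f" by simp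
qed (intro continuous_intros)

lemma trig1_continuous: "trig1 K f \<Longrightarrow> continuous_on UNIV f"
  unfolding continuous_of_real_iff[of UNIV f, symmetric]
  by (erule spectrum_in_continuous) (rule continuous_char1)

lemma trig3_continuous: "trig3 K f \<Longrightarrow> continuous_on UNIV f"
  unfolding continuous_of_real_iff[of UNIV f, symmetric]
  by (erule spectrum_in_continuous) (rule continuous_char3)

lemma circle_integral_sin_cos:
  fixes k :: int assumes "k \<noteq> 0"
  shows "(LINT x|circle. cos (of_int k * x)) = 0" "(LINT x|circle. sin (of_int k * x)) = 0"
proof -
  have "sin (of_int k * (2 * pi)) = 0" "cos (of_int k * (2 * pi)) = 1"
    using sin_integer_2pi[of "of_int k"] cos_integer_2pi[of "of_int k"] by (simp_all add: mult_ac)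
  note k = this assms
  have "(LINT x|circle. cos (of_int k * x)) = sin (of_int k * (2*pi)) / of_int k - sin (of_int k * 0) / of_int k"
    by (rule circle_integral_FTC) (auto intro!: derivative_eq_intros continuous_intros simp: k)
  then show "(LINT x|circle. cos (of_int k * x)) = 0" by (simp add: k)
  have "(LINT x|circle. sin (of_int k * x)) = - cos (of_int k * (2*pi)) / of_int k - (- cos (of_int k * 0) / of_int k)"
    by (rule circle_integral_FTC) (auto intro!: derivative_eq_intros continuous_intros simp: k)
  then show "(LINT x|circle. sin (of_int k * x)) = 0" by (simp add: k)
qed

lemma measure_circle: "(LINT x|circle. 1::real) = 2 * pi"
  using circle_integral_FTC[of "\<lambda>x. x" "\<lambda>_. 1"] by (simp add: continuous_intros)

lemma circle_integral_char1: "(LINT x|circle. char1 k x) = (if k = 0 then 2 * pi else 0)"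
proof -
  have i: "integrable circle (\<lambda>x. cos (of_int k * x))" "integrable circle (\<lambda>x. sin (of_int k * x))"
    by (intro continuous_integrable_circle continuous_intros)+
  have "(LINT x|circle. char1 k x)
      = (LINT x|circle. complex_of_real (cos (of_int k * x)) + \<i> * complex_of_real (sin (of_int k * x)))"
    by (intro Bochner_Integration.integral_cong) (auto simp: complex_eq_iff)
  also have "\<dots> = complex_of_real (LINT x|circle. cos (of_int k * x))
      + \<i> * complex_of_real (LINT x|circle. sin (of_int k * x))"
    using i by (subst Bochner_Integration.integral_add) auto
  also have "\<dots> = (if k = 0 then 2 * pi else 0)"
    using circle_integral_sin_cos[of k] measure_circle by auto
  finally show ?thesis by auto
qed

lemma torus_integral_char3: "(LINT x|torus. char3 k x) = (if k = 0 then (2 * pi) ^ 3 else 0)"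
proof -
  have "(LINT x|torus. char3 k x)
    = (LINT x|circle. char1 (k$1) x) * (LINT x|circle. char1 (k$2) x) * (LINT x|circle. char1 (k$3) x)"
    unfolding char3_prod by (rule torus_integral_prod3; rule continuous_char1)
  also have "\<dots> = (if k = 0 then (2 * pi) ^ 3 else 0)"
    by (auto simp: circle_integral_char1 vec_eq_iff forall_3 power3_eq_cube)
  finally show ?thesis .
qed

lemma trig1_integral_zero:
  assumes "trig1 K f" "0 \<notin> K" shows "(LINT x|circle. f x) = 0"
proof -
  obtain c where c: "\<And>x. complex_of_real (f x) = (\<Sum>k\<in>K. c k * char1 k x)"
    by (rule spectrum_inE[OF assms(1)]) blast
  have "complex_of_real (LINT x|circle. f x) = (LINT x|circle. (\<Sum>k\<in>K. c k * char1 k x))"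
    by (simp flip: c)
  also have "\<dots> = (\<Sum>k\<in>K. c k * (LINT x|circle. char1 k x))"
    by (subst Bochner_Integration.integral_sum)
       (auto intro!: continuous_integrable_circle continuous_intros continuous_char1)
  also have "\<dots> = 0" using assms(2) by (intro sum.neutral) (auto simp: circle_integral_char1)
  finally show ?thesis by simp
qed

text \<open>
  Differentiation multiplies the coefficient of frequency \<open>k\<close> by \<open>\<i> k\<close>, which removes the zero frequency;
  that the result is again real follows from uniqueness of the derivative of the imaginary part.
\<close>

lemma trig1_deriv:
  assumes "trig1 K f"
  shows trig1_DERIV: "(f has_real_derivative deriv f x) (at x)"
    and trig1_deriv_nonzero: "trig1 (K - {0}) (deriv f)"
proof -
  obtain c where c: "finite K" "\<And>x. complex_of_real (f x) = (\<Sum>k\<in>K. c k * char1 k x)"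
    by (rule spectrum_inE[OF assms(1)]) blast
  define g where "g x = (\<Sum>k\<in>K. c k * (\<i> * of_int k * char1 k x))" for x
  have "((\<lambda>x. \<Sum>k\<in>K. c k * char1 k x) has_vector_derivative g x) (at x)" for x
    unfolding g_def cis_conv_exp
    by (intro derivative_eq_intros has_vector_derivative_real_field | simp add: algebra_simps)+
  then have D: "((\<lambda>x. complex_of_real (f x)) has_vector_derivative g x) (at x)" for x
    by (simp add: c(2))
  have "((\<lambda>x. Im (complex_of_real (f x))) has_vector_derivative Im (g x)) (at x)" for x
    by (rule bounded_linear.has_vector_derivative[OF bounded_linear_Im D])
  then have "((\<lambda>x. 0::real) has_vector_derivative Im (g x)) (at x)" for x by simp
  from vector_derivative_unique_at[OF this has_vector_derivative_const]
  have Im0: "Im (g x) = 0" for x by simp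
  have "((\<lambda>x. Re (complex_of_real (f x))) has_vector_derivative Re (g x)) (at x)" for x
    by (rule bounded_linear.has_vector_derivative[OF bounded_linear_Re D])
  then have R: "(f has_real_derivative Re (g x)) (at x)" for x
    by (simp add: has_real_derivative_iff_has_vector_derivative)
  then have d: "deriv f x = Re (g x)" for x by (rule DERIV_imp_deriv)
  show "(f has_real_derivative deriv f x) (at x)" unfolding d by (rule R)
  have "complex_of_real (deriv f x) = (\<Sum>k\<in>K - {0}. (c k * \<i> * of_int k) * char1 k x)" for x
  proof -
    have "complex_of_real (deriv f x) = g x" using Im0[of x] by (simp add: d complex_eq_iff)
    also have "\<dots> = (\<Sum>k\<in>K - {0}. (c k * \<i> * of_int k) * char1 k x)"
      unfolding g_def using c(1) by (intro sum.mono_neutral_cong_right) (auto simp: mult_ac)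
    finally show ?thesis .
  qed
  then show "trig1 (K - {0}) (deriv f)"
    using c(1) unfolding spectrum_in_def by (intro conjI exI[of _ "\<lambda>k. c k * \<i> * of_int k"]) auto
qed

lemma trig1_deriv': "trig1 K f \<Longrightarrow> trig1 K (deriv f)"
  by (rule spectrum_in_mono[OF trig1_deriv_nonzero]) (auto dest: spectrum_in_finite)

text \<open>
  This is the source of every integration by parts in one variable.
\<close>

lemma circle_integral_deriv: "trig1 K f \<Longrightarrow> (LINT x|circle. deriv f x) = 0"
  by (rule trig1_integral_zero[OF trig1_deriv_nonzero]) auto

section \<open>The Fejer kernel\<close>

text \<open>
  The squared modulus of \<open>\<Sum>m<N. w m * cis (m x)\<close>. With unit weights and division by \<open>N\<close> it is the
  Fejer kernel, normalised to have integral \<open>2 pi\<close> and height \<open>N\<close>.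
\<close>

definition energy_sum :: "(nat \<Rightarrow> real) \<Rightarrow> nat \<Rightarrow> real \<Rightarrow> real" where
  "energy_sum w N x = (\<Sum>m<N. w m * cos (real m * x))\<^sup>2 + (\<Sum>m<N. w m * sin (real m * x))\<^sup>2"

definition fejer :: "nat \<Rightarrow> real \<Rightarrow> real" where
  "fejer N x = energy_sum (\<lambda>_. 1) N x / real N"

text \<open>
  A single nonnegative function of height and mass comparable to those of the Fejer kernel \<open>F\<close>
  that dominates both \<open>F\<close> and \<open>F' / N\<close>. The second summand is the squared modulus of the
  derivative of the Dirichlet sum, rescaled.
\<close>

definition majorant :: "nat \<Rightarrow> real \<Rightarrow> real" where
  "majorant N x = energy_sum (\<lambda>_. 1) N x / real N + energy_sum real N x / real N ^ 3"

lemma energy_sum_expand: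
  "energy_sum w N x = (\<Sum>m<N. \<Sum>l<N. w m * w l * cos (of_int (int m - int l) * x))"
  by (simp add: energy_sum_def power2_eq_square sum_product sum.distrib[symmetric] left_diff_distrib
      cos_diff algebra_simps)

lemma energy_sum_nonneg: "0 \<le> energy_sum w N x"
  by (simp add: energy_sum_def)

lemma energy_sum_le:
  assumes "\<And>m. 0 \<le> w m" shows "energy_sum w N x \<le> (\<Sum>m<N. w m)\<^sup>2"
proof -
  have "energy_sum w N x \<le> (\<Sum>m<N. \<Sum>l<N. w m * w l * 1)"
    unfolding energy_sum_expand by (intro sum_mono mult_left_mono) (auto simp: assms)
  then show ?thesis by (simp add: power2_eq_square sum_product)
qed

lemma energy_sum_continuous: "continuous_on A (energy_sum w N)"
  unfolding energy_sum_def[abs_def] by (intro continuous_intros)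

lemma circle_integral_energy_sum: "(LINT x|circle. energy_sum w N x) = 2 * pi * (\<Sum>m<N. (w m)\<^sup>2)"
proof -
  have "(LINT x|circle. energy_sum w N x)
      = (\<Sum>m<N. \<Sum>l<N. w m * w l * (LINT x|circle. cos (of_int (int m - int l) * x)))"
    unfolding energy_sum_expand
    by (simp add: Bochner_Integration.integral_sum continuous_integrable_circle continuous_intros del: of_int_diff)
  also have "\<dots> = (\<Sum>m<N. \<Sum>l<N. w m * w l * (if m = l then 2 * pi else 0))"
  proof -
    have "(LINT x|circle. cos (of_int (int m - int l) * x)) = (if m = l then 2 * pi else 0)" for m l
      using circle_integral_sin_cos(1)[of "int m - int l"] measure_circle by (cases "m = l") (auto simp del: of_int_diff)
    then show ?thesis by (simp only:)
  qed
  also have "\<dots> = (\<Sum>m<N. 2 * pi * (w m)\<^sup>2)"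
    by (intro sum.cong refl) (simp add: if_distrib power2_eq_square cong: if_cong)
  finally show ?thesis by (simp add: sum_distrib_left)
qed

lemma fejer_nonneg: "0 \<le> fejer N x" by (simp add: fejer_def energy_sum_nonneg)

lemma fejer_le_majorant: "fejer N x \<le> majorant N x"
  by (simp add: fejer_def majorant_def energy_sum_nonneg)

lemma majorant_nonneg: "0 \<le> majorant N x"
  by (simp add: majorant_def energy_sum_nonneg)

lemma majorant_continuous: "continuous_on A (majorant N)"
  unfolding majorant_def[abs_def] divide_inverse by (intro continuous_intros energy_sum_continuous)

lemma fejer_continuous: "continuous_on A (fejer N)"
  unfolding fejer_def[abs_def] divide_inverse by (intro continuous_intros energy_sum_continuous)

lemma majorant_le: assumes "N > 0" shows "majorant N x \<le> 2 * real N"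
proof -
  have a: "energy_sum (\<lambda>_. 1) N x \<le> real N ^ 2" using energy_sum_le[of "\<lambda>_. 1" N x] by simp
  have s: "(\<Sum>m<N. real m) \<le> real N * real N"
    using sum_bounded_above[of "{..<N}" real "real N"] by simp
  have "energy_sum real N x \<le> (\<Sum>m<N. real m)\<^sup>2" by (rule energy_sum_le) simp
  also have "\<dots> \<le> (real N * real N)\<^sup>2" by (rule power_mono[OF s]) (simp add: sum_nonneg)
  finally have b: "energy_sum real N x \<le> real N ^ 4" by (simp add: power2_eq_square power4_eq_xxxx mult_ac)
  have "energy_sum (\<lambda>_. 1) N x / real N \<le> real N"
    using a assms by (simp add: pos_divide_le_eq power2_eq_square)
  moreover have "energy_sum real N x / real N ^ 3 \<le> real N"
    using b assms by (simp add: pos_divide_le_eq power4_eq_xxxx power3_eq_cube mult.assoc)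
  ultimately show ?thesis unfolding majorant_def by linarith
qed

lemma circle_integral_majorant: assumes "N > 0" shows "(LINT x|circle. majorant N x) \<le> 4 * pi"
proof -
  have "(LINT x|circle. majorant N x) = (LINT x|circle. energy_sum (\<lambda>_. 1) N x) / real N
      + (LINT x|circle. energy_sum real N x) / real N ^ 3"
    unfolding majorant_def
    by (subst Bochner_Integration.integral_add)
      (use assms in \<open>auto intro!: continuous_integrable_circle continuous_intros energy_sum_continuous\<close>)
  also have "\<dots> = 2 * pi + 2 * pi * (\<Sum>m<N. (real m)\<^sup>2) / real N ^ 3"
    using assms by (simp add: circle_integral_energy_sum)
  also have "(\<Sum>m<N. (real m)\<^sup>2) \<le> real N * (real N)\<^sup>2"
    using sum_bounded_above[of "{..<N}" "\<lambda>m. (real m)\<^sup>2" "(real N)\<^sup>2"] by (simp add: power_mono)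
  then have "2 * pi * (\<Sum>m<N. (real m)\<^sup>2) / real N ^ 3 \<le> 2 * pi"
    using assms by (simp add: divide_simps power2_eq_square power3_eq_cube mult.assoc)
  finally show ?thesis by simp
qed

text \<open>
  With \<open>F = \<bar>D\<bar>\<^sup>2 / N\<close> one has \<open>\<bar>F'\<bar> \<le> 2 \<bar>D\<bar> \<bar>D'\<bar> / N\<close>, and the product is split by the
  inequality between arithmetic and geometric mean, weighted so that both squares come out
  with the normalisation of the majorant.
\<close>

lemma fejer_deriv_le: 
  assumes "N > 0" shows "\<bar>deriv (fejer N) x\<bar> \<le> real N * majorant N x"
proof -
  define c s where "c = (\<Sum>m<N. cos (real m * x))" and "s = (\<Sum>m<N. sin (real m * x))"
  define c' s' where "c' = (\<Sum>m<N. real m * cos (real m * x))" and "s' = (\<Sum>m<N. real m * sin (real m * x))"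
  have "((\<lambda>x. \<Sum>m<N. cos (real m * x)) has_real_derivative - s') (at x)"
    unfolding s'_def sum_negf[symmetric] by (intro DERIV_sum) (auto intro!: derivative_eq_intros)
  moreover have "((\<lambda>x. \<Sum>m<N. sin (real m * x)) has_real_derivative c') (at x)"
    unfolding c'_def by (intro DERIV_sum) (auto intro!: derivative_eq_intros)
  moreover have "((\<lambda>x. ((C x)\<^sup>2 + (S x)\<^sup>2) / real N) has_real_derivative (2 * C x * dC + 2 * S x * dS) / real N) (at x)"
    if "(C has_real_derivative dC) (at x)" "(S has_real_derivative dS) (at x)" for C S :: "real \<Rightarrow> real" and dC dS
    using that assms by (auto intro!: derivative_eq_intros simp: field_simps)
  ultimately have "((\<lambda>x. ((\<Sum>m<N. cos (real m * x))\<^sup>2 + (\<Sum>m<N. sin (real m * x))\<^sup>2) / real N)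
      has_real_derivative (2 * c * (- s') + 2 * s * c') / real N) (at x)"
    unfolding c_def s_def by blast
  then have "(fejer N has_real_derivative 2 * (s * c' - c * s') / real N) (at x)"
    by (simp add: fejer_def[abs_def] energy_sum_def algebra_simps)
  then have d: "deriv (fejer N) x = 2 * (s * c' - c * s') / real N" by (rule DERIV_imp_deriv)
  define n where "n = real N"
  have n: "n > 0" using assms by (simp add: n_def)
  \<comment> \<open>the weighted inequality between the means, from the square of \<open>n \<bar>u\<bar> - \<bar>v\<bar>\<close>\<close>
  have y: "2 * \<bar>u * v\<bar> \<le> n * u\<^sup>2 + v\<^sup>2 / n" for u v :: real
  proof -
    have "0 \<le> (n * \<bar>u\<bar> - \<bar>v\<bar>)\<^sup>2 / n" using n by simp
    also have "\<dots> = n * u\<^sup>2 + v\<^sup>2 / n - 2 * \<bar>u * v\<bar>"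
      using n by (simp add: field_simps power2_eq_square abs_mult)
    finally show ?thesis by simp
  qed
  have "\<bar>2 * (s * c' - c * s')\<bar> \<le> 2 * \<bar>s * c'\<bar> + 2 * \<bar>c * s'\<bar>"
    using abs_triangle_ineq4[of "2 * (s * c')" "2 * (c * s')"] by (simp add: right_diff_distrib abs_mult)
  also have "\<dots> \<le> n * (c\<^sup>2 + s\<^sup>2) + (c'\<^sup>2 + s'\<^sup>2) / n"
    using y[of s c'] y[of c s'] by (simp add: algebra_simps add_divide_distrib)
  finally have "\<bar>deriv (fejer N) x\<bar> \<le> (n * (c\<^sup>2 + s\<^sup>2) + (c'\<^sup>2 + s'\<^sup>2) / n) / n"
    unfolding d n_def[symmetric] using n by (simp add: divide_right_mono)
  also have "\<dots> = n * majorant N x"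
    unfolding majorant_def energy_sum_def n_def[symmetric] c_def s_def c'_def s'_def
    using n by (simp add: field_simps power2_eq_square power3_eq_cube)
  finally show ?thesis by (simp add: n_def)
qed

text \<open>
  For \<open>0 \<le> x \<le> 1 / N\<close> all the phases stay below \<open>pi / 3\<close>, so nothing cancels in the Dirichlet sum.
\<close>

lemma fejer_ge: assumes "0 \<le> x" "real N * x \<le> 1" shows "real N / 4 \<le> fejer N x"
proof (cases "N = 0")
  case False
  have "(\<Sum>m<N. 1/2) \<le> (\<Sum>m<N. 1 * cos (real m * x))"
  proof (rule sum_mono)
    fix m assume "m \<in> {..<N}"
    then have "real m * x \<le> real N * x" using assms by (intro mult_right_mono) auto
    then have "real m * x \<le> pi / 3" using assms(2) pi_gt3 by linarith
    then have "cos (pi / 3) \<le> cos (real m * x)" using assms(1) pi_gt3 by (subst cos_mono_le_eq) auto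
    then show "1/2 \<le> 1 * cos (real m * x)" by (simp add: cos_60)
  qed
  then have "real N / 2 \<le> (\<Sum>m<N. 1 * cos (real m * x))" by simp
  then have "(real N / 2)\<^sup>2 \<le> (\<Sum>m<N. 1 * cos (real m * x))\<^sup>2" by (rule power_mono) simp
  also have "\<dots> \<le> energy_sum (\<lambda>_. 1) N x" by (simp add: energy_sum_def)
  finally show ?thesis using False by (simp add: fejer_def field_simps power2_eq_square)
qed (simp add: fejer_def)

lemma fejer_even: "fejer N (- x) = fejer N x"
  by (simp add: fejer_def energy_sum_def sum_negf)

section \<open>Carrier waves and parity\<close>

text \<open>
  Frequencies within distance \<open>d\<close> of \<open>m\<close> or \<open>- m\<close>: where a carrier wave of frequency \<open>m\<close>,
  modulated by a function of degree below \<open>d\<close>, has its spectrum.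
\<close>

definition band :: "int \<Rightarrow> int \<Rightarrow> int set" where
  "band m d = {k. \<bar>\<bar>k\<bar> - m\<bar> < d}"

lemma finite_band: "finite (band m d)"
  by (rule finite_subset[of _ "{-(\<bar>m\<bar> + \<bar>d\<bar>)..\<bar>m\<bar> + \<bar>d\<bar>}"]) (auto simp: band_def)

lemma fejer_trig1: "trig1 (band 0 (int N)) (fejer N)"
proof -
  have "trig1 (band 0 (int N)) (\<lambda>x. (1 / real N) * (\<Sum>m<N. \<Sum>l<N. 1 * cos (of_int (int m - int l) * x)))"
    by (intro spectrum_in_real_cmult spectrum_in_real_sum finite_band spectrum_in_mono[OF trig1_cos])
       (auto simp: band_def)
  then show ?thesis
    by (simp add: fejer_def[abs_def] energy_sum_expand)
qed

lemma modulate_band: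
  assumes "trig1 (band 0 d) f" "0 \<le> m"
  shows cos_modulate_band: "trig1 (band m d) (\<lambda>x. cos (of_int m * x) * f x)"
    and sin_modulate_band: "trig1 (band m d) (\<lambda>x. sin (of_int m * x) * f x)"
  by (rule trig1_mult[OF trig1_cos assms(1) finite_band] trig1_mult[OF trig1_sin assms(1) finite_band];
      use assms(2) in \<open>force simp: band_def\<close>)+

lemma band0_mult:
  assumes "trig1 (band 0 d) f" "trig1 (band 0 e) g"
  shows "trig1 (band 0 (d + e)) (\<lambda>x. f x * g x)"
  by (rule trig1_mult[OF assms finite_band]) (auto simp: band_def)

text \<open>
  A carrier faster than the degree of its amplitude averages to zero.
\<close>

lemma fast_phase_integral:
  assumes "trig1 (band 0 d) f" "d \<le> m"
  shows fast_cos: "(LINT x|circle. cos (of_int m * x) * f x) = 0"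
    and fast_sin: "(LINT x|circle. sin (of_int m * x) * f x) = 0"
proof -
  have "band 0 d = {}" if "\<not> 0 \<le> m" using that assms(2) by (force simp: band_def)
  then consider "0 \<le> m" | "band 0 d = {}" by blast
  then show "(LINT x|circle. cos (of_int m * x) * f x) = 0" "(LINT x|circle. sin (of_int m * x) * f x) = 0"
  proof (atomize(full), cases)
    case 1
    show "(LINT x|circle. cos (of_int m * x) * f x) = 0 \<and> (LINT x|circle. sin (of_int m * x) * f x) = 0"
      using assms(2) trig1_integral_zero[OF cos_modulate_band[OF assms(1) 1]]
        trig1_integral_zero[OF sin_modulate_band[OF assms(1) 1]] by (auto simp: band_def)
  next
    case 2
    then have "f x = 0" for x using assms(1) by (auto simp: spectrum_in_def)
    then show "(LINT x|circle. cos (of_int m * x) * f x) = 0 \<and> (LINT x|circle. sin (of_int m * x) * f x) = 0"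
      by simp
  qed
qed

text \<open>
  Both sides are the constant Fourier coefficient.
\<close>

lemma trig1_integral_reflect:
  assumes "trig1 K f" shows "(LINT x|circle. f (- x)) = (LINT x|circle. f x)"
proof -
  obtain c where c: "\<And>x. complex_of_real (f x) = (\<Sum>k\<in>K. c k * char1 k x)"
    by (rule spectrum_inE[OF assms(1)]) blast
  have "complex_of_real (LINT x|circle. f (s * x)) = (\<Sum>k\<in>K. c k * (if k = 0 then 2 * pi else 0))"
    if s: "s = 1 \<or> s = -1" for s :: real
  proof -
    have eq: "char1 k (s * x) = char1 (if s = 1 then k else - k) x" for k x using s by auto
    have "complex_of_real (LINT x|circle. f (s * x)) = (LINT x|circle. (\<Sum>k\<in>K. c k * char1 k (s * x)))"
      by (simp flip: c)
    also have "\<dots> = (\<Sum>k\<in>K. c k * (LINT x|circle. char1 k (s * x)))"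
      unfolding eq by (subst Bochner_Integration.integral_sum)
        (auto intro!: continuous_integrable_circle continuous_intros continuous_char1)
    also have "\<dots> = (\<Sum>k\<in>K. c k * (if k = 0 then 2 * pi else 0))"
    proof -
      have "(LINT x|circle. char1 k (s * x)) = (if k = 0 then 2 * pi else 0)" for k
        unfolding eq circle_integral_char1 by simp
      then show ?thesis by (simp only:)
    qed
    finally show ?thesis .
  qed
  from this[of 1] this[of "-1"]
  have "complex_of_real (LINT x|circle. f (- x)) = complex_of_real (LINT x|circle. f x)" by simp
  then show ?thesis by (simp only: of_real_eq_iff)
qed

definition parity :: "real \<Rightarrow> (real \<Rightarrow> real) \<Rightarrow> bool" where
  "parity s f \<longleftrightarrow> (\<forall>x. f (- x) = s * f x)"

lemma odd_integral_zero: 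
  assumes "trig1 K f" "parity (-1) f" shows "(LINT x|circle. f x) = 0"
  using trig1_integral_reflect[OF assms(1)] assms(2) by (simp add: parity_def)

lemma parity_deriv:
  assumes "trig1 K f" "parity s f" shows "parity (- s) (deriv f)"
  unfolding parity_def
proof
  fix x
  have "((\<lambda>x. f (- x)) has_real_derivative - deriv f (- x)) (at x)"
    using trig1_DERIV[OF assms(1), of "- x"] by (simp only: DERIV_mirror)
  moreover have "((\<lambda>x. f (- x)) has_real_derivative s * deriv f x) (at x)"
    using assms(2) by (auto simp: parity_def intro!: derivative_eq_intros trig1_DERIV[OF assms(1)])
  ultimately show "deriv f (- x) = - s * deriv f x" using DERIV_unique by fastforce
qed

lemma trig1_derivs: "trig1 K f \<Longrightarrow> trig1 K ((deriv ^^ i) f)"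
  by (induction i) (auto intro: trig1_deriv')

lemma parity_derivs: "trig1 K f \<Longrightarrow> parity s f \<Longrightarrow> parity ((-1) ^ i * s) ((deriv ^^ i) f)"
proof (induction i)
  case (Suc i)
  then show ?case using parity_deriv[OF trig1_derivs[of K f i]] by simp
qed simp

section \<open>Energy transfer between separated stream functions\<close>

definition triple :: "(real \<Rightarrow> real) \<Rightarrow> (real \<Rightarrow> real) \<Rightarrow> (real \<Rightarrow> real) \<Rightarrow> real" where
  "triple f g h = (LINT x|circle. f x * g x * h x)"

text \<open>
  For stream functions \<open>f = f1(x\<^sub>1) f2(x\<^sub>2)\<close>, \<open>g\<close>, \<open>h\<close> of this form with velocities
  \<open>u\<^sub>f = (- \<partial>\<^sub>2 f, \<partial>\<^sub>1 f)\<close>, this is the integral of \<open>\<Sum>i j. (u\<^sub>f)\<^sub>i (u\<^sub>g)\<^sub>j \<partial>\<^sub>j (u\<^sub>h)\<^sub>i\<close>, that is, of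
  \<open>f\<^sub>1 g\<^sub>1 h\<^sub>1\<^sub>2 - f\<^sub>2 g\<^sub>2 h\<^sub>1\<^sub>2 + f\<^sub>2 g\<^sub>1 h\<^sub>2\<^sub>2 - f\<^sub>1 g\<^sub>2 h\<^sub>1\<^sub>1\<close> with indices for partial derivatives.
\<close>

definition planar_transfer :: "(real \<Rightarrow> real) \<Rightarrow> (real \<Rightarrow> real) \<Rightarrow> (real \<Rightarrow> real) \<Rightarrow> (real \<Rightarrow> real)
    \<Rightarrow> (real \<Rightarrow> real) \<Rightarrow> (real \<Rightarrow> real) \<Rightarrow> real" where
  "planar_transfer f1 f2 g1 g2 h1 h2 =
     triple (deriv f1) (deriv g1) (deriv h1) * triple f2 g2 (deriv h2)
   - triple f1 g1 (deriv h1) * triple (deriv f2) (deriv g2) (deriv h2)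
   + triple f1 (deriv g1) h1 * triple (deriv f2) g2 (deriv (deriv h2))
   - triple (deriv f1) g1 (deriv (deriv h1)) * triple f2 (deriv g2) h2"

lemma trig1_mult_ex: "trig1 K f \<Longrightarrow> trig1 L g \<Longrightarrow> trig1 ((\<lambda>(k, l). k + l) ` (K \<times> L)) (\<lambda>x. f x * g x)"
  by (rule trig1_mult) (auto dest: spectrum_in_finite)

lemma triple_commute: "triple f g h = triple h g f"
  by (simp add: triple_def mult_ac)

lemma triple_parts:
  assumes "trig1 K f" "trig1 L g" "trig1 M h"
  shows "triple (deriv f) g h + triple f (deriv g) h + triple f g (deriv h) = 0"
proof -
  have fgh: "trig1 ((\<lambda>(k, l). k + l) ` ((\<lambda>(k, l). k + l) ` (K \<times> L) \<times> M)) (\<lambda>x. f x * g x * h x)"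
    by (intro trig1_mult_ex assms)
  have D: "deriv (\<lambda>x. f x * g x * h x) x = deriv f x * g x * h x + f x * deriv g x * h x + f x * g x * deriv h x" for x
    by (rule DERIV_imp_deriv) 
      (auto intro!: derivative_eq_intros trig1_DERIV[OF assms(1)] trig1_DERIV[OF assms(2)] trig1_DERIV[OF assms(3)]
        simp: algebra_simps)
  have c: "continuous_on UNIV f" "continuous_on UNIV g" "continuous_on UNIV h"
    "continuous_on UNIV (deriv f)" "continuous_on UNIV (deriv g)" "continuous_on UNIV (deriv h)"
    using assms by (auto intro: trig1_continuous trig1_deriv')
  have "0 = (LINT x|circle. deriv f x * g x * h x + f x * deriv g x * h x + f x * g x * deriv h x)"
    using circle_integral_deriv[OF fgh] by (simp add: D)
  also have "\<dots> = triple (deriv f) g h + triple f (deriv g) h + triple f g (deriv h)"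
    unfolding triple_def
    by (subst Bochner_Integration.integral_add Bochner_Integration.integral_add;
        (intro continuous_integrable_circle continuous_intros c)?)+ simp
  finally show ?thesis by simp
qed

text \<open>
  Advection by a divergence-free \<open>u\<^sub>g\<close> conserves energy: \<open>\<integral> u\<^sub>f \<cdot> (u\<^sub>g \<cdot> \<nabla>) u\<^sub>h\<close> is antisymmetric in \<open>f\<close>
  and \<open>h\<close>. For separated variables this reduces to integrations by parts in each variable.
\<close>

lemma planar_transfer_antisym:
  assumes "trig1 K1 f1" "trig1 K2 f2" "trig1 L1 g1" "trig1 L2 g2" "trig1 M1 h1" "trig1 M2 h2"
  shows "planar_transfer f1 f2 g1 g2 h1 h2 + planar_transfer h1 h2 g1 g2 f1 f2 = 0"
proof -
  note d = trig1_deriv'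
  note p1 = triple_parts[OF assms(1,3,5)] and p2 = triple_parts[OF assms(2,4,6)]
  have q1: "triple (deriv f1) g1 (deriv (deriv h1)) = - triple (deriv f1) (deriv g1) (deriv h1) - triple (deriv (deriv f1)) g1 (deriv h1)"
    using triple_parts[OF d[OF assms(1)] assms(3) d[OF assms(5)]] by simp
  have q2: "triple (deriv f2) g2 (deriv (deriv h2)) = - triple (deriv f2) (deriv g2) (deriv h2) - triple (deriv (deriv f2)) g2 (deriv h2)"
    using triple_parts[OF d[OF assms(2)] assms(4) d[OF assms(6)]] by simp
  have p1': "triple f1 g1 (deriv h1) = - triple (deriv f1) g1 h1 - triple f1 (deriv g1) h1" using p1 by simp
  have p2': "triple f2 g2 (deriv h2) = - triple (deriv f2) g2 h2 - triple f2 (deriv g2) h2" using p2 by simp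
  show ?thesis
    unfolding planar_transfer_def triple_commute[of h1] triple_commute[of h2] triple_commute[of "deriv h1"]
      triple_commute[of "deriv h2"] q1 q2 p1' p2' by (simp add: algebra_simps)
qed

text \<open>
  Each of the four terms carries an odd number of derivatives in each variable. Hence one variable
  alone can make the whole expression vanish, for reasons of frequency or of parity.
\<close>

lemma planar_transfer_zero_first:
  assumes "\<And>i j k. odd (i + j + k) \<Longrightarrow> triple ((deriv ^^ i) f1) ((deriv ^^ j) g1) ((deriv ^^ k) h1) = 0"
  shows "planar_transfer f1 f2 g1 g2 h1 h2 = 0"
  using assms[of 1 1 1] assms[of 0 0 1] assms[of 0 1 0] assms[of 1 0 "Suc 1"]
  by (simp add: planar_transfer_def)

lemma planar_transfer_zero_second:
  assumes "\<And>i j k. odd (i + j + k) \<Longrightarrow> triple ((deriv ^^ i) f2) ((deriv ^^ j) g2) ((deriv ^^ k) h2) = 0"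
  shows "planar_transfer f1 f2 g1 g2 h1 h2 = 0"
  using assms[of 1 1 1] assms[of 0 0 1] assms[of 0 1 0] assms[of 1 0 "Suc 1"]
  by (simp add: planar_transfer_def)

lemma triple_zero_frequency:
  assumes "trig1 K f" "trig1 L g" "trig1 M h" "\<And>k l m. k \<in> K \<Longrightarrow> l \<in> L \<Longrightarrow> m \<in> M \<Longrightarrow> k + l + m \<noteq> 0"
  shows "triple f g h = 0"
  unfolding triple_def
  by (rule trig1_integral_zero[OF trig1_mult_ex[OF trig1_mult_ex[OF assms(1,2)] assms(3)]])
     (auto dest: assms(4)[THEN not_sym])

lemma triple_zero_parity:
  assumes "trig1 K f" "trig1 L g" "trig1 M h" "parity r f" "parity s g" "parity t h" "r * s * t = -1"
  shows "triple f g h = 0"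
  unfolding triple_def
proof (rule odd_integral_zero[OF trig1_mult_ex[OF trig1_mult_ex[OF assms(1,2)] assms(3)]])
  show "parity (- 1) (\<lambda>x. f x * g x * h x)"
    using assms(4-6) unfolding assms(7)[symmetric] by (simp add: parity_def)
qed

lemma triple_derivs_zero_frequency:
  assumes "trig1 K f" "trig1 L g" "trig1 M h" "\<And>k l m. k \<in> K \<Longrightarrow> l \<in> L \<Longrightarrow> m \<in> M \<Longrightarrow> k + l + m \<noteq> 0"
  shows "triple ((deriv ^^ i) f) ((deriv ^^ j) g) ((deriv ^^ k) h) = 0"
  by (rule triple_zero_frequency[OF assms(1-3)[THEN trig1_derivs] assms(4)])

text \<open>
  Three functions with an even product acquire an odd product after an odd number of derivatives.
\<close>

lemma triple_derivs_zero_parity: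
  assumes "trig1 K f" "trig1 L g" "trig1 M h" "parity r f" "parity s g" "parity t h" "r * s * t = 1"
    and "odd (i + j + k)"
  shows "triple ((deriv ^^ i) f) ((deriv ^^ j) g) ((deriv ^^ k) h) = 0"
proof (rule triple_zero_parity[OF assms(1-3)[THEN trig1_derivs]])
  show "parity ((-1) ^ i * r) ((deriv ^^ i) f)" "parity ((-1) ^ j * s) ((deriv ^^ j) g)" "parity ((-1) ^ k * t) ((deriv ^^ k) h)"
    by (rule parity_derivs[OF assms(1,4)] parity_derivs[OF assms(2,5)] parity_derivs[OF assms(3,6)])+
  have "(- 1) ^ i * r * ((- 1) ^ j * s) * ((- 1) ^ k * t) = (-1) ^ (i + j + k) * (r * s * t)"
    by (simp add: power_add)
  then show "(- 1) ^ i * r * ((- 1) ^ j * s) * ((- 1) ^ k * t) = - 1"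
    using assms(7,8) by simp
qed

lemma modulated_deriv:
  assumes "trig1 K f"
  shows deriv_cos_mult: "deriv (\<lambda>x. cos (m * x) * f x) = (\<lambda>x. - m * sin (m * x) * f x + cos (m * x) * deriv f x)"
    and deriv_sin_mult: "deriv (\<lambda>x. sin (m * x) * f x) = (\<lambda>x. m * cos (m * x) * f x + sin (m * x) * deriv f x)"
  by (rule ext, rule DERIV_imp_deriv, auto intro!: derivative_eq_intros trig1_DERIV[OF assms])+

context
  fixes F :: "real \<Rightarrow> real" and d e :: int
  assumes F: "trig1 (band 0 d) F"
begin

lemma trig1_dF: "trig1 (band 0 d) (deriv F)" by (rule trig1_deriv'[OF F])

text \<open>
  The carriers \<open>cos (b x)\<close> and \<open>sin (b x)\<close> on the same slow amplitude \<open>F\<close>: products are rewritten with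
  the double angle \<open>2 b x\<close>, which oscillates too fast to contribute, and only the mean of
  \<open>cos\<^sup>2\<close> or \<open>sin\<^sup>2\<close> survives. In the first two products there is no such mean.
\<close>

lemma carrier_products:
  fixes P :: "real \<Rightarrow> real" and b :: int
  assumes P: "trig1 (band 0 e) P" and b: "d + d + e \<le> 2 * b"
  defines "B \<equiv> (\<lambda>x. cos (of_int b * x) * F x)" and "C \<equiv> (\<lambda>x. sin (of_int b * x) * F x)"
  shows "triple B C P = 0" "triple (deriv B) (deriv C) P = 0"
    "triple B (deriv C) P = of_int b / 2 * triple F F P" "triple (deriv B) C P = - (of_int b / 2) * triple F F P"
proof -
  let ?c = "\<lambda>x::real. cos (of_int (2 * b) * x)" and ?s = "\<lambda>x::real. sin (of_int (2 * b) * x)"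
  have B': "deriv B = (\<lambda>x. - of_int b * sin (of_int b * x) * F x + cos (of_int b * x) * deriv F x)"
    and C': "deriv C = (\<lambda>x. of_int b * cos (of_int b * x) * F x + sin (of_int b * x) * deriv F x)"
    unfolding B_def C_def by (rule modulated_deriv[OF F])+
  have t: "trig1 (band 0 (d + d + e)) (\<lambda>x. F x * F x * P x)"
     "trig1 (band 0 (d + d + e)) (\<lambda>x. F x * deriv F x * P x)"
     "trig1 (band 0 (d + d + e)) (\<lambda>x. deriv F x * deriv F x * P x)"
    by (intro band0_mult F trig1_dF P)+
  have z: "(LINT x|circle. ?c x * f x) = 0" "(LINT x|circle. ?s x * f x) = 0"
    if "trig1 (band 0 (d + d + e)) f" for f
    using fast_phase_integral[OF that b] .
  have i: "integrable circle (\<lambda>x. ?c x * f x)" "integrable circle (\<lambda>x. ?s x * f x)"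
     "integrable circle f"
    if "trig1 (band 0 (d + d + e)) f" for f
    by (intro continuous_integrable_circle continuous_intros trig1_continuous[OF that])+
  have dbl: "?s x = 2 * sin (of_int b * x) * cos (of_int b * x)"
     "?c x = cos (of_int b * x) * cos (of_int b * x) - sin (of_int b * x) * sin (of_int b * x)"
     "sin (of_int b * x) * sin (of_int b * x) = 1 - cos (of_int b * x) * cos (of_int b * x)" for x :: real
    using sin_double[of "of_int b * x"] cos_double[of "of_int b * x"] sin_squared_eq[of "of_int b * x"]
    by (simp_all add: mult_ac power2_eq_square)
  have sum0: "(LINT x|circle. p * (?c x * f x) + q * (?s x * g x)
      + r * (?s x * h x) + s * h' x) = s * (LINT x|circle. h' x)"
    if "trig1 (band 0 (d + d + e)) f" "trig1 (band 0 (d + d + e)) g" "trig1 (band 0 (d + d + e)) h" "trig1 (band 0 (d + d + e)) h'"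
    for p q r s f g h h'
    using i[OF that(1)] i[OF that(2)] i[OF that(3)] i[OF that(4)]
    by (simp add: z[OF that(1)] z[OF that(2)] z[OF that(3)] del: of_int_mult)
  have "triple B C P = (LINT x|circle. 0 * (?c x * (F x * F x * P x))
     + 1/2 * (?s x * (F x * F x * P x)) + 0 * (?s x * (F x * F x * P x))
     + 0 * (F x * F x * P x))"
    unfolding triple_def B_def C_def by (simp only: dbl) (simp add: mult_ac)
  then show "triple B C P = 0" by (subst (asm) sum0) (use t in simp_all)
  have "triple (deriv B) (deriv C) P = (LINT x|circle. of_int b * (?c x * (F x * deriv F x * P x))
     + 1/2 * (?s x * (deriv F x * deriv F x * P x))
     + (- (of_int b)\<^sup>2 / 2) * (?s x * (F x * F x * P x))
     + 0 * (F x * F x * P x))"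
    unfolding triple_def B' C' by (simp only: dbl(1,2)) (simp add: algebra_simps power2_eq_square)
  then show "triple (deriv B) (deriv C) P = 0" by (subst (asm) sum0) (use t in simp_all)
  have "triple B (deriv C) P = (LINT x|circle. (of_int b / 2) * (?c x * (F x * F x * P x))
     + 1/2 * (?s x * (F x * deriv F x * P x))
     + 0 * (?s x * (F x * F x * P x))
     + (of_int b / 2) * (F x * F x * P x))"
    unfolding triple_def B_def C'
    by (rule Bochner_Integration.integral_cong[OF refl], simp only: dbl) (simp add: field_simps)
  then show "triple B (deriv C) P = of_int b / 2 * triple F F P"
    by (subst (asm) sum0) (use t in \<open>simp_all add: triple_def\<close>)
  have "triple (deriv B) C P = (LINT x|circle. (of_int b / 2) * (?c x * (F x * F x * P x))
     + 1/2 * (?s x * (F x * deriv F x * P x))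
     + 0 * (?s x * (F x * F x * P x))
     + (- (of_int b / 2)) * (F x * F x * P x))"
  proof -
    have "(- of_int b * sin (of_int b * x) * F x + cos (of_int b * x) * deriv F x) * (sin (of_int b * x) * F x) * P x
      = (of_int b / 2) * ((1 - 2 * (sin (of_int b * x) * sin (of_int b * x))) * (F x * F x * P x))
     + 1/2 * (2 * sin (of_int b * x) * cos (of_int b * x) * (F x * deriv F x * P x))
     + 0 * (2 * sin (of_int b * x) * cos (of_int b * x) * (F x * F x * P x))
     + (- (of_int b / 2)) * (F x * F x * P x)" for x
      by (simp add: field_simps)
    moreover have "1 - 2 * (sin (of_int b * x) * sin (of_int b * x)) = ?c x" for x :: real
      using dbl(2)[of x] dbl(3)[of x] by simp
    ultimately show ?thesis unfolding triple_def B' C_def dbl(1) by (simp del: of_int_mult)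
  qed
  then show "triple (deriv B) C P = - (of_int b / 2) * triple F F P"
    by (subst (asm) sum0) (use t in \<open>simp_all add: triple_def\<close>)
qed

text \<open>
  In the Wronskian of \<open>sin (y x) F\<close> and \<open>cos (z x) F\<close> the derivatives of \<open>F\<close> cancel. What remains is
  \<open>F\<^sup>2\<close> times waves of frequency \<open>z - y\<close> and \<open>z + y\<close>, and only the first one resonates with a wave of
  frequency \<open>z - y\<close>.
\<close>

lemma wronskian_products:
  fixes P :: "real \<Rightarrow> real" and y z :: int
  assumes P: "trig1 (band 0 e) P" and yz: "d + d + e \<le> 2 * y" "d + d + e \<le> 2 * z" "d + d + e \<le> 2 * (z - y)"
  defines "B \<equiv> (\<lambda>x. sin (of_int y * x) * F x)" and "C \<equiv> (\<lambda>x. cos (of_int z * x) * F x)"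
  defines "W \<equiv> (\<lambda>x. deriv B x * C x - B x * deriv C x)"
  shows "(LINT x|circle. W x * (cos (of_int (z - y) * x) * P x)) = of_int (y + z) / 4 * triple F F P"
    and "(LINT x|circle. W x * (sin (of_int (z - y) * x) * P x)) = 0"
proof -
  have B': "deriv B = (\<lambda>x. of_int y * cos (of_int y * x) * F x + sin (of_int y * x) * deriv F x)"
    and C': "deriv C = (\<lambda>x. - of_int z * sin (of_int z * x) * F x + cos (of_int z * x) * deriv F x)"
    unfolding B_def C_def by (rule modulated_deriv[OF F])+
  have W: "W x = (of_int (y + z) / 2 * cos (of_int (z - y) * x) + of_int (y - z) / 2 * cos (of_int (z + y) * x)) * (F x * F x)" for x
  proof -
    have "W x = (of_int y * (cos (of_int y * x) * cos (of_int z * x)) + of_int z * (sin (of_int y * x) * sin (of_int z * x))) * (F x * F x)"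
      unfolding W_def B' C' unfolding B_def C_def by (simp add: algebra_simps)
    also have "cos (of_int y * x) * cos (of_int z * x) = (cos (of_int (z - y) * x) + cos (of_int (z + y) * x)) / 2"
      by (simp add: algebra_simps cos_add cos_diff)
    also have "sin (of_int y * x) * sin (of_int z * x) = (cos (of_int (z - y) * x) - cos (of_int (z + y) * x)) / 2"
      by (simp add: algebra_simps cos_add cos_diff)
    finally show ?thesis by (simp add: algebra_simps add_divide_distrib diff_divide_distrib)
  qed
  have t: "trig1 (band 0 (d + d + e)) (\<lambda>x. F x * F x * P x)" by (intro band0_mult F P)
  note c = trig1_continuous[OF t]
  have i: "integrable circle (\<lambda>x. cos (of_int m * x) * (F x * F x * P x))" "integrable circle (\<lambda>x. sin (of_int m * x) * (F x * F x * P x))"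
     "integrable circle (\<lambda>x. F x * F x * P x)" for m :: int
    by (intro continuous_integrable_circle continuous_intros c)+
  have k: "2 * (z - y) = (z - y) + (z - y)" "2 * y = (z + y) - (z - y)" "2 * z = (z + y) + (z - y)" by simp_all
  note z = fast_phase_integral[OF t yz(1)] fast_phase_integral[OF t yz(2)] fast_phase_integral[OF t yz(3)]
  have "(LINT x|circle. W x * (cos (of_int (z - y) * x) * P x))
     = (LINT x|circle. of_int (y + z) / 4 * (F x * F x * P x)
        + of_int (y + z) / 4 * (cos (of_int (2 * (z - y)) * x) * (F x * F x * P x))
        + of_int (y - z) / 4 * (cos (of_int (2 * y) * x) * (F x * F x * P x))
        + of_int (y - z) / 4 * (cos (of_int (2 * z) * x) * (F x * F x * P x)))"
    (is "_ = (LINT x|circle. ?R x)")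
  proof (rule Bochner_Integration.integral_cong[OF refl])
    fix x :: real
    have "cos (of_int (2 * (z - y)) * x) = 2 * cos (of_int (z - y) * x) * cos (of_int (z - y) * x) - 1"
      using cos_double_cos[of "real_of_int (z - y) * x"] by (simp add: power2_eq_square mult_ac)
    moreover have "cos (of_int (2 * y) * x) + cos (of_int (2 * z) * x) = 2 * cos (of_int (z + y) * x) * cos (of_int (z - y) * x)"
      unfolding k(2,3) of_int_diff[of "z + y"] of_int_add[of "z + y"] distrib_right left_diff_distrib cos_add cos_diff by simp
    ultimately show "W x * (cos (of_int (z - y) * x) * P x) = ?R x"
      unfolding W by algebra
  qed
  also have "\<dots> = of_int (y + z) / 4 * triple F F P"
    using i(3) i(1)[of "2 * (z - y)"] i(1)[of "2 * y"] i(1)[of "2 * z"]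
    by (simp add: z triple_def del: of_int_mult of_int_diff of_int_add right_diff_distrib_numeral)
  finally show "(LINT x|circle. W x * (cos (of_int (z - y) * x) * P x)) = of_int (y + z) / 4 * triple F F P" .
  have "(LINT x|circle. W x * (sin (of_int (z - y) * x) * P x))
     = (LINT x|circle. of_int (y + z) / 4 * (sin (of_int (2 * (z - y)) * x) * (F x * F x * P x))
        + of_int (y - z) / 4 * (sin (of_int (2 * z) * x) * (F x * F x * P x))
        + (- (of_int (y - z) / 4)) * (sin (of_int (2 * y) * x) * (F x * F x * P x)))"
    (is "_ = (LINT x|circle. ?R x)")
  proof (rule Bochner_Integration.integral_cong[OF refl])
    fix x :: real
    have "sin (of_int (2 * (z - y)) * x) = 2 * sin (of_int (z - y) * x) * cos (of_int (z - y) * x)"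
      using sin_double[of "real_of_int (z - y) * x"] by (simp add: mult_ac)
    moreover have "sin (of_int (2 * z) * x) - sin (of_int (2 * y) * x) = 2 * cos (of_int (z + y) * x) * sin (of_int (z - y) * x)"
      unfolding k(2,3) of_int_diff[of "z + y"] of_int_add[of "z + y"] distrib_right left_diff_distrib sin_add sin_diff by simp
    ultimately show "W x * (sin (of_int (z - y) * x) * P x) = ?R x"
      unfolding W by algebra
  qed
  also have "\<dots> = 0"
    using i(2)[of "2 * (z - y)"] i(2)[of "2 * y"] i(2)[of "2 * z"]
    by (simp add: z del: of_int_mult of_int_diff of_int_add right_diff_distrib_numeral)
  finally show "(LINT x|circle. W x * (sin (of_int (z - y) * x) * P x)) = 0" .
qed

text \<open>
  The transfer of one resonant triad, without error terms. In the first variable everything is a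
  multiple of \<open>\<integral> F\<^sup>2 G\<close> or \<open>\<integral> F\<^sup>2 G''\<close>, in the second variable only the Wronskian enters, and the
  contributions containing \<open>G''\<close> cancel between the two variables. The result has a definite sign.
\<close>

lemma planar_transfer_exact:
  fixes G :: "real \<Rightarrow> real" and b y z :: int
  assumes G: "trig1 (band 0 e) G" and fr: "d + d + e \<le> 2 * b" "d + d + e \<le> 2 * y" "d + d + e \<le> 2 * z" "d + d + e \<le> 2 * (z - y)"
  defines "B1 \<equiv> (\<lambda>x. cos (of_int b * x) * F x)" and "B2 \<equiv> (\<lambda>x. sin (of_int y * x) * F x)"
    and "C1 \<equiv> (\<lambda>x. sin (of_int b * x) * F x)" and "C2 \<equiv> (\<lambda>x. cos (of_int z * x) * F x)"
    and "A2 \<equiv> (\<lambda>x. cos (of_int (z - y) * x) * G x)"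
  shows "planar_transfer B1 B2 C1 C2 G A2 + planar_transfer C1 C2 B1 B2 G A2
     = - (of_int b * of_int (y + z) * (of_int (z - y))\<^sup>2 / 8) * (triple F F G)\<^sup>2"
proof -
  let ?a = "real_of_int (z - y)"
  have G': "trig1 (band 0 e) (deriv G)" "trig1 (band 0 e) (deriv (deriv G))"
    using G by (auto intro!: trig1_deriv')
  note g0 = carrier_products[OF G fr(1), folded B1_def C1_def]
   and g1 = carrier_products[OF G'(1) fr(1), folded B1_def C1_def]
   and g2 = carrier_products[OF G'(2) fr(1), folded B1_def C1_def]
  have sw: "triple C1 B1 P = triple B1 C1 P" "triple (deriv C1) (deriv B1) P = triple (deriv B1) (deriv C1) P"
     "triple C1 (deriv B1) P = triple (deriv B1) C1 P" "triple (deriv C1) B1 P = triple B1 (deriv C1) P" for P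
    by (simp_all add: triple_def mult_ac)
  have cB: "continuous_on UNIV B2" "continuous_on UNIV C2"
    unfolding B2_def C2_def by (intro continuous_intros trig1_continuous[OF F])+
  have cB': "continuous_on UNIV (deriv B2)" "continuous_on UNIV (deriv C2)"
    unfolding B2_def C2_def modulated_deriv[OF F] by (intro continuous_intros trig1_continuous[OF F] trig1_continuous[OF trig1_dF])+
  have A2': "deriv A2 = (\<lambda>x. - ?a * sin (?a * x) * G x + cos (?a * x) * deriv G x)"
    unfolding A2_def by (rule modulated_deriv[OF G])
  have A2'': "deriv (deriv A2) = (\<lambda>x. - ?a\<^sup>2 * (cos (?a * x) * G x) + (- 2 * ?a) * (sin (?a * x) * deriv G x)
      + cos (?a * x) * deriv (deriv G) x)"
    unfolding A2' by (rule ext, rule DERIV_imp_deriv)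
      (auto intro!: derivative_eq_intros trig1_DERIV[OF G] trig1_DERIV[OF G'(1)] simp: power2_eq_square algebra_simps)
  let ?W = "\<lambda>x. deriv B2 x * C2 x - B2 x * deriv C2 x"
  have w: "(LINT x|circle. ?W x * (cos (?a * x) * P x)) = of_int (y + z) / 4 * triple F F P"
     "(LINT x|circle. ?W x * (sin (?a * x) * P x)) = 0" if "trig1 (band 0 e) P" for P
    unfolding B2_def C2_def by (rule wronskian_products[OF that fr(2-4)])+
  have cA: "continuous_on UNIV A2" "continuous_on UNIV (deriv (deriv A2))"
    unfolding A2'' unfolding A2_def
    by (intro continuous_intros trig1_continuous[OF G] trig1_continuous[OF G'(1)] trig1_continuous[OF G'(2)])+
  have split: "triple (deriv B2) C2 Q - triple (deriv C2) B2 Q = (LINT x|circle. ?W x * Q x)"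
    if "continuous_on UNIV Q" for Q
    unfolding triple_def
    by (subst Bochner_Integration.integral_diff[symmetric])
      (auto intro!: continuous_integrable_circle continuous_intros cB cB' that Bochner_Integration.integral_cong simp: algebra_simps)
  have WA: "(LINT x|circle. ?W x * A2 x) = of_int (y + z) / 4 * triple F F G"
    unfolding A2_def by (rule w(1)[OF G])
  have WA'': "(LINT x|circle. ?W x * deriv (deriv A2) x) = of_int (y + z) / 4 * (- ?a\<^sup>2 * triple F F G + triple F F (deriv (deriv G)))"
  proof -
    have cW: "continuous_on UNIV ?W" by (intro continuous_intros cB cB')
    have "(LINT x|circle. ?W x * deriv (deriv A2) x)
      = (LINT x|circle. - ?a\<^sup>2 * (?W x * (cos (?a * x) * G x)) + (- 2 * ?a) * (?W x * (sin (?a * x) * deriv G x))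
          + ?W x * (cos (?a * x) * deriv (deriv G) x))"
      unfolding A2'' by (intro Bochner_Integration.integral_cong refl) algebra
    also have "\<dots> = - ?a\<^sup>2 * (LINT x|circle. ?W x * (cos (?a * x) * G x))
       + (- 2 * ?a) * (LINT x|circle. ?W x * (sin (?a * x) * deriv G x))
       + (LINT x|circle. ?W x * (cos (?a * x) * deriv (deriv G) x))"
    proof -
      have ints: "integrable circle (\<lambda>x. ?W x * (cos (?a * x) * G x))" "integrable circle (\<lambda>x. ?W x * (sin (?a * x) * deriv G x))"
        "integrable circle (\<lambda>x. ?W x * (cos (?a * x) * deriv (deriv G) x))"
        by (intro continuous_integrable_circle continuous_on_mult cW trig1_continuous[OF G] trig1_continuous[OF G'(1)]
           trig1_continuous[OF G'(2)] continuous_intros)+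
      show ?thesis using ints by (simp only: Bochner_Integration.integral_add integrable_mult_right Bochner_Integration.integrable_add integral_mult_right_zero)
    qed
    finally show ?thesis unfolding w(1)[OF G] w(2)[OF G'(1)] w(1)[OF G'(2)]
      by (simp add: algebra_simps del: of_int_add of_int_diff)
  qed
  have "planar_transfer B1 B2 C1 C2 G A2 + planar_transfer C1 C2 B1 B2 G A2
     = of_int b / 2 * triple F F G * (triple (deriv B2) C2 (deriv (deriv A2)) - triple (deriv C2) B2 (deriv (deriv A2)))
     - of_int b / 2 * triple F F (deriv (deriv G)) * (triple (deriv B2) C2 A2 - triple (deriv C2) B2 A2)"
    unfolding planar_transfer_def sw g0 g1 g2 triple_def[of C2 "deriv B2"] triple_def[of B2 "deriv C2"]
    by (simp add: algebra_simps triple_def)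
  also have "\<dots> = - (of_int b * of_int (y + z) * ?a\<^sup>2 / 8) * (triple F F G)\<^sup>2"
    unfolding split[OF cA(1)] split[OF cA(2)] WA WA''
    by (simp add: field_simps power2_eq_square del: of_int_add of_int_diff)
  finally show ?thesis .
qed

end

section \<open>Three waves and their resonances\<close>

text \<open>
  Three types of waves, at scale \<open>N\<close>, with stream functions in \<open>(x\<^sub>1, x\<^sub>2)\<close> given by the Fejer kernel
  in each variable times
  \<open>cos (136 N x\<^sub>2)\<close>, \<open>cos (130 N x\<^sub>1) sin (20 N x\<^sub>2)\<close> and \<open>sin (130 N x\<^sub>1) cos (54 N x\<^sub>2)\<close>.

  The carriers are chosen so that all frequencies, including the spread \<open>N\<close> of the kernels, have
  modulus between \<open>128 N\<close> and \<open>128 N * sqrt 5 / 2\<close>, and so that \<open>54 - 20 = 136 / 4\<close>: an \<open>Axial\<close> wave is in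
  resonance with the two other waves one scale (a factor \<open>4\<close>) higher. The combination of sines
  and cosines gives the three types parities in \<open>x\<^sub>1\<close> and \<open>x\<^sub>2\<close> for which a triad can transfer energy
  only if it contains every type once.
\<close>

datatype wave = Axial | CosSin | SinCos

fun prof1 :: "wave \<Rightarrow> nat \<Rightarrow> real \<Rightarrow> real" where
  "prof1 Axial N = fejer N"
| "prof1 CosSin N = (\<lambda>x. cos (of_int (130 * int N) * x) * fejer N x)"
| "prof1 SinCos N = (\<lambda>x. sin (of_int (130 * int N) * x) * fejer N x)"

fun prof2 :: "wave \<Rightarrow> nat \<Rightarrow> real \<Rightarrow> real" where
  "prof2 Axial N = (\<lambda>x. cos (of_int (136 * int N) * x) * fejer N x)"
| "prof2 CosSin N = (\<lambda>x. sin (of_int (20 * int N) * x) * fejer N x)"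
| "prof2 SinCos N = (\<lambda>x. cos (of_int (54 * int N) * x) * fejer N x)"

fun carrier1 :: "wave \<Rightarrow> int" where
  "carrier1 Axial = 0" | "carrier1 CosSin = 130" | "carrier1 SinCos = 130"

fun carrier2 :: "wave \<Rightarrow> int" where
  "carrier2 Axial = 136" | "carrier2 CosSin = 20" | "carrier2 SinCos = 54"

fun sign1 :: "wave \<Rightarrow> real" where
  "sign1 Axial = 1" | "sign1 CosSin = 1" | "sign1 SinCos = -1"

fun sign2 :: "wave \<Rightarrow> real" where
  "sign2 Axial = 1" | "sign2 CosSin = -1" | "sign2 SinCos = 1"

lemma prof1_trig1: "trig1 (band (carrier1 w * int N) (int N)) (prof1 w N)"
  by (cases w; simp only: prof1.simps carrier1.simps mult_zero_left;
      intro fejer_trig1 cos_modulate_band sin_modulate_band; simp)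

lemma prof2_trig1: "trig1 (band (carrier2 w * int N) (int N)) (prof2 w N)"
  by (cases w; simp only: prof2.simps carrier2.simps mult_zero_left;
      intro fejer_trig1 cos_modulate_band sin_modulate_band; simp)

lemma prof1_parity: "parity (sign1 w) (prof1 w N)"
  by (cases w) (simp_all add: parity_def fejer_even)

lemma prof2_parity: "parity (sign2 w) (prof2 w N)"
  by (cases w) (simp_all add: parity_def fejer_even)

abbreviation wave_transfer :: "wave \<times> nat \<Rightarrow> wave \<times> nat \<Rightarrow> wave \<times> nat \<Rightarrow> real" where
  "wave_transfer X Y Z \<equiv> planar_transfer
     (prof1 (fst X) (4 ^ snd X)) (prof2 (fst X) (4 ^ snd X))
     (prof1 (fst Y) (4 ^ snd Y)) (prof2 (fst Y) (4 ^ snd Y))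
     (prof1 (fst Z) (4 ^ snd Z)) (prof2 (fst Z) (4 ^ snd Z))"

lemma wave_transfer_antisym: "wave_transfer X Y Z + wave_transfer Z Y X = 0"
  by (rule planar_transfer_antisym; rule prof1_trig1 prof2_trig1)

lemma power4_mono_less: "p < q \<Longrightarrow> 4 * 4 ^ p \<le> (4::int) ^ q"
  using power_increasing[of "Suc p" q "4::int"] by simp

text \<open>
  If \<open>p \<noteq> q\<close>, the first carriers of the two
  higher waves leave a frequency of at least \<open>96\<close> times the larger scale, which only an \<open>Axial\<close> wave of
  a scale exceeding this could compensate; but then its second carrier is out of reach.
  If \<open>p = q\<close>, the second carriers differ by about \<open>34\<close> and add up to about \<open>74\<close> times \<open>4 ^ p\<close>, while
  the \<open>Axial\<close> one is about \<open>136 * 4 ^ r\<close>.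
\<close>

lemma resonance_scales:
  assumes "\<not> (p = q \<and> p = Suc r)"
  shows "(\<forall>k\<in>band 0 (4 ^ r). \<forall>l\<in>band (130 * 4 ^ p) (4 ^ p). \<forall>m\<in>band (130 * 4 ^ q) (4 ^ q). k + l + m \<noteq> 0)
    \<or> (\<forall>k\<in>band (136 * 4 ^ r) (4 ^ r). \<forall>l\<in>band (20 * 4 ^ p) (4 ^ p). \<forall>m\<in>band (54 * 4 ^ q) (4 ^ q). k + l + m \<noteq> 0)"
proof -
  define a b c :: int where "a = 4 ^ r" and "b = 4 ^ p" and "c = 4 ^ q"
  have pos: "0 < a" "0 < b" "0 < c" by (simp_all add: a_def b_def c_def)
  have first: "\<forall>k\<in>band 0 a. \<forall>l\<in>band (130 * b) b. \<forall>m\<in>band (130 * c) c. k + l + m \<noteq> 0"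
    if "4 * c \<le> b \<and> a \<le> 96 * b \<or> 4 * b \<le> c \<and> a \<le> 96 * c"
  proof (intro ballI)
    fix k l m assume "k \<in> band 0 a" "l \<in> band (130 * b) b" "m \<in> band (130 * c) c"
    then show "k + l + m \<noteq> 0" using that pos unfolding band_def mem_Collect_eq by (smt (verit))
  qed
  have second: "\<forall>k\<in>band (136 * a) a. \<forall>l\<in>band (20 * b) b. \<forall>m\<in>band (54 * c) c. k + l + m \<noteq> 0"
    if "4 * c \<le> b \<and> 96 * b < a \<or> 4 * b \<le> c \<and> 96 * c < a \<or> b = c \<and> (b \<le> a \<or> 16 * a \<le> b)"
  proof (intro ballI)
    fix k l m assume "k \<in> band (136 * a) a" "l \<in> band (20 * b) b" "m \<in> band (54 * c) c"
    then show "k + l + m \<noteq> 0" using that pos unfolding band_def mem_Collect_eq by (smt (verit))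
  qed
  have "4 * c \<le> b \<or> 4 * b \<le> c \<or> b = c \<and> (b \<le> a \<or> 16 * a \<le> b)"
  proof (cases p q rule: linorder_cases)
    case equal
    then have "p \<le> r \<or> Suc r < p" using assms by linarith
    then show ?thesis
      using equal power4_mono_less[of "Suc r" p] power_increasing[of p r "4::int"] by (auto simp: a_def b_def c_def)
  qed (simp_all add: b_def c_def power4_mono_less)
  then show ?thesis using first second unfolding a_def b_def c_def by linarith
qed

text \<open>
  The transfer integral is odd under both reflections of the plane, so it vanishes when the product
  of the three parities in one of the variables is even.
\<close>

lemma wave_transfer_zero_sign:
  assumes "sign1 (fst X) * sign1 (fst Y) * sign1 (fst Z) = 1 \<or> sign2 (fst X) * sign2 (fst Y) * sign2 (fst Z) = 1"
  shows "wave_transfer X Y Z = 0"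
  using assms
proof
  assume "sign1 (fst X) * sign1 (fst Y) * sign1 (fst Z) = 1"
  then show ?thesis
    by (intro planar_transfer_zero_first triple_derivs_zero_parity[OF prof1_trig1 prof1_trig1 prof1_trig1 prof1_parity prof1_parity prof1_parity])
next
  assume "sign2 (fst X) * sign2 (fst Y) * sign2 (fst Z) = 1"
  then show ?thesis
    by (intro planar_transfer_zero_second triple_derivs_zero_parity[OF prof2_trig1 prof2_trig1 prof2_trig1 prof2_parity prof2_parity prof2_parity])
qed

text \<open>
  Stated for the set of the three waves, to cover all orders of a triad at once.
\<close>

definition nonresonant :: "(wave \<Rightarrow> int) \<Rightarrow> (wave \<times> nat) set \<Rightarrow> bool" where
  "nonresonant carrier S \<longleftrightarrow>
     (\<forall>k. (\<forall>V\<in>S. k V \<in> band (carrier (fst V) * 4 ^ snd V) (4 ^ snd V)) \<longrightarrow> sum k S \<noteq> 0)"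

lemma nonresonantD:
  assumes "nonresonant carrier {X, Y, Z}" "distinct [X, Y, Z]"
    and "k \<in> band (carrier (fst X) * 4 ^ snd X) (4 ^ snd X)" "l \<in> band (carrier (fst Y) * 4 ^ snd Y) (4 ^ snd Y)"
      "m \<in> band (carrier (fst Z) * 4 ^ snd Z) (4 ^ snd Z)"
  shows "k + l + m \<noteq> 0"
proof -
  let ?k = "\<lambda>V. if V = X then k else if V = Y then l else m"
  have "\<forall>V\<in>{X, Y, Z}. ?k V \<in> band (carrier (fst V) * 4 ^ snd V) (4 ^ snd V)"
    using assms(2-) by simp
  with assms(1)[unfolded nonresonant_def, THEN spec, of ?k] have "sum ?k {X, Y, Z} \<noteq> 0" by (rule mp)
  moreover have "X \<noteq> Y" "X \<noteq> Z" "Y \<noteq> Z" "Y \<noteq> X" "Z \<noteq> X" "Z \<noteq> Y" using assms(2) by auto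
  ultimately show ?thesis by (simp add: add.assoc)
qed

lemma wave_transfer_zero_frequency:
  assumes "distinct [X, Y, Z]" "nonresonant carrier1 {X, Y, Z} \<or> nonresonant carrier2 {X, Y, Z}"
  shows "wave_transfer X Y Z = 0"
  using assms(2)
proof
  assume "nonresonant carrier1 {X, Y, Z}"
  from nonresonantD[OF this assms(1)] show ?thesis
    by (intro planar_transfer_zero_first triple_derivs_zero_frequency[OF prof1_trig1 prof1_trig1 prof1_trig1]) simp
next
  assume "nonresonant carrier2 {X, Y, Z}"
  from nonresonantD[OF this assms(1)] show ?thesis
    by (intro planar_transfer_zero_second triple_derivs_zero_frequency[OF prof2_trig1 prof2_trig1 prof2_trig1]) simp
qed

text \<open>
  Parity leaves one wave of each type, and then frequency fixes the scales.
\<close>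

lemma wave_transfer_nonzero:
  assumes "wave_transfer X Y Z \<noteq> 0"
  obtains n where "{X, Y, Z} = {(Axial, n), (CosSin, Suc n), (SinCos, Suc n)}"
proof -
  obtain u p v q w r where XYZ: "X = (u, p)" "Y = (v, q)" "Z = (w, r)" by (metis surj_pair)
  have s: "sign1 u * sign1 v * sign1 w \<noteq> 1" "sign2 u * sign2 v * sign2 w \<noteq> 1"
    using wave_transfer_zero_sign[of X Y Z] assms by (auto simp: XYZ)
  then have d: "distinct [X, Y, Z]"
    unfolding XYZ by (cases u; cases v; cases w; simp)
  have "\<exists>p q r. {X, Y, Z} = {(Axial, r), (CosSin, p), (SinCos, q)}"
    using s unfolding XYZ by (cases u; cases v; cases w; simp; blast)
  then obtain p q r where S: "{X, Y, Z} = {(Axial, r), (CosSin, p), (SinCos, q)}" by blast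
  have "p = q \<and> p = Suc r"
  proof (rule ccontr)
    assume "\<not> (p = q \<and> p = Suc r)"
    from resonance_scales[OF this] have "nonresonant carrier1 {X, Y, Z} \<or> nonresonant carrier2 {X, Y, Z}"
      unfolding S nonresonant_def by (elim disj_forward) (auto simp: add.assoc)
    then show False using wave_transfer_zero_frequency[OF d] assms by blast
  qed
  then have "{X, Y, Z} = {(Axial, r), (CosSin, Suc r), (SinCos, Suc r)}" unfolding S by auto
  then show ?thesis by (rule that)
qed

section \<open>Waves on the torus\<close>

text \<open>
  The free parameters \<open>a n\<close> scale the \<open>Axial\<close> waves. The exponent makes the velocity, one derivative of
  three kernels of height \<open>4 ^ n\<close>, of size \<open>(4 ^ n) powr (2 / 3)\<close>.
\<close>

definition amp :: "(nat \<Rightarrow> real) \<Rightarrow> wave \<times> nat \<Rightarrow> real" where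
  "amp a X = (if fst X = Axial then a (snd X) else 1) * (4 ^ snd X) powr (- 10 / 3)"

abbreviation wave1 :: "nat \<Rightarrow> wave \<times> nat \<Rightarrow> real \<Rightarrow> real" where
  "wave1 i X \<equiv> (deriv ^^ i) (prof1 (fst X) (4 ^ snd X))"

abbreviation wave2 :: "nat \<Rightarrow> wave \<times> nat \<Rightarrow> real \<Rightarrow> real" where
  "wave2 i X \<equiv> (deriv ^^ i) (prof2 (fst X) (4 ^ snd X))"

text \<open>
  The derivative \<open>\<partial>\<^sub>1 ^ i \<partial>\<^sub>2 ^ j\<close> of the stream function of the wave \<open>X\<close>.
\<close>

definition piece :: "(nat \<Rightarrow> real) \<Rightarrow> nat \<Rightarrow> nat \<Rightarrow> wave \<times> nat \<Rightarrow> real^3 \<Rightarrow> real" where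
  "piece a i j X x = amp a X * (wave1 i X (x $ 1)
     * wave2 j X (x $ 2) * fejer (4 ^ snd X) (x $ 3))"

text \<open>
  Frequencies in the range where the cutoff of level \<open>2 n + 7\<close> equals one and its dilations by powers of
  two are all zero or one.
\<close>

definition shell :: "nat \<Rightarrow> (int^3) set" where
  "shell n = {k. 128 * 4 ^ n \<le> norm (freq k) \<and> norm (freq k) \<le> 64 * sqrt 5 * 4 ^ n}"

lemma freq_nth: "freq k $ i = of_int (k $ i)"
  by (simp add: freq_def)

lemma finite_int_box3:
  assumes "\<And>i. finite (K i)" shows "finite {k::int^3. \<forall>i. k $ i \<in> K i}"
proof -
  have "{k::int^3. \<forall>i. k $ i \<in> K i} \<subseteq> vec_lambda ` (PiE UNIV K)"
  proof
    fix k :: "int^3" assume "k \<in> {k. \<forall>i. k $ i \<in> K i}"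
    then have "(\<lambda>i. k $ i) \<in> PiE UNIV K" by auto
    then show "k \<in> vec_lambda ` (PiE UNIV K)" by (intro image_eqI[of _ _ "\<lambda>i. k $ i"]) auto
  qed
  then show ?thesis by (rule finite_subset) (intro finite_imageI finite_PiE assms; simp)
qed

lemma finite_freq_ball: "finite {k. norm (freq k) \<le> R}"
proof (rule finite_subset)
  show "{k. norm (freq k) \<le> R} \<subseteq> {k. \<forall>i. k $ i \<in> {- \<lceil>R\<rceil>..\<lceil>R\<rceil>}}"
  proof safe
    fix k i assume k: "norm (freq k) \<le> R"
    have "\<bar>real_of_int (k $ i)\<bar> \<le> norm (freq k)"
      using component_le_norm_cart[of "freq k" i] by (simp add: freq_nth)
    then have "\<bar>real_of_int (k $ i)\<bar> \<le> of_int \<lceil>R\<rceil>" using k by (smt (verit) le_of_int_ceiling)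
    then have "\<bar>k $ i\<bar> \<le> \<lceil>R\<rceil>" by (simp flip: of_int_abs)
    then show "k $ i \<in> {- \<lceil>R\<rceil>..\<lceil>R\<rceil>}" by auto
  qed
qed (rule finite_int_box3, simp)

lemma finite_shell: "finite (shell n)"
  by (rule finite_subset[OF _ finite_freq_ball[of "64 * sqrt 5 * 4 ^ n"]]) (auto simp: shell_def)

lemma norm_freq_sq: "(norm (freq k))\<^sup>2 = of_int ((k $ 1)\<^sup>2 + (k $ 2)\<^sup>2 + (k $ 3)\<^sup>2)"
  by (simp add: norm_vec_def L2_set_def sum_UNIV3 freq_nth real_sqrt_pow2)

lemma band_boxes_in_shell:
  assumes "k $ 1 \<in> band (carrier1 w * 4 ^ n) (4 ^ n)" "k $ 2 \<in> band (carrier2 w * 4 ^ n) (4 ^ n)"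
    "k $ 3 \<in> band 0 (4 ^ n)"
  shows "k \<in> shell n"
proof -
  define t :: int where "t = 4 ^ n"
  have t: "t > 0" by (simp add: t_def)
  define x y z where "x = \<bar>k $ 1\<bar>" "y = \<bar>k $ 2\<bar>" "z = \<bar>k $ 3\<bar>"
  have nn: "0 \<le> x" "0 \<le> y" "0 \<le> z" by (simp_all add: x_y_z_def)
  have xyz: "\<bar>x - carrier1 w * t\<bar> < t" "\<bar>y - carrier2 w * t\<bar> < t" "z < t"
    using assms by (simp_all add: x_y_z_def band_def t_def)
  have sq: "p\<^sup>2 * t\<^sup>2 \<le> u\<^sup>2" if "p * t \<le> u" "0 \<le> p" for p u :: int
    using power_mono[OF that(1), of 2] that(2) t by (simp add: power_mult_distrib)
  have sq': "u\<^sup>2 \<le> p\<^sup>2 * t\<^sup>2" if "u \<le> p * t" "0 \<le> u" for p u :: int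
    using power_mono[OF that(1), of 2] that(2) t by (simp add: power_mult_distrib)
  have z2: "z\<^sup>2 \<le> t\<^sup>2" using sq'[of z 1] xyz nn by simp
  have "128\<^sup>2 * t\<^sup>2 \<le> x\<^sup>2 + y\<^sup>2 + z\<^sup>2 \<and> x\<^sup>2 + y\<^sup>2 + z\<^sup>2 \<le> 20480 * t\<^sup>2"
  proof (cases w)
    case Axial
    have "y \<le> 137 * t" "x \<le> 1 * t" "135 * t \<le> y" using xyz t by (auto simp: Axial)
    from sq'[OF this(1) nn(2)] sq'[OF this(2) nn(1)] sq[OF this(3)] show ?thesis
      using z2 by (intro conjI; simp; (insert zero_le_power2[of x] zero_le_power2[of y] zero_le_power2[of z] zero_le_power2[of t]; linarith)?)
  next
    case CosSin
    have "x \<le> 131 * t" "129 * t \<le> x" "y \<le> 21 * t" using xyz t by (auto simp: CosSin)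
    from sq'[OF this(1) nn(1)] sq[OF this(2)] sq'[OF this(3) nn(2)] show ?thesis
      using z2 by (intro conjI; simp; (insert zero_le_power2[of x] zero_le_power2[of y] zero_le_power2[of z] zero_le_power2[of t]; linarith)?)
  next
    case SinCos
    have "x \<le> 131 * t" "129 * t \<le> x" "y \<le> 55 * t" using xyz t by (auto simp: SinCos)
    from sq'[OF this(1) nn(1)] sq[OF this(2)] sq'[OF this(3) nn(2)] show ?thesis
      using z2 by (intro conjI; simp; (insert zero_le_power2[of x] zero_le_power2[of y] zero_le_power2[of z] zero_le_power2[of t]; linarith)?)
  qed
  then have *: "128\<^sup>2 * t\<^sup>2 \<le> (k $ 1)\<^sup>2 + (k $ 2)\<^sup>2 + (k $ 3)\<^sup>2"
    "(k $ 1)\<^sup>2 + (k $ 2)\<^sup>2 + (k $ 3)\<^sup>2 \<le> 20480 * t\<^sup>2"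
    by (simp_all add: x_y_z_def)
  have "(128 * real_of_int t)\<^sup>2 = of_int (128\<^sup>2 * t\<^sup>2)" by (simp add: power_mult_distrib)
  also have "\<dots> \<le> of_int ((k $ 1)\<^sup>2 + (k $ 2)\<^sup>2 + (k $ 3)\<^sup>2)" by (simp only: of_int_le_iff *)
  finally have "(128 * real_of_int t)\<^sup>2 \<le> (norm (freq k))\<^sup>2" by (simp only: norm_freq_sq)
  then have 1: "128 * real_of_int t \<le> norm (freq k)" by (rule power2_le_imp_le) simp
  have "(norm (freq k))\<^sup>2 \<le> of_int (20480 * t\<^sup>2)" unfolding norm_freq_sq by (simp only: of_int_le_iff *)
  also have "\<dots> = (64 * sqrt 5 * real_of_int t)\<^sup>2" by (simp add: power_mult_distrib)
  finally have 2: "norm (freq k) \<le> 64 * sqrt 5 * real_of_int t" by (rule power2_le_imp_le) (use t in simp)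
  show ?thesis using 1 2 by (simp add: shell_def t_def)
qed

lemma freq_axis_inner: "freq (axis i k) \<bullet> x = of_int k * x $ i"
proof -
  have "freq (axis i k) = axis i (of_int k)" by (simp add: vec_eq_iff freq_nth axis_def)
  then show ?thesis by (simp add: inner_axis' )
qed

lemma trig3_coordinate:
  assumes "trig1 K f" shows "trig3 ((\<lambda>k. axis i k) ` K) (\<lambda>x. f (x $ i))"
proof -
  obtain c where c: "finite K" "\<And>x. complex_of_real (f x) = (\<Sum>k\<in>K. c k * char1 k x)"
    by (rule spectrum_inE[OF assms(1)]) blast
  have eq: "(\<lambda>x. complex_of_real (f (x $ i))) = (\<lambda>x. \<Sum>k\<in>K. c k * char3 (axis i k) x)"
    by (simp add: c(2) freq_axis_inner)
  show ?thesis unfolding eq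
    by (intro spectrum_in_sum spectrum_in_cmult spectrum_in_char) (use c(1) in auto)
qed

lemma trig3_product:
  assumes "trig1 K1 f1" "trig1 K2 f2" "trig1 K3 f3"
    and "finite L" and L: "\<And>k. k $ 1 \<in> K1 \<Longrightarrow> k $ 2 \<in> K2 \<Longrightarrow> k $ 3 \<in> K3 \<Longrightarrow> k \<in> L"
  shows "trig3 L (\<lambda>x. f1 (x $ 1) * f2 (x $ 2) * f3 (x $ 3))"
proof -
  note fin = assms(1-3)[THEN spectrum_in_finite]
  let ?M = "(\<lambda>(k, l). axis 1 k + axis 2 l) ` (K1 \<times> K2)"
  have "trig3 ?M (\<lambda>x. f1 (x $ 1) * f2 (x $ 2))"
    by (rule trig3_mult[OF trig3_coordinate[OF assms(1)] trig3_coordinate[OF assms(2)]]) (use fin in auto)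
  then show ?thesis
    by (rule trig3_mult[OF _ trig3_coordinate[OF assms(3)] assms(4)])
      (auto intro!: L simp: axis_def)
qed

lemma piece_trig3: "trig3 (shell n) (piece a i j (w, n))"
  unfolding piece_def[abs_def] fst_conv snd_conv
  by (intro spectrum_in_real_cmult trig3_product[OF trig1_derivs[OF prof1_trig1] trig1_derivs[OF prof2_trig1] fejer_trig1 finite_shell])
    (rule band_boxes_in_shell; simp)

lemma piece_continuous: "continuous_on UNIV (piece a i j X)"
  using trig3_continuous[OF piece_trig3[of "snd X" a i j "fst X"]] by simp

lemma integral_three_pieces:
  "(LINT x|torus. piece a i j X x * piece a i' j' Y x * piece a i'' j'' Z x)
     = amp a X * amp a Y * amp a Z
     * (triple (wave1 i X) (wave1 i' Y) (wave1 i'' Z)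
     * triple (wave2 j X) (wave2 j' Y) (wave2 j'' Z)
     * triple (fejer (4 ^ snd X)) (fejer (4 ^ snd Y)) (fejer (4 ^ snd Z)))"
proof -
  have c: "continuous_on UNIV ((deriv ^^ i) (prof1 w N))" "continuous_on UNIV ((deriv ^^ i) (prof2 w N))" for i w N
    by (rule trig1_continuous[OF trig1_derivs[OF prof1_trig1]] trig1_continuous[OF trig1_derivs[OF prof2_trig1]])+
  show ?thesis
    unfolding triple_def torus_integral_prod3[symmetric, OF continuous_on_mult[OF continuous_on_mult[OF c(1) c(1)] c(1)]
       continuous_on_mult[OF continuous_on_mult[OF c(2) c(2)] c(2)]
       continuous_on_mult[OF continuous_on_mult[OF fejer_continuous fejer_continuous] fejer_continuous]]
    by (simp add: piece_def mult_ac flip: integral_mult_right_zero)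
qed

abbreviation transfer_density :: "(nat \<Rightarrow> real) \<Rightarrow> wave \<times> nat \<Rightarrow> wave \<times> nat \<Rightarrow> wave \<times> nat \<Rightarrow> real^3 \<Rightarrow> real" where
  "transfer_density a X Y Z x \<equiv> piece a 1 0 X x * piece a 1 0 Y x * piece a 1 1 Z x
     - piece a 0 1 X x * piece a 0 1 Y x * piece a 1 1 Z x
     + piece a 0 1 X x * piece a 1 0 Y x * piece a 0 2 Z x
     - piece a 1 0 X x * piece a 0 1 Y x * piece a 2 0 Z x"

text \<open>
  The contribution of the velocities of the waves \<open>X\<close>, \<open>Y\<close>, \<open>Z\<close> to \<open>\<integral> \<Sum>i j. u\<^sub>i v\<^sub>j \<partial>\<^sub>j w\<^sub>i\<close>.
\<close>

definition transfer :: "(nat \<Rightarrow> real) \<Rightarrow> wave \<times> nat \<Rightarrow> wave \<times> nat \<Rightarrow> wave \<times> nat \<Rightarrow> real" where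
  "transfer a X Y Z = (LINT x|torus. transfer_density a X Y Z x)"

lemma transfer_eq:
  "transfer a X Y Z = amp a X * amp a Y * amp a Z * wave_transfer X Y Z
     * triple (fejer (4 ^ snd X)) (fejer (4 ^ snd Y)) (fejer (4 ^ snd Z))"
proof -
  have int: "integrable torus (\<lambda>x. piece a i j X x * piece a i' j' Y x * piece a i'' j'' Z x)" for i j i' j' i'' j''
    by (intro continuous_integrable_torus continuous_on_mult piece_continuous)
  have "transfer a X Y Z = (LINT x|torus. piece a 1 0 X x * piece a 1 0 Y x * piece a 1 1 Z x)
     - (LINT x|torus. piece a 0 1 X x * piece a 0 1 Y x * piece a 1 1 Z x)
     + (LINT x|torus. piece a 0 1 X x * piece a 1 0 Y x * piece a 0 2 Z x)
     - (LINT x|torus. piece a 1 0 X x * piece a 0 1 Y x * piece a 2 0 Z x)"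
    unfolding transfer_def by (simp add: int del: One_nat_def)
  then show ?thesis
    unfolding integral_three_pieces planar_transfer_def by (simp add: numeral_2_eq_2 algebra_simps)
qed

lemma transfer_antisym: "transfer a X Y Z + transfer a Z Y X = 0"
proof -
  have "transfer a X Y Z + transfer a Z Y X = amp a X * amp a Y * amp a Z * (wave_transfer X Y Z + wave_transfer Z Y X)
     * triple (fejer (4 ^ snd X)) (fejer (4 ^ snd Y)) (fejer (4 ^ snd Z))"
    unfolding transfer_eq triple_commute[of "fejer (4 ^ snd Z)"] by (simp only: algebra_simps)
  then show ?thesis by (simp only: wave_transfer_antisym mult_zero_right mult_zero_left)
qed

text \<open>
  Normalised by scaling, so that it is of order one.
\<close>

definition kernel_overlap :: "nat \<Rightarrow> real" where
  "kernel_overlap n = triple (fejer (4 * 4 ^ n)) (fejer (4 * 4 ^ n)) (fejer (4 ^ n)) / (4 ^ n)\<^sup>2"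

text \<open>
  On an interval of length \<open>1 / (4 t)\<close> with \<open>t = 4 ^ n\<close> the two kernels of height \<open>4 t\<close> exceed \<open>t\<close> and the one of
  height \<open>t\<close> exceeds \<open>t / 4\<close>.
\<close>

lemma kernel_overlap_ge: "1 / 16 \<le> kernel_overlap n"
proof -
  define t where "t = real (4 ^ n)"
  have t: "t \<ge> 1" by (simp add: t_def)
  define f where "f x = fejer (4 * 4 ^ n) x * fejer (4 * 4 ^ n) x * fejer (4 ^ n) x" for x
  have "t\<^sup>2 / 16 = (LINT x|lborel. indicator {0..1/(4*t)} x *\<^sub>R (t ^ 3 / 4))"
    using t by (simp add: field_simps power2_eq_square power3_eq_cube)
  also have "\<dots> \<le> (LINT x|lborel. indicator {0..<2*pi} x *\<^sub>R f x)"
  proof (rule integral_mono)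
    show "integrable lborel (\<lambda>x. indicator {0..1/(4*t)} x *\<^sub>R (t ^ 3 / 4))" using t by simp
    have "integrable circle f"
      unfolding f_def[abs_def] by (intro continuous_integrable_circle continuous_intros fejer_continuous)
    then show "integrable lborel (\<lambda>x. indicator {0..<2*pi} x *\<^sub>R f x)" by (simp add: circle_integrable_lborel)
    fix x
    have f0: "0 \<le> f x" by (simp add: f_def fejer_nonneg)
    show "indicator {0..1/(4*t)} x *\<^sub>R (t ^ 3 / 4) \<le> indicator {0..<2*pi} x *\<^sub>R f x"
    proof (cases "x \<in> {0..1/(4*t)}")
      case True
      have x: "0 \<le> x" "4 * t * x \<le> 1" using True t by (simp_all add: field_simps)
      moreover have "t * x \<le> 1" using x t mult_nonneg_nonneg[of t x] by linarith
      ultimately have "t \<le> fejer (4 * 4 ^ n) x" "t / 4 \<le> fejer (4 ^ n) x"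
        using fejer_ge[of x "4 * 4 ^ n"] fejer_ge[of x "4 ^ n"] by (simp_all add: t_def)
      then have "t * t * (t / 4) \<le> f x" unfolding f_def using t by (intro mult_mono) (auto simp: fejer_nonneg)
      moreover have "x < 2 * pi"
      proof -
        have "x \<le> t * x" using x t by (simp add: mult_le_cancel_right1)
        then show ?thesis using \<open>t * x \<le> 1\<close> pi_gt3 by linarith
      qed
      ultimately show ?thesis using True x by (simp add: power3_eq_cube)
    qed (use f0 in simp)
  qed
  also have "\<dots> = triple (fejer (4 * 4 ^ n)) (fejer (4 * 4 ^ n)) (fejer (4 ^ n))"
    by (simp add: triple_def circle_integral_lborel f_def)
  finally show ?thesis using t by (simp add: kernel_overlap_def t_def field_simps)
qed

text \<open>
  All powers of the scale cancel: the integrals contribute \<open>t ^ 4 * (t\<^sup>2) ^ 3\<close> and the amplitudes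
  \<open>t ^ - 10\<close>. The numerical factor is \<open>b (y + z) (z - y)\<^sup>2 / 8\<close> for \<open>b = 520\<close>, \<open>y = 80\<close>, \<open>z = 216\<close>.
\<close>

lemma transfer_resonant:
  "transfer a (CosSin, Suc n) (SinCos, Suc n) (Axial, n) + transfer a (SinCos, Suc n) (CosSin, Suc n) (Axial, n)
     = - 355863040 * 4 powr (- 20 / 3) * kernel_overlap n ^ 3 * a n"
proof -
  let ?A = "(Axial, n)" and ?B = "(CosSin, Suc n)" and ?C = "(SinCos, Suc n)"
  define t where "t = (4::real) ^ n"
  have t: "t > 0" by (simp add: t_def)
  define S where "S = triple (fejer (4 * 4 ^ n)) (fejer (4 * 4 ^ n)) (fejer (4 ^ n))"
  have ex: "wave_transfer ?B ?C ?A + wave_transfer ?C ?B ?A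
     = - (355863040 * t ^ 4) * S\<^sup>2"
  proof -
    have F: "trig1 (band 0 (4 * 4 ^ n)) (fejer (4 * 4 ^ n))" and G: "trig1 (band 0 (4 ^ n)) (fejer (4 ^ n))"
      using fejer_trig1[of "4 * 4 ^ n"] fejer_trig1[of "4 ^ n"] by simp_all
    \<comment> \<open>in units of the lower scale the carriers \<open>20\<close> and \<open>54\<close> become \<open>80\<close> and \<open>216\<close>\<close>
    show ?thesis
      using planar_transfer_exact[OF F G, of "520 * 4 ^ n" "80 * 4 ^ n" "216 * 4 ^ n"]
      by (simp add: S_def t_def power2_eq_square power4_eq_xxxx algebra_simps)
  qed
  have S: "S = kernel_overlap n * t\<^sup>2" using t by (simp add: S_def kernel_overlap_def t_def)
  have amps: "amp a ?B * amp a ?C * amp a ?A = a n * 4 powr (- 20 / 3) / t ^ 10"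
  proof -
    have "(4 * t) powr (- 10 / 3) * (4 * t) powr (- 10 / 3) * t powr (- 10 / 3) = 4 powr (- 20 / 3) * t powr (- 10)"
    proof -
      have "(4 * t) powr (- 10 / 3) = 4 powr (- 10 / 3) * t powr (- 10 / 3)" using t by (simp add: powr_mult)
      moreover have "(4::real) powr (- 10 / 3) * 4 powr (- 10 / 3) = 4 powr (- 20 / 3)" by (simp flip: powr_add)
      moreover have "t powr (- 10 / 3) * t powr (- 10 / 3) * t powr (- 10 / 3) = t powr (- 10)" by (simp flip: powr_add)
      ultimately show ?thesis by algebra
    qed
    also have "t powr (- 10) = 1 / t ^ 10" using t by (simp add: powr_minus powr_numeral divide_inverse)
    finally have pw: "(4 * t) powr (- 10 / 3) * (4 * t) powr (- 10 / 3) * t powr (- 10 / 3) = 4 powr (- 20 / 3) * (1 / t ^ 10)" .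
    have "amp a ?B * amp a ?C * amp a ?A
        = a n * ((4 * t) powr (- 10 / 3) * (4 * t) powr (- 10 / 3) * t powr (- 10 / 3))"
      by (simp add: amp_def t_def)
    then show ?thesis unfolding pw by simp
  qed
  have "transfer a ?B ?C ?A + transfer a ?C ?B ?A
     = (amp a ?B * amp a ?C * amp a ?A)
       * (wave_transfer ?B ?C ?A + wave_transfer ?C ?B ?A) * S"
    unfolding transfer_eq S_def by (simp add: distrib_right distrib_left mult_ac)
  also have "\<dots> = - 355863040 * 4 powr (- 20 / 3) * kernel_overlap n ^ 3 * a n"
    unfolding ex amps S using t by (simp add: field_simps power2_eq_square power3_eq_cube power4_eq_xxxx eval_nat_numeral)
  finally show ?thesis .
qed

lemma transfer_nonzero:
  assumes "transfer a X Y Z \<noteq> 0"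
  obtains n where "{X, Y, Z} = {(Axial, n), (CosSin, Suc n), (SinCos, Suc n)}"
  using assms wave_transfer_nonzero[of X Y Z thesis] by (auto simp: transfer_eq)

section \<open>Size of the velocity\<close>

lemma UNIV_wave: "(UNIV :: wave set) = {Axial, CosSin, SinCos}"
  using wave.exhaust by auto

lemma finite_wave: "finite (UNIV :: wave set)"
  by (simp add: UNIV_wave)

lemma prof_bounds:
  assumes "N > 0"
  shows prof1_le: "\<bar>prof1 w N x\<bar> \<le> majorant N x"
    and prof2_le: "\<bar>prof2 w N x\<bar> \<le> majorant N x"
    and deriv_prof1_le: "\<bar>deriv (prof1 w N) x\<bar> \<le> 137 * real N * majorant N x"
    and deriv_prof2_le: "\<bar>deriv (prof2 w N) x\<bar> \<le> 137 * real N * majorant N x"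
proof -
  note F = fejer_trig1[of N]
  have f: "\<bar>fejer N x\<bar> \<le> majorant N x" using fejer_nonneg fejer_le_majorant by simp
  have "\<bar>c\<bar> \<le> 1 \<Longrightarrow> \<bar>c * fejer N x\<bar> \<le> majorant N x" for c
    using mult_mono[of "\<bar>c\<bar>" 1 "\<bar>fejer N x\<bar>" "majorant N x"] f by (simp add: abs_mult)
  note 0 = this
  show "\<bar>prof1 w N x\<bar> \<le> majorant N x" "\<bar>prof2 w N x\<bar> \<le> majorant N x"
    by (cases w; simp add: 0 f)+
  have d: "\<bar>deriv (fejer N) x\<bar> \<le> real N * majorant N x" by (rule fejer_deriv_le[OF assms])
  have comb: "\<bar>m * c * fejer N x + c' * deriv (fejer N) x\<bar> \<le> 137 * real N * majorant N x"
    if "\<bar>m\<bar> \<le> 136 * real N" "\<bar>c\<bar> \<le> 1" "\<bar>c'\<bar> \<le> 1" for m c c'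
  proof -
    have "\<bar>m * c\<bar> * \<bar>fejer N x\<bar> \<le> (136 * real N * 1) * majorant N x"
      unfolding abs_mult using that f by (intro mult_mono) auto
    moreover have "\<bar>c'\<bar> * \<bar>deriv (fejer N) x\<bar> \<le> 1 * (real N * majorant N x)"
      using that d by (intro mult_mono) auto
    ultimately show ?thesis using abs_triangle_ineq[of "m * c * fejer N x" "c' * deriv (fejer N) x"]
      unfolding abs_mult by linarith
  qed
  have single: "\<bar>deriv (fejer N) x\<bar> \<le> 137 * real N * majorant N x"
    using comb[of 0 0 1] by simp
  have comb': "\<bar>- (m * c * fejer N x) + c' * deriv (fejer N) x\<bar> \<le> 137 * real N * majorant N x"
    if "\<bar>m\<bar> \<le> 136 * real N" "\<bar>c\<bar> \<le> 1" "\<bar>c'\<bar> \<le> 1" for m c c'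
    using comb[of "- m" c c'] that by simp
  have comb'': "\<bar>c' * deriv (fejer N) x - m * c * fejer N x\<bar> \<le> 137 * real N * majorant N x"
    if "\<bar>m\<bar> \<le> 136 * real N" "\<bar>c\<bar> \<le> 1" "\<bar>c'\<bar> \<le> 1" for m c c'
    using comb[of "- m" c c'] that by simp
  show "\<bar>deriv (prof1 w N) x\<bar> \<le> 137 * real N * majorant N x"
    by (cases w) (auto simp: modulated_deriv[OF F] single intro!: comb comb' comb'')
  show "\<bar>deriv (prof2 w N) x\<bar> \<le> 137 * real N * majorant N x"
    by (cases w) (auto simp: modulated_deriv[OF F] single intro!: comb comb' comb'')
qed

text \<open>
  A pointwise bound for the velocity at scale \<open>4 ^ n\<close>. The factor \<open>411\<close> is \<open>3 * 137\<close>: three waves, and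
  carriers of at most \<open>136\<close> plus one for differentiating the kernel.
\<close>

definition envelope :: "real \<Rightarrow> nat \<Rightarrow> real^3 \<Rightarrow> real" where
  "envelope A n x = 411 * A * (4 ^ n) powr (- 7 / 3)
     * (majorant (4 ^ n) (x $ 1) * majorant (4 ^ n) (x $ 2) * majorant (4 ^ n) (x $ 3))"

text \<open>
  The rotated gradient in the first two coordinates of the stream functions at scale \<open>4 ^ n\<close>.
\<close>

definition shell_velocity :: "(nat \<Rightarrow> real) \<Rightarrow> nat \<Rightarrow> real^3 \<Rightarrow> real^3" where
  "shell_velocity a n x = (\<chi> i. if i = 1 then - (\<Sum>w\<in>UNIV. piece a 0 1 (w, n) x)
     else if i = 2 then (\<Sum>w\<in>UNIV. piece a 1 0 (w, n) x) else 0)"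

definition velocity :: "(nat \<Rightarrow> real) \<Rightarrow> real^3 \<Rightarrow> real^3" where
  "velocity a x = (\<chi> i. \<Sum>n. shell_velocity a n x $ i)"

lemma shell_velocity_simps:
  "shell_velocity a n x $ 1 = - (\<Sum>w\<in>UNIV. piece a 0 1 (w, n) x)"
  "shell_velocity a n x $ 2 = (\<Sum>w\<in>UNIV. piece a 1 0 (w, n) x)"
  "shell_velocity a n x $ 3 = 0"
  by (simp_all add: shell_velocity_def)

lemma envelope_nonneg: "0 \<le> A \<Longrightarrow> 0 \<le> envelope A n x"
  by (simp add: envelope_def majorant_nonneg)

lemma envelope_continuous: "continuous_on UNIV (envelope A n)"
  unfolding envelope_def[abs_def]
  by (intro continuous_intros continuous_on_compose2[OF majorant_continuous[of UNIV]]) auto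

lemma envelope_borel [measurable]: "envelope A n \<in> borel_measurable torus"
  by (rule borel_measurable_torusI[OF borel_measurable_continuous_onI[OF envelope_continuous]])

lemma piece_bound:
  assumes a: "\<bar>a n\<bar> \<le> A" "1 \<le> A" and ij: "i = 1 \<and> j = 0 \<or> i = 0 \<and> j = 1"
  shows "\<bar>piece a i j (w, n) x\<bar> \<le> envelope A n x / 3"
proof -
  define t where "t = (4::real) ^ n"
  have t: "t > 0" by (simp add: t_def)
  have N: "(4::nat) ^ n > 0" by simp
  note b = prof_bounds[OF N, of w, simplified, folded t_def]
  let ?M = "majorant (4 ^ n)"
  note M0 = majorant_nonneg[of "4 ^ n"]
  have amp: "\<bar>amp a (w, n)\<bar> \<le> A * t powr (- 10 / 3)"
    using a by (auto simp: amp_def t_def abs_mult intro!: mult_right_mono)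
  have "\<bar>(deriv ^^ i) (prof1 w (4 ^ n)) (x $ 1)\<bar> * \<bar>(deriv ^^ j) (prof2 w (4 ^ n)) (x $ 2)\<bar>
      \<le> 137 * t * (?M (x $ 1) * ?M (x $ 2))"
    using ij
  proof
    assume "i = 1 \<and> j = 0"
    then show ?thesis
      using mult_mono[OF b(3)[of "x $ 1"] b(2)[of "x $ 2"]] M0 t by (simp add: mult_ac)
  next
    assume "i = 0 \<and> j = 1"
    then show ?thesis
      using mult_mono[OF b(1)[of "x $ 1"] b(4)[of "x $ 2"]] M0 t by (simp add: mult_ac)
  qed
  then have prod: "\<bar>(deriv ^^ i) (prof1 w (4 ^ n)) (x $ 1)\<bar> * \<bar>(deriv ^^ j) (prof2 w (4 ^ n)) (x $ 2)\<bar> * \<bar>fejer (4 ^ n) (x $ 3)\<bar>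
      \<le> (137 * t * (?M (x $ 1) * ?M (x $ 2))) * ?M (x $ 3)"
    by (rule mult_mono) (use t M0 fejer_le_majorant fejer_nonneg in auto)
  have "\<bar>piece a i j (w, n) x\<bar> \<le> (A * t powr (- 10 / 3)) * ((137 * t * (?M (x $ 1) * ?M (x $ 2))) * ?M (x $ 3))"
    unfolding piece_def abs_mult fst_conv snd_conv by (rule mult_mono[OF amp prod]) (use t a in auto)
  also have "\<dots> = 137 * A * (t powr (- 10 / 3) * t powr 1) * (?M (x $ 1) * ?M (x $ 2) * ?M (x $ 3))"
    using t by (simp add: mult_ac)
  also have "t powr (- 10 / 3) * t powr 1 = t powr (- 7 / 3)" unfolding powr_add[symmetric] by simp
  also have "137 * A * t powr (- 7 / 3) * (?M (x $ 1) * ?M (x $ 2) * ?M (x $ 3)) = envelope A n x / 3"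
    by (simp add: envelope_def t_def)
  finally show ?thesis .
qed

lemma shell_velocity_bound:
  assumes a: "\<bar>a n\<bar> \<le> A" "1 \<le> A"
  shows "\<bar>shell_velocity a n x $ i\<bar> \<le> envelope A n x"
proof -
  have "0 \<le> envelope A n x" using a by (intro envelope_nonneg) simp
  moreover have "\<bar>shell_velocity a n x $ 1\<bar> \<le> envelope A n x" "\<bar>shell_velocity a n x $ 2\<bar> \<le> envelope A n x"
    using piece_bound[where a=a and n=n, OF a, of 0 1 Axial x] piece_bound[where a=a and n=n, OF a, of 0 1 CosSin x] piece_bound[where a=a and n=n, OF a, of 0 1 SinCos x]
      piece_bound[where a=a and n=n, OF a, of 1 0 Axial x] piece_bound[where a=a and n=n, OF a, of 1 0 CosSin x] piece_bound[where a=a and n=n, OF a, of 1 0 SinCos x]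
    by (auto simp: shell_velocity_simps UNIV_wave)
  ultimately show ?thesis using exhaust_3[of i] by (auto simp: shell_velocity_simps)
qed

definition Lp_const :: "real \<Rightarrow> real \<Rightarrow> real" where
  "Lp_const A p = (411 * A) powr p * 8 powr (p - 1) * (4 * pi) ^ 3"

lemma Lp_const_nonneg [simp]: "0 \<le> A \<Longrightarrow> 0 \<le> Lp_const A p"
  by (simp add: Lp_const_def)

text \<open>
  Interpolation between height and mass: the \<open>p\<close>-th power of the product of kernels is at most its
  height to the power \<open>p - 1\<close> times the product itself.
\<close>

lemma envelope_integral:
  assumes "1 \<le> p" "0 \<le> A"
  shows "(\<integral>\<^sup>+x. ennreal (envelope A n x powr p) \<partial>torus)
    \<le> ennreal (Lp_const A p * (4 ^ n) powr (- (3 - 2 / 3 * p)))"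
proof -
  define t where "t = (4::real) ^ n"
  have t: "t > 0" by (simp add: t_def)
  let ?M = "\<lambda>x::real^3. majorant (4 ^ n) (x $ 1) * majorant (4 ^ n) (x $ 2) * majorant (4 ^ n) (x $ 3)"
  note M0 = majorant_nonneg[of "4 ^ n"]
  have M: "0 \<le> ?M x" "?M x \<le> 8 * t ^ 3" for x
  proof -
    have "majorant (4 ^ n) y \<le> 2 * t" for y using majorant_le[of "4 ^ n" y] by (simp add: t_def)
    then have "?M x \<le> (2 * t) * (2 * t) * (2 * t)"
      using M0 t by (intro mult_mono mult_nonneg_nonneg) auto
    then show "?M x \<le> 8 * t ^ 3" by (simp add: power3_eq_cube)
  qed (simp add: M0)
  have cM: "continuous_on UNIV ?M"
    by (intro continuous_intros continuous_on_compose2[OF majorant_continuous[of UNIV]]) auto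
  define c where "c = (411 * A * t powr (- 7 / 3)) powr p * (8 * t ^ 3) powr (p - 1)"
  have pt: "envelope A n x powr p \<le> c * ?M x" for x
  proof (cases "?M x = 0")
    case False
    then have pos: "?M x > 0" using M(1)[of x] by linarith
    have "envelope A n x powr p = (411 * A * t powr (- 7 / 3)) powr p * ?M x powr p"
      unfolding envelope_def t_def[symmetric] using assms M by (simp add: powr_mult)
    also have "?M x powr p = ?M x powr (p - 1) * ?M x" using pos by (simp add: powr_mult_base' powr_diff)
    also have "?M x powr (p - 1) \<le> (8 * t ^ 3) powr (p - 1)" using M assms by (intro powr_mono2) auto
    finally show ?thesis using M by (simp add: c_def mult_left_mono mult_right_mono mult.assoc)
  next
    case True
    have "envelope A n x = 411 * A * t powr (- 7 / 3) * ?M x" by (simp add: envelope_def t_def)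
    then show ?thesis unfolding True by simp
  qed
  have c0: "0 \<le> c" by (simp add: c_def)
  have "(\<integral>\<^sup>+x. ennreal (envelope A n x powr p) \<partial>torus) \<le> (\<integral>\<^sup>+x. ennreal (c * ?M x) \<partial>torus)"
    by (intro nn_integral_mono ennreal_leI pt)
  also have "\<dots> = ennreal (LINT x|torus. c * ?M x)"
    by (intro nn_integral_eq_integral continuous_integrable_torus continuous_intros cM)
       (use c0 M in auto)
  also have "(LINT x|torus. c * ?M x) = c * (LINT x|circle. majorant (4 ^ n) x) ^ 3"
    using torus_integral_prod3[OF majorant_continuous majorant_continuous majorant_continuous, of "4 ^ n" "4 ^ n" "4 ^ n"]
    by (simp add: power3_eq_cube)
  also have "\<dots> \<le> c * (4 * pi) ^ 3"
    using circle_integral_majorant[of "4 ^ n"]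
    by (intro mult_left_mono power_mono c0 integral_nonneg_AE) (auto simp: majorant_nonneg)
  also have "c = (411 * A) powr p * 8 powr (p - 1) * t powr (- (3 - 2 / 3 * p))"
  proof -
    have "c = (411 * A) powr p * 8 powr (p - 1) * (t powr (- 7 / 3 * p) * t powr (3 * (p - 1)))"
    proof -
      have t3: "t ^ 3 = t powr 3" using t by (simp add: powr_numeral)
      have "(411 * A * t powr (- 7 / 3)) powr p = (411 * A) powr p * t powr (- 7 / 3 * p)"
        using t assms by (subst powr_mult) (auto simp: powr_powr)
      moreover have "(8 * t ^ 3) powr (p - 1) = 8 powr (p - 1) * t powr (3 * (p - 1))"
        unfolding t3 using t by (simp add: powr_mult powr_powr del: powr_numeral)
      ultimately show ?thesis by (simp add: c_def)
    qed
    also have "t powr (- 7 / 3 * p) * t powr (3 * (p - 1)) = t powr (- (3 - 2 / 3 * p))"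
      unfolding powr_add[symmetric] by (rule arg_cong[of _ _ "\<lambda>s. t powr s"]) (simp add: algebra_simps)
    finally show ?thesis .
  qed
  finally show ?thesis by (simp add: Lp_const_def t_def mult_ac ennreal_leI)
qed

lemma power_powr_swap: "0 \<le> b \<Longrightarrow> (b ^ n) powr x = (b powr x) ^ n" for b x :: real
  by (induction n) (auto simp: powr_mult)

text \<open>
  The weights \<open>r ^ n\<close> give away half of the decay: \<open>H n x \<le> r ^ n * y\<close> for the number \<open>y\<close> whose \<open>p\<close>-th power
  is the sum of all \<open>(H n x / r ^ n) powr p\<close>, so \<open>\<Sum>n. H n x\<close> is at most \<open>y / (1 - r)\<close>, and the integral of that
  sum still converges geometrically.
\<close>

lemma geometric_series_Lp:
  fixes H :: "nat \<Rightarrow> 'a \<Rightarrow> real" and p C \<theta> :: real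
  assumes [measurable]: "\<And>n. H n \<in> borel_measurable M"
    and H0: "\<And>n x. 0 \<le> H n x" and p: "1 \<le> p" and C: "0 \<le> C" and th: "0 < \<theta>"
    and int: "\<And>n. (\<integral>\<^sup>+x. ennreal (H n x powr p) \<partial>M) \<le> ennreal (C * (4 ^ n) powr (- \<theta>))"
  shows "AE x in M. summable (\<lambda>n. H n x)"
    and "(\<integral>\<^sup>+x. ennreal ((\<Sum>n. H n x) powr p) \<partial>M) < \<infinity>"
proof -
  define r where "r = (4::real) powr (- \<theta> / (2 * p))"
  have r: "0 < r" "r < 1" using p th by (auto simp: r_def powr_less_one)
  define R where "R x = (\<Sum>n. ennreal ((H n x / r ^ n) powr p))" for x
  have [measurable]: "R \<in> borel_measurable M" unfolding R_def[abs_def] by measurable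
  have rp: "0 < r powr p" "r powr p < 1" using r p powr_less_mono2[of p r 1] by auto
  have "(\<integral>\<^sup>+x. R x \<partial>M) = (\<Sum>n. \<integral>\<^sup>+x. ennreal ((H n x / r ^ n) powr p) \<partial>M)"
    unfolding R_def by (rule nn_integral_suminf) measurable
  also have "\<dots> \<le> (\<Sum>n. ennreal (C * (r powr p) ^ n))"
  proof (rule suminf_le)
    fix n
    have e1: "(H n x / r ^ n) powr p = (1 / (r powr p) ^ n) * H n x powr p" for x
      using r H0 by (simp add: powr_divide powr_powr mult.commute flip: powr_realpow)
    \<comment> \<open>the exponent in \<open>r\<close> is such that the decay rate is exactly the square of \<open>r powr p\<close>\<close>
    have "4 powr (- \<theta>) = (r powr p)\<^sup>2"
    proof -
      have "(r powr p)\<^sup>2 = r powr (p * 2)" using r by (simp add: powr_powr flip: powr_realpow)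
      also have "\<dots> = 4 powr (- \<theta> / (2 * p) * (p * 2))" unfolding r_def by (rule powr_powr)
      finally show ?thesis using p by simp
    qed
    then have e2: "(4 ^ n) powr (- \<theta>) = ((r powr p) ^ n)\<^sup>2"
      by (simp add: power_powr_swap power2_eq_square power_mult_distrib)
    have "(\<integral>\<^sup>+x. ennreal ((H n x / r ^ n) powr p) \<partial>M)
        = (\<integral>\<^sup>+x. ennreal (1 / (r powr p) ^ n) * ennreal (H n x powr p) \<partial>M)"
      unfolding e1 using rp by (intro nn_integral_cong, subst ennreal_mult'[symmetric]) auto
    also have "\<dots> = ennreal (1 / (r powr p) ^ n) * (\<integral>\<^sup>+x. ennreal (H n x powr p) \<partial>M)"
      by (rule nn_integral_cmult) measurable
    also have "\<dots> \<le> ennreal (1 / (r powr p) ^ n) * ennreal (C * (4 ^ n) powr (- \<theta>))"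
      by (intro mult_left_mono int) simp
    also have "\<dots> = ennreal (C * (r powr p) ^ n)"
      unfolding e2 using rp C by (simp add: power2_eq_square flip: ennreal_mult')
    finally show "(\<integral>\<^sup>+x. ennreal ((H n x / r ^ n) powr p) \<partial>M) \<le> ennreal (C * (r powr p) ^ n)" .
  qed auto
  also have "\<dots> < \<infinity>"
    using rp C by (subst suminf_ennreal2) (auto intro!: summable_mult summable_geometric)
  finally have Rint: "(\<integral>\<^sup>+x. R x \<partial>M) < \<infinity>" .
  have "AE x in M. R x \<noteq> \<infinity>" by (rule nn_integral_PInf_AE) (use Rint in auto)
  have pt: "summable (\<lambda>n. H n x) \<and> ennreal ((\<Sum>n. H n x) powr p) \<le> ennreal ((1 / (1 - r)) powr p) * R x"
    if fin: "R x \<noteq> \<infinity>" for x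
  proof -
    define y where "y = enn2real (R x) powr (1 / p)"
    have yp: "y powr p = enn2real (R x)" using p by (simp add: y_def powr_powr)
    have y0: "0 \<le> y" by (simp add: y_def)
    have le: "H n x \<le> y * r ^ n" for n
    proof -
      have "ennreal ((H n x / r ^ n) powr p) \<le> R x"
      proof -
        have "f n = sum f {n}" for f :: "nat \<Rightarrow> ennreal" by simp
        moreover have "sum f {n} \<le> suminf f" for f :: "nat \<Rightarrow> ennreal"
          by (rule sum_le_suminf) auto
        ultimately have "f n \<le> suminf f" for f :: "nat \<Rightarrow> ennreal" by simp
        from this[of "\<lambda>n. ennreal ((H n x / r ^ n) powr p)"] show ?thesis by (simp only: R_def)
      qed
      then have "(H n x / r ^ n) powr p \<le> enn2real (R x)"
        using enn2real_mono[of "ennreal ((H n x / r ^ n) powr p)" "R x"] fin by (simp add: less_top)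
      then have "((H n x / r ^ n) powr p) powr (1 / p) \<le> y"
        unfolding y_def using p by (intro powr_mono2) auto
      then have "H n x / r ^ n \<le> y" using p H0[of n x] r by (simp add: powr_powr)
      then show ?thesis using r by (simp add: divide_le_eq)
    qed
    have sg: "summable (\<lambda>n. y * r ^ n)" using r by (intro summable_mult summable_geometric) auto
    have sH: "summable (\<lambda>n. H n x)"
      by (rule summable_comparison_test[OF _ sg]) (use le H0 in auto)
    have "(\<Sum>n. H n x) \<le> (\<Sum>n. y * r ^ n)" by (rule suminf_le[OF le sH sg])
    also have "\<dots> = 1 / (1 - r) * y" using r by (simp add: suminf_mult suminf_geometric summable_geometric)
    finally have "(\<Sum>n. H n x) powr p \<le> (1 / (1 - r) * y) powr p"
      using H0 p by (intro powr_mono2 suminf_nonneg sH) auto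
    also have "\<dots> = (1 / (1 - r)) powr p * enn2real (R x)" using r y0 yp by (simp add: powr_mult powr_divide)
    finally have "ennreal ((\<Sum>n. H n x) powr p) \<le> ennreal ((1 / (1 - r)) powr p) * ennreal (enn2real (R x))"
      using r by (simp add: ennreal_leI flip: ennreal_mult')
    also have "ennreal (enn2real (R x)) = R x" using fin by (simp add: less_top)
    finally show ?thesis using sH by simp
  qed
  show "AE x in M. summable (\<lambda>n. H n x)"
    using \<open>AE x in M. R x \<noteq> \<infinity>\<close> by eventually_elim (use pt in blast)
  have "(\<integral>\<^sup>+x. ennreal ((\<Sum>n. H n x) powr p) \<partial>M) \<le> (\<integral>\<^sup>+x. ennreal ((1 / (1 - r)) powr p) * R x \<partial>M)"
    by (rule nn_integral_mono_AE) (use \<open>AE x in M. R x \<noteq> \<infinity>\<close> pt in \<open>auto elim!: eventually_mono\<close>)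
  also have "\<dots> = ennreal ((1 / (1 - r)) powr p) * (\<integral>\<^sup>+x. R x \<partial>M)"
    by (rule nn_integral_cmult) measurable
  also have "\<dots> < \<infinity>" using Rint by (simp add: ennreal_mult_less_top)
  finally show "(\<integral>\<^sup>+x. ennreal ((\<Sum>n. H n x) powr p) \<partial>M) < \<infinity>" .
qed

section \<open>Radial multipliers\<close>

lemma cis_neg_inner: "cis (- (freq k \<bullet> x)) = char3 (- k) x"
  by (simp add: freq_minus)

lemma trig3_coefficients:
  assumes "trig3 K f"
  shows fourier_inversion: "complex_of_real (f x) = (\<Sum>k\<in>K. fourier_coeff f k * char3 k x)"
    and fourier_coeff_outside: "k \<notin> K \<Longrightarrow> fourier_coeff f k = 0"
proof -
  obtain c where c: "finite K" "\<And>x. complex_of_real (f x) = (\<Sum>k\<in>K. c k * char3 k x)"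
    by (rule spectrum_inE[OF assms]) blast
  have fc: "fourier_coeff f k = (if k \<in> K then c k else 0)" for k
  proof -
    have "(LINT x|torus. complex_of_real (f x) * char3 (- k) x) = (LINT x|torus. (\<Sum>l\<in>K. c l * char3 (l + - k) x))"
      unfolding c(2) char3_add by (simp add: sum_distrib_right mult.assoc)
    also have "\<dots> = (\<Sum>l\<in>K. c l * (LINT x|torus. char3 (l + - k) x))"
      by (subst Bochner_Integration.integral_sum)
        (auto intro!: continuous_integrable_torus continuous_on_mult continuous_char3 continuous_on_const)
    also have "\<dots> = (\<Sum>l\<in>K. if l = k then (2 * pi) ^ 3 * c l else 0)"
      unfolding torus_integral_char3 by (intro sum.cong refl) auto
    finally show ?thesis
      unfolding fourier_coeff_def cis_neg_inner using c(1) by (simp add: sum.delta')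
  qed
  show "complex_of_real (f x) = (\<Sum>k\<in>K. fourier_coeff f k * char3 k x)" "k \<notin> K \<Longrightarrow> fourier_coeff f k = 0"
    by (simp_all add: fc c(2))
qed

lemma integrable_mult_char3:
  assumes "integrable torus f"
  shows "integrable torus (\<lambda>x. complex_of_real (f x) * char3 k x)"
proof (rule Bochner_Integration.integrable_bound[OF assms])
  have "char3 k \<in> borel_measurable torus"
    by (intro borel_measurable_torusI borel_measurable_continuous_onI continuous_char3)
  then show "(\<lambda>x. complex_of_real (f x) * char3 k x) \<in> borel_measurable torus"
    using assms by measurable
qed (simp add: norm_mult)

lemma fourier_coeff_suminf:
  assumes u: "\<And>n. integrable torus (u n)" and ae: "AE x in torus. summable (\<lambda>n. \<bar>u n x\<bar>)"
    and s: "summable (\<lambda>n. LINT x|torus. \<bar>u n x\<bar>)"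
  shows "fourier_coeff (\<lambda>x. \<Sum>n. u n x) k = (\<Sum>n. fourier_coeff (u n) k)"
proof -
  have "(LINT x|torus. complex_of_real (\<Sum>n. u n x) * char3 (- k) x)
      = (LINT x|torus. (\<Sum>n. complex_of_real (u n x) * char3 (- k) x))"
  proof (rule integral_cong_AE)
    have [measurable]: "u n \<in> borel_measurable torus" for n using u by auto
    have [measurable]: "char3 (- k) \<in> borel_measurable torus"
      by (intro borel_measurable_torusI borel_measurable_continuous_onI continuous_char3)
    show "(\<lambda>x. complex_of_real (\<Sum>n. u n x) * char3 (- k) x) \<in> borel_measurable torus" by measurable
    show "(\<lambda>x. \<Sum>n. complex_of_real (u n x) * char3 (- k) x) \<in> borel_measurable torus" by measurable
    show "AE x in torus. complex_of_real (\<Sum>n. u n x) * char3 (- k) x = (\<Sum>n. complex_of_real (u n x) * char3 (- k) x)"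
      using ae
    proof eventually_elim
      case (elim x)
      then have "summable (\<lambda>n. u n x)" by (rule summable_rabs_cancel)
      then show ?case by (simp add: suminf_mult2 summable_of_real suminf_of_real)
    qed
  qed
  also have "\<dots> = (\<Sum>n. LINT x|torus. complex_of_real (u n x) * char3 (- k) x)"
  proof (rule integral_suminf)
    show "AE x in torus. summable (\<lambda>n. norm (complex_of_real (u n x) * char3 (- k) x))"
      using ae by (simp add: norm_mult)
    show "summable (\<lambda>n. LINT x|torus. norm (complex_of_real (u n x) * char3 (- k) x))"
      using s by (simp add: norm_mult)
  qed (rule integrable_mult_char3[OF u])
  finally have *: "(LINT x|torus. complex_of_real (\<Sum>n. u n x) * char3 (- k) x)
     = (\<Sum>n. LINT x|torus. complex_of_real (u n x) * char3 (- k) x)" .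
  have sm: "summable (\<lambda>n. LINT x|torus. complex_of_real (u n x) * char3 (- k) x)"
  proof (rule summable_comparison_test[OF _ s], intro exI allI impI)
    fix n
    show "norm (LINT x|torus. complex_of_real (u n x) * char3 (- k) x) \<le> (LINT x|torus. \<bar>u n x\<bar>)"
      using integral_norm_bound[of torus "\<lambda>x. complex_of_real (u n x) * char3 (- k) x"] by (simp add: norm_mult)
  qed
  show ?thesis unfolding fourier_coeff_def cis_neg_inner * by (rule suminf_divide[OF sm, symmetric])
qed

text \<open>
  A radial multiplier that is constant on each spectrum acts on the series termwise. The series may
  diverge on a null set, so this is read off from the Fourier coefficients.
\<close>

lemma radial_multiplier_series:
  fixes u :: "nat \<Rightarrow> real^3 \<Rightarrow> real"
  assumes tr: "\<And>n. trig3 (K n) (u n)" and disj: "\<And>m n. m \<noteq> n \<Longrightarrow> K m \<inter> K n = {}"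
    and ae: "AE x in torus. summable (\<lambda>n. \<bar>u n x\<bar>)" and s: "summable (\<lambda>n. LINT x|torus. \<bar>u n x\<bar>)"
    and m: "\<And>n k. k \<in> K n \<Longrightarrow> m (norm (freq k)) = \<mu> n" and J: "finite J" "\<And>n. n \<notin> J \<Longrightarrow> \<mu> n = 0"
  shows "radial_multiplier m (\<lambda>x. \<Sum>n. u n x) x = (\<Sum>n\<in>J. \<mu> n * u n x)"
proof -
  note c = fourier_inversion[OF tr] and c0 = fourier_coeff_outside[OF tr]
  have fin: "finite (K n)" for n using tr spectrum_in_finite by blast
  have int: "integrable torus (u n)" for n
    by (rule continuous_integrable_torus[OF trig3_continuous[OF tr]])
  note fc = fourier_coeff_suminf[OF int ae s]
  have fin_in: "fourier_coeff (\<lambda>x. \<Sum>n. u n x) k = fourier_coeff (u n) k" if k: "k \<in> K n" for k n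
  proof -
    have "k \<notin> K m" if "m \<noteq> n" for m using disj[OF that] k by blast
    then have "(\<Sum>m. fourier_coeff (u m) k) = (\<Sum>m\<in>{n}. fourier_coeff (u m) k)"
      by (intro suminf_finite) (auto simp: c0)
    then show ?thesis by (simp add: fc)
  qed
  have fin_out: "fourier_coeff (\<lambda>x. \<Sum>n. u n x) k = 0" if "\<And>n. k \<notin> K n" for k
    using that by (simp add: fc c0)
  let ?g = "\<lambda>k. complex_of_real (m (norm (freq k))) * fourier_coeff (\<lambda>x. \<Sum>n. u n x) k * char3 k x"
  have "(\<Sum>\<^sub>\<infinity>k. ?g k) = (\<Sum>\<^sub>\<infinity>k\<in>(\<Union>n\<in>J. K n). ?g k)"
  proof (rule infsum_cong_neutral)
    fix k assume k: "k \<in> UNIV - (\<Union>n\<in>J. K n)"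
    show "?g k = 0"
    proof (cases "\<exists>n. k \<in> K n")
      case True
      then obtain n where n: "k \<in> K n" by blast
      then have "n \<notin> J" using k by blast
      then show ?thesis using m[OF n] J(2) by simp
    qed (use fin_out in simp)
  qed auto
  also have "\<dots> = (\<Sum>k\<in>(\<Union>n\<in>J. K n). ?g k)"
    by (rule infsum_finite) (use J fin in auto)
  also have "\<dots> = (\<Sum>n\<in>J. \<Sum>k\<in>K n. ?g k)"
    by (rule sum.UNION_disjoint) (use J fin disj in auto)
  also have "\<dots> = (\<Sum>n\<in>J. complex_of_real (\<mu> n) * (\<Sum>k\<in>K n. fourier_coeff (u n) k * char3 k x))"
    by (intro sum.cong refl) (simp add: m fin_in sum_distrib_left mult.assoc)
  also have "\<dots> = complex_of_real (\<Sum>n\<in>J. \<mu> n * u n x)"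
    by (simp add: c[symmetric])
  finally show ?thesis unfolding radial_multiplier_def by simp
qed

text \<open>
  Parseval: the multiplier can be moved to \<open>P\<close>, where it acts as the identity.
\<close>

lemma radial_multiplier_selfadjoint:
  assumes f: "integrable torus f" and P: "trig3 K P" and m1: "\<And>k. k \<in> K \<Longrightarrow> m (norm (freq k)) = 1"
    and R: "\<And>r. R < r \<Longrightarrow> m r = 0"
  shows "(LINT x|torus. radial_multiplier m f x * P x) = (LINT x|torus. f x * P x)"
    and "continuous_on UNIV (radial_multiplier m f)"
proof -
  define B where "B = {k. norm (freq k) \<le> R}"
  have finB: "finite B" unfolding B_def by (rule finite_freq_ball)
  define g where "g k = complex_of_real (m (norm (freq k))) * fourier_coeff f k" for k
  have rm: "radial_multiplier m f x = Re (\<Sum>k\<in>B. g k * char3 k x)" for x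
  proof -
    have "(\<Sum>\<^sub>\<infinity>k. g k * char3 k x) = (\<Sum>\<^sub>\<infinity>k\<in>B. g k * char3 k x)"
      by (rule infsum_cong_neutral) (auto simp: g_def B_def R not_le)
    then show ?thesis using finB by (simp add: radial_multiplier_def g_def)
  qed
  show "continuous_on UNIV (radial_multiplier m f)"
    unfolding rm[abs_def] by (intro continuous_intros continuous_char3)
  note c = fourier_inversion[OF P] and c0 = fourier_coeff_outside[OF P]
  have ft: "(LINT x|torus. complex_of_real (h x) * char3 k x) = (2 * pi) ^ 3 * fourier_coeff h (- k)" for h k
    unfolding fourier_coeff_def cis_neg_inner by simp
  have cP: "continuous_on UNIV P" by (rule trig3_continuous[OF P])
  have norm_minus: "norm (freq (- k)) = norm (freq k)" for k by (simp add: freq_minus)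
  have KB: "k \<in> B" if "- k \<in> K" for k
    using R[of "norm (freq (- k))"] m1[OF that] by (force simp: B_def norm_minus)
  have intB: "integrable torus (\<lambda>x. g k * char3 k x * complex_of_real (P x))" for k
    by (intro continuous_integrable_torus continuous_intros continuous_char3 cP)
  have "(LINT x|torus. radial_multiplier m f x * P x)
      = (LINT x|torus. Re (\<Sum>k\<in>B. g k * char3 k x * complex_of_real (P x)))"
    unfolding rm by (simp add: sum_distrib_right[symmetric])
  also have "\<dots> = Re (LINT x|torus. (\<Sum>k\<in>B. g k * char3 k x * complex_of_real (P x)))"
    by (rule integral_Re) (rule Bochner_Integration.integrable_sum[OF intB])
  also have "(LINT x|torus. (\<Sum>k\<in>B. g k * char3 k x * complex_of_real (P x)))
      = (\<Sum>k\<in>B. LINT x|torus. g k * char3 k x * complex_of_real (P x))"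
    by (rule Bochner_Integration.integral_sum[OF intB])
  also have "\<dots> = (\<Sum>k\<in>B. g k * ((2 * pi) ^ 3 * fourier_coeff P (- k)))"
    unfolding ft[symmetric] by (simp add: mult_ac flip: integral_mult_right_zero)
  also have "\<dots> = (\<Sum>k\<in>uminus ` K. g k * ((2 * pi) ^ 3 * fourier_coeff P (- k)))"
  proof -
    have "k \<in> uminus ` K \<longleftrightarrow> - k \<in> K" for k by (metis image_iff minus_minus)
    then show ?thesis using finB KB c0 by (intro sum.mono_neutral_right) auto
  qed
  also have "\<dots> = (\<Sum>k\<in>K. g (- k) * ((2 * pi) ^ 3 * fourier_coeff P k))"
    by (subst sum.reindex) (auto simp: inj_on_def)
  also have "\<dots> = (\<Sum>k\<in>K. fourier_coeff P k * (LINT x|torus. complex_of_real (f x) * char3 k x))"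
    unfolding ft by (intro sum.cong refl) (simp add: g_def norm_minus m1)
  also have "\<dots> = (LINT x|torus. (\<Sum>k\<in>K. fourier_coeff P k * (complex_of_real (f x) * char3 k x)))"
    by (subst Bochner_Integration.integral_sum) (auto intro!: integrable_mult_right integrable_mult_char3 f)
  also have "\<dots> = (LINT x|torus. complex_of_real (f x * P x))"
    by (simp add: c sum_distrib_left mult_ac)
  also have "Re \<dots> = (LINT x|torus. f x * P x)"
    by (simp only: integral_complex_of_real Re_complex_of_real)
  finally show "(LINT x|torus. radial_multiplier m f x * P x) = (LINT x|torus. f x * P x)" .
qed

lemma shell_disjoint:
  assumes "m \<noteq> n" shows "shell m \<inter> shell n = {}"
proof -
  have *: "shell m \<inter> shell n = {}" if "m < n" for m n
  proof -
    have "sqrt 5 < 4" by (rule real_less_lsqrt) auto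
    then have "64 * sqrt 5 * 4 ^ m < 64 * 4 * 4 ^ m" by simp
    also have "64 * 4 * (4::real) ^ m = 64 * 4 ^ Suc m" by simp
    also have "\<dots> \<le> 64 * 4 ^ n" using that by (intro mult_left_mono power_increasing) auto
    also have "\<dots> \<le> 128 * 4 ^ n" by simp
    finally show ?thesis by (force simp: shell_def)
  qed
  show ?thesis using *[of m n] *[of n m] assms by (metis Int_commute linorder_neqE_nat)
qed

text \<open>
  The ratio of the outer to the inner radius of a shell is \<open>sqrt 5 / 2\<close>. At level \<open>2 n + 7\<close> or
  above the rescaled frequency is at most \<open>sqrt 5 / 2\<close>, and at any lower level it is at least \<open>2\<close>.
\<close>

lemma cutoff_on_shell:
  assumes \<phi>: "lp_cutoff \<epsilon> \<phi>" and k: "k \<in> shell n"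
  shows "\<phi> (inverse (lp_lambda q) * norm (freq k)) = (if 2 * int n + 7 \<le> q then 1 else 0)"
proof -
  define \<xi> where "\<xi> = inverse (lp_lambda q) * norm (freq k)"
  have pos: "0 < lp_lambda q" by (simp add: lp_lambda_def)
  have \<xi>0: "0 \<le> \<xi>" using pos by (simp add: \<xi>_def)
  have L: "128 * 4 ^ n = lp_lambda (2 * int n + 7)"
    by (simp add: lp_lambda_def power_int_add power_int_mult power_int_numeral)
  have sh: "lp_lambda (2 * int n + 7) \<le> norm (freq k)" "norm (freq k) \<le> sqrt 5 / 2 * lp_lambda (2 * int n + 7)"
    using k unfolding L[symmetric] by (simp_all add: shell_def)
  show ?thesis
  proof (cases "2 * int n + 7 \<le> q")
    case True
    have "lp_lambda (2 * int n + 7) \<le> lp_lambda q"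
      unfolding lp_lambda_def using True by (intro power_int_increasing) auto
    then have "norm (freq k) \<le> sqrt 5 / 2 * lp_lambda q" using sh(2) by (smt (verit) mult_left_mono real_sqrt_ge_zero divide_nonneg_pos)
    then have "\<xi> \<le> sqrt 5 / 2" using pos by (simp add: \<xi>_def field_simps)
    then show ?thesis using \<phi> \<xi>0 True unfolding lp_cutoff_def \<xi>_def[symmetric] by simp
  next
    case False
    have "2 * lp_lambda q = lp_lambda (q + 1)" by (simp add: lp_lambda_def power_int_add)
    also have "\<dots> \<le> lp_lambda (2 * int n + 7)"
      unfolding lp_lambda_def using False by (intro power_int_increasing) auto
    finally have "2 * lp_lambda q \<le> norm (freq k)" using sh(1) by linarith
    then have "2 \<le> \<xi>" using pos by (simp add: \<xi>_def field_simps)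
    then have "2 - 4 * \<epsilon> \<le> \<xi>" using \<phi> by (simp add: lp_cutoff_def)
    then show ?thesis using \<phi> False unfolding lp_cutoff_def \<xi>_def[symmetric] by simp
  qed
qed

lemma psi_on_shell:
  assumes \<phi>: "lp_cutoff \<epsilon> \<phi>" and k: "k \<in> shell n"
  shows "lp_psi \<phi> (inverse (lp_lambda q) * norm (freq k)) = (if 2 * int n + 7 = q then - 1 else 0)"
proof -
  have e: "2 * (inverse (lp_lambda q) * norm (freq k)) = inverse (lp_lambda (q - 1)) * norm (freq k)"
    by (simp add: lp_lambda_def power_int_diff field_simps)
  show ?thesis unfolding lp_psi_def e cutoff_on_shell[OF assms] by auto
qed

section \<open>Besov regularity\<close>

lemma borel_measurable_vec3I:
  fixes f :: "'a \<Rightarrow> real^3"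
  assumes "\<And>i. (\<lambda>x. f x $ i) \<in> borel_measurable M"
  shows "f \<in> borel_measurable M"
  unfolding borel_measurable_euclidean_space[of f]
  using assms by (auto simp: Basis_vec_def inner_axis)

lemma norm_le_3:
  fixes v :: "real^3" assumes "\<And>i. \<bar>v $ i\<bar> \<le> b" shows "norm v \<le> 3 * b"
  using norm_le_l1_cart[of v] sum_bounded_above[of "UNIV::3 set" "\<lambda>i. \<bar>v $ i\<bar>" b] assms by simp

lemma shell_velocity_trig3: "trig3 (shell n) (\<lambda>x. shell_velocity a n x $ i)"
proof -
  have s: "trig3 (shell n) (\<lambda>x. (\<Sum>w\<in>UNIV. piece a i j (w, n) x))" for i j
    by (intro spectrum_in_real_sum finite_shell piece_trig3)
  have "trig3 (shell n) (\<lambda>x. shell_velocity a n x $ 1)"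
    unfolding shell_velocity_simps using spectrum_in_real_cmult[OF s[of 0 1], of "-1"] by simp
  moreover have "trig3 (shell n) (\<lambda>x. shell_velocity a n x $ 2)"
    unfolding shell_velocity_simps by (rule s)
  moreover have "trig3 (shell n) (\<lambda>x. shell_velocity a n x $ 3)"
    unfolding shell_velocity_simps using spectrum_in_zero[OF finite_shell] by simp
  ultimately show ?thesis using exhaust_3[of i] by auto
qed

lemma shell_velocity_continuous: "continuous_on UNIV (\<lambda>x. shell_velocity a n x $ i)"
  by (rule trig3_continuous[OF shell_velocity_trig3])

lemma shell_velocity_borel [measurable]: "(\<lambda>x. shell_velocity a n x $ i) \<in> borel_measurable torus"
  by (intro borel_measurable_torusI borel_measurable_continuous_onI shell_velocity_continuous)

lemma velocity_nth: "velocity a x $ i = (\<Sum>n. shell_velocity a n x $ i)"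
  by (simp add: velocity_def)

lemma velocity_nth_borel [measurable]: "(\<lambda>x. velocity a x $ i) \<in> borel_measurable torus"
  unfolding velocity_nth by measurable

lemma velocity_borel [measurable]: "velocity a \<in> borel_measurable torus"
  by (rule borel_measurable_vec3I) measurable

lemma piece_periodic: "piece a i j X (x + (2 * pi) *\<^sub>R axis l 1) = piece a i j X x"
proof -
  obtain w n where X: "X = (w, n)" by (cases X)
  obtain c where c: "\<And>x. complex_of_real (piece a i j (w, n) x) = (\<Sum>k\<in>shell n. c k * char3 k x)"
    by (rule spectrum_inE[OF piece_trig3[of n a i j w]]) blast
  have "char3 k (x + (2 * pi) *\<^sub>R axis l 1) = char3 k x" for k
  proof -
    have "freq k \<bullet> (x + (2 * pi) *\<^sub>R axis l 1) = freq k \<bullet> x + 2 * pi * of_int (k $ l)"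
      by (simp add: inner_add_right inner_axis freq_nth)
    then show ?thesis by (simp flip: cis_mult)
  qed
  then have "complex_of_real (piece a i j X (x + (2 * pi) *\<^sub>R axis l 1)) = complex_of_real (piece a i j X x)"
    unfolding X c by simp
  then show ?thesis by (simp only: of_real_eq_iff)
qed

lemma torus_periodic_velocity: "torus_periodic (velocity a)"
proof -
  have "shell_velocity a n (x + (2 * pi) *\<^sub>R axis l 1) = shell_velocity a n x" for n x l
    by (simp add: vec_eq_iff forall_3 shell_velocity_simps piece_periodic)
  then show ?thesis by (simp add: torus_periodic_def velocity_def)
qed

lemma nn_integral_norm_powr:
  fixes u :: "real^3 \<Rightarrow> real^3"
  assumes "0 \<le> p" "AE x in torus. norm (u x) \<le> 3 * h x" and [measurable]: "h \<in> borel_measurable torus"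
  shows "(\<integral>\<^sup>+x. ennreal (norm (u x) powr p) \<partial>torus) \<le> ennreal (3 powr p) * (\<integral>\<^sup>+x. ennreal (h x powr p) \<partial>torus)"
proof -
  have "(\<integral>\<^sup>+x. ennreal (norm (u x) powr p) \<partial>torus) \<le> (\<integral>\<^sup>+x. ennreal (3 powr p) * ennreal (h x powr p) \<partial>torus)"
  proof (rule nn_integral_mono_AE)
    show "AE x in torus. ennreal (norm (u x) powr p) \<le> ennreal (3 powr p) * ennreal (h x powr p)"
      using assms(2)
    proof eventually_elim
      case (elim x)
      then have "norm (u x) powr p \<le> (3 * h x) powr p" using assms(1) by (intro powr_mono2) auto
      also have "\<dots> = 3 powr p * h x powr p"
        using order_trans[OF norm_ge_zero elim] by (subst powr_mult) auto
      finally show ?case by (simp add: ennreal_leI flip: ennreal_mult')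
    qed
  qed
  also have "\<dots> = ennreal (3 powr p) * (\<integral>\<^sup>+x. ennreal (h x powr p) \<partial>torus)"
    by (rule nn_integral_cmult) measurable
  finally show ?thesis .
qed

lemma Lp_norm_finite:
  assumes "(\<integral>\<^sup>+x. ennreal (norm (u x) powr p) \<partial>torus) < \<infinity>"
  shows "Lp_norm (ereal p) u < \<infinity>"
  using assms by (auto simp: Lp_norm_def Let_def)

lemma Lp_norm_zero: "0 < p \<Longrightarrow> Lp_norm p (\<lambda>x. 0) = 0"
proof (cases "p = \<infinity>")
  case True
  have "esssup torus (\<lambda>x. ennreal (norm (0::real^3))) \<le> 0" by (rule esssup_I) auto
  then show ?thesis using True by (simp add: Lp_norm_def)
qed (simp add: Lp_norm_def Let_def)

lemma lp_lambda_level: "lp_lambda (2 * int n + 7) = 128 * 4 ^ n"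
  by (simp add: lp_lambda_def power_int_add power_int_mult power_int_numeral)

lemma finite_levels: "finite {n. 2 * int n + 7 \<le> q}"
  by (rule finite_subset[of _ "{..nat q}"]) auto

context
  fixes a :: "nat \<Rightarrow> real" and A :: real
  assumes a: "\<And>n. \<bar>a n\<bar> \<le> A" and A: "1 \<le> A"
begin

definition total_envelope :: "real^3 \<Rightarrow> real" where
  "total_envelope x = (\<Sum>n. envelope A n x)"

lemma total_envelope_borel [measurable]: "total_envelope \<in> borel_measurable torus"
  unfolding total_envelope_def[abs_def] by measurable

lemma envelope_series:
  assumes "1 \<le> p" "p < 9 / 2"
  shows "AE x in torus. summable (\<lambda>n. envelope A n x)"
    and "(\<integral>\<^sup>+x. ennreal (total_envelope x powr p) \<partial>torus) < \<infinity>"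
proof -
  let ?C = "Lp_const A p"
  have "envelope A n \<in> borel_measurable torus" "0 \<le> envelope A n x" for n x
    using A by (measurable, intro envelope_nonneg) simp
  note L = geometric_series_Lp[of "envelope A" torus p ?C "3 - 2 / 3 * p", OF this assms(1) _ _ envelope_integral[OF assms(1)]]
  have "AE x in torus. summable (\<lambda>n. envelope A n x)" "(\<integral>\<^sup>+x. ennreal ((\<Sum>n. envelope A n x) powr p) \<partial>torus) < \<infinity>"
    by (rule L; use assms A in simp)+
  then show "AE x in torus. summable (\<lambda>n. envelope A n x)"
    "(\<integral>\<^sup>+x. ennreal (total_envelope x powr p) \<partial>torus) < \<infinity>"
    by (simp_all add: total_envelope_def)
qed

lemma AE_summable: "AE x in torus. summable (\<lambda>n. envelope A n x)"
  by (rule envelope_series(1)[of 1]) auto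

lemma shell_le: "\<bar>shell_velocity a n x $ i\<bar> \<le> envelope A n x"
  by (rule shell_velocity_bound[where a=a and n=n, OF a A])

lemma total_envelope_integrable:
  assumes "p = 1 \<or> p = 2" shows "integrable torus (\<lambda>x. total_envelope x ^ p)"
proof (rule integrableI_bounded)
  have 0: "AE x in torus. 0 \<le> total_envelope x"
    using AE_summable by eventually_elim (use A in \<open>auto simp: total_envelope_def intro!: suminf_nonneg envelope_nonneg\<close>)
  have "(\<integral>\<^sup>+x. ennreal (norm (total_envelope x ^ p)) \<partial>torus) = (\<integral>\<^sup>+x. ennreal (total_envelope x powr real p) \<partial>torus)"
  proof (rule nn_integral_cong_AE)
    show "AE x in torus. ennreal (norm (total_envelope x ^ p)) = ennreal (total_envelope x powr real p)"
      using 0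
    proof eventually_elim
      case (elim x)
      then show ?case using assms by (cases "total_envelope x = 0") (auto simp: powr_realpow)
    qed
  qed
  also have "\<dots> < \<infinity>" by (rule envelope_series(2)) (use assms in auto)
  finally show "(\<integral>\<^sup>+x. ennreal (norm (total_envelope x ^ p)) \<partial>torus) < \<infinity>" .
qed measurable

lemma shell_summable:
  assumes "summable (\<lambda>n. envelope A n x)"
  shows "summable (\<lambda>n. \<bar>shell_velocity a n x $ i\<bar>)"
  by (rule summable_comparison_test[OF _ assms]) (use shell_le in auto)

lemma partial_velocity_le:
  assumes "summable (\<lambda>n. envelope A n x)"
  shows "\<bar>\<Sum>n<N. shell_velocity a n x $ i\<bar> \<le> total_envelope x"
    and velocity_le: "\<bar>velocity a x $ i\<bar> \<le> total_envelope x"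
proof -
  have "\<bar>\<Sum>n<N. shell_velocity a n x $ i\<bar> \<le> (\<Sum>n<N. envelope A n x)" for N
    by (rule order_trans[OF sum_abs]) (intro sum_mono shell_le)
  also have "(\<Sum>n<N. envelope A n x) \<le> total_envelope x" for N
    unfolding total_envelope_def using A by (intro sum_le_suminf assms) (auto intro: envelope_nonneg)
  finally have le: "\<bar>\<Sum>n<N. shell_velocity a n x $ i\<bar> \<le> total_envelope x" for N .
  then show "\<bar>\<Sum>n<N. shell_velocity a n x $ i\<bar> \<le> total_envelope x" .
  have "(\<lambda>N. \<Sum>n<N. shell_velocity a n x $ i) \<longlonglongrightarrow> velocity a x $ i"
    unfolding velocity_nth by (rule summable_LIMSEQ[OF summable_rabs_cancel[OF shell_summable[OF assms]]])
  from tendsto_rabs[OF this] show "\<bar>velocity a x $ i\<bar> \<le> total_envelope x"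
    by (rule LIMSEQ_le_const2) (use le in auto)
qed

lemma envelope_integral_1:
  "(LINT x|torus. envelope A n x) \<le> 411 * A * (4 * pi) ^ 3 * (4 powr (- 7 / 3)) ^ n"
proof -
  have "ennreal (LINT x|torus. envelope A n x) = (\<integral>\<^sup>+x. ennreal (envelope A n x) \<partial>torus)"
    using A by (intro nn_integral_eq_integral[symmetric] continuous_integrable_torus envelope_continuous AE_I2)
      (auto intro: envelope_nonneg)
  also have "\<dots> = (\<integral>\<^sup>+x. ennreal (envelope A n x powr 1) \<partial>torus)"
    using A by (simp add: envelope_nonneg)
  also have "\<dots> \<le> ennreal (Lp_const A 1 * (4 ^ n) powr (- (3 - 2 / 3 * 1)))"
    by (rule envelope_integral) (use A in auto)
  finally have "(LINT x|torus. envelope A n x) \<le> Lp_const A 1 * (4 ^ n) powr (- (3 - 2 / 3 * 1))"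
    by (rule ennreal_le_iff[THEN iffD1, rotated]) (use A in simp)
  also have "(4 ^ n) powr (- (3 - 2 / 3 * 1)) = ((4::real) powr (- 7 / 3)) ^ n"
    by (simp add: power_powr_swap)
  finally show ?thesis using A by (simp add: Lp_const_def)
qed

lemma dominated_series:
  fixes f :: "nat \<Rightarrow> real^3 \<Rightarrow> real"
  assumes c: "\<And>n. continuous_on UNIV (f n)" and B: "0 \<le> B"
    and le: "\<And>n x. x \<in> space torus \<Longrightarrow> \<bar>f n x\<bar> \<le> B * envelope A n x"
  shows AE_summable_abs: "AE x in torus. summable (\<lambda>n. \<bar>f n x\<bar>)"
    and summable_integrals: "summable (\<lambda>n. LINT x|torus. \<bar>f n x\<bar>)"
proof -
  show "AE x in torus. summable (\<lambda>n. \<bar>f n x\<bar>)"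
    using AE_summable AE_space
  proof eventually_elim
    case (elim x)
    show ?case
      by (rule summable_comparison_test[OF _ summable_mult[OF elim(1), of B]]) (use le[OF elim(2)] in auto)
  qed
  let ?b = "\<lambda>n. B * (411 * A * (4 * pi) ^ 3 * (4 powr (- 7 / 3)) ^ n)"
  show "summable (\<lambda>n. LINT x|torus. \<bar>f n x\<bar>)"
  proof (rule summable_comparison_test[of _ ?b], intro exI allI impI)
    have "(4::real) powr (- 7 / 3) < 1" by (rule powr_less_one) auto
    then show "summable ?b" by (intro summable_mult summable_geometric) auto
    fix n
    have "(LINT x|torus. \<bar>f n x\<bar>) \<le> (LINT x|torus. B * envelope A n x)"
      by (intro integral_mono continuous_integrable_torus continuous_intros c envelope_continuous le)
    also have "\<dots> \<le> ?b n" using mult_left_mono[OF envelope_integral_1 B] by simp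
    finally show "norm (LINT x|torus. \<bar>f n x\<bar>) \<le> ?b n" by (simp add: integral_nonneg_AE)
  qed
qed

lemmas shell_series = dominated_series[where B = 1 and f = "\<lambda>n x. shell_velocity a n x $ i" for i,
    OF shell_velocity_continuous zero_le_one order_trans[OF shell_le eq_refl[OF mult_1[symmetric]]]]

lemmas radial_multiplier_velocity =
  radial_multiplier_series[OF shell_velocity_trig3 shell_disjoint shell_series, folded velocity_nth]

lemma torus_field_velocity: "torus_field (velocity a)"
proof -
  have "integrable torus (velocity a)"
  proof (rule Bochner_Integration.integrable_bound)
    show "integrable torus (\<lambda>x. 3 * total_envelope x)"
      using total_envelope_integrable[of 1] by simp
    show "AE x in torus. norm (velocity a x) \<le> norm (3 * total_envelope x)"
      using AE_summable
    proof eventually_elim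
      case (elim x)
      from norm_le_3[OF velocity_le[OF elim]] show ?case by simp
    qed
  qed measurable
  then show ?thesis by (simp add: torus_field_def torus_periodic_velocity)
qed

lemma Lp_norm_velocity:
  assumes "1 \<le> p" "p < 9 / 2" shows "Lp_norm (ereal p) (velocity a) < \<infinity>"
proof (rule Lp_norm_finite)
  have "AE x in torus. norm (velocity a x) \<le> 3 * total_envelope x"
    using AE_summable by eventually_elim (intro norm_le_3 velocity_le)
  then have "(\<integral>\<^sup>+x. ennreal (norm (velocity a x) powr p) \<partial>torus)
      \<le> ennreal (3 powr p) * (\<integral>\<^sup>+x. ennreal (total_envelope x powr p) \<partial>torus)"
    using assms by (intro nn_integral_norm_powr) auto
  also have "\<dots> < \<infinity>" using envelope_series(2)[OF assms] by (simp add: ennreal_mult_less_top)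
  finally show "(\<integral>\<^sup>+x. ennreal (norm (velocity a x) powr p) \<partial>torus) < \<infinity>" .
qed

context
  fixes \<epsilon> :: real and \<phi> :: "real \<Rightarrow> real"
  assumes phi: "lp_cutoff \<epsilon> \<phi>"
begin

lemma lp_S_velocity: "lp_S \<phi> q (\<lambda>x. velocity a x $ i) x = (\<Sum>n | 2 * int n + 7 \<le> q. shell_velocity a n x $ i)"
proof -
  have "lp_S \<phi> q (\<lambda>x. velocity a x $ i) x
      = (\<Sum>n | 2 * int n + 7 \<le> q. (if 2 * int n + 7 \<le> q then 1 else 0) * shell_velocity a n x $ i)"
    unfolding lp_S_def
    by (rule radial_multiplier_velocity) (auto simp: cutoff_on_shell[OF phi] finite_levels)
  then show ?thesis by simp
qed

lemma lp_Delta_velocity: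
  "componentwise (lp_Delta \<phi> q) (velocity a)
     = (if \<exists>n. 2 * int n + 7 = q then (\<lambda>x. - shell_velocity a (nat ((q - 7) div 2)) x) else (\<lambda>x. 0))"
proof -
  have "lp_Delta \<phi> q (\<lambda>x. velocity a x $ i) x
      = (\<Sum>n | 2 * int n + 7 = q. (if 2 * int n + 7 = q then - 1 else 0) * shell_velocity a n x $ i)" for i x
    unfolding lp_Delta_def
    by (rule radial_multiplier_velocity)
      (auto simp: psi_on_shell[OF phi] intro: finite_subset[OF _ finite_levels[of q]])
  moreover have "{n. 2 * int n + 7 = q} = (if \<exists>n. 2 * int n + 7 = q then {nat ((q - 7) div 2)} else {})"
    by auto
  ultimately show ?thesis
    by (auto simp: componentwise_def fun_eq_iff vec_eq_iff)
qed

lemma norm_shell_le: "norm (shell_velocity a n x) \<le> 3 * envelope A n x"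
  by (rule norm_le_3) (rule shell_le)

lemma Lp_norm_shell_real:
  assumes "1 \<le> p"
  shows "Lp_norm (ereal p) (\<lambda>x. - shell_velocity a n x)
    \<le> ennreal ((3 powr p * Lp_const A p) powr (1 / p) * (4 ^ n) powr (- (3 / p - 2 / 3)))"
proof -
  define C where "C = 3 powr p * Lp_const A p"
  have C0: "0 \<le> C" by (simp add: C_def Lp_const_def)
  define I where "I = (\<integral>\<^sup>+x. ennreal (norm (- shell_velocity a n x) powr p) \<partial>torus)"
  have "I \<le> ennreal (3 powr p) * (\<integral>\<^sup>+x. ennreal (envelope A n x powr p) \<partial>torus)"
    unfolding I_def using assms norm_shell_le by (intro nn_integral_norm_powr AE_I2) auto
  also have "\<dots> \<le> ennreal (3 powr p) * ennreal (Lp_const A p * (4 ^ n) powr (- (3 - 2 / 3 * p)))"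
    by (intro mult_left_mono envelope_integral assms) (use A in auto)
  also have "\<dots> = ennreal (C * (4 ^ n) powr (- (3 - 2 / 3 * p)))"
    by (simp add: C_def mult.assoc flip: ennreal_mult')
  finally have I: "I \<le> ennreal (C * (4 ^ n) powr (- (3 - 2 / 3 * p)))" .
  then have "enn2real I \<le> C * (4 ^ n) powr (- (3 - 2 / 3 * p))"
    using C0 by (intro enn2real_leI) auto
  then have "enn2real I powr (1 / p) \<le> (C * (4 ^ n) powr (- (3 - 2 / 3 * p))) powr (1 / p)"
    using assms by (intro powr_mono2) auto
  also have "\<dots> = C powr (1 / p) * (4 ^ n) powr (- (3 - 2 / 3 * p) * (1 / p))"
    using C0 by (subst powr_mult) (auto simp: powr_powr)
  also have "- (3 - 2 / 3 * p) * (1 / p) = - (3 / p - 2 / 3)" using assms by (simp add: field_simps)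
  finally have "ennreal (enn2real I powr (1 / p)) \<le> ennreal (C powr (1 / p) * (4 ^ n) powr (- (3 / p - 2 / 3)))"
    by (rule ennreal_leI)
  moreover have "I \<noteq> \<infinity>" using I by (auto simp: top_unique)
  ultimately show ?thesis by (simp add: Lp_norm_def I_def C_def)
qed

lemma Lp_norm_shell_infinity:
  "Lp_norm \<infinity> (\<lambda>x. - shell_velocity a n x) \<le> ennreal (3 * (411 * A * 8) * (4 ^ n) powr (2 / 3))"
proof -
  define t where "t = (4::real) ^ n"
  have t: "t > 0" by (simp add: t_def)
  have "norm (shell_velocity a n x) \<le> 3 * (411 * A * 8) * t powr (2 / 3)" for x
  proof -
    have M: "majorant (4 ^ n) y \<le> 2 * t" for y using majorant_le[of "4 ^ n" y] by (simp add: t_def)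
    have "majorant (4 ^ n) (x $ 1) * majorant (4 ^ n) (x $ 2) * majorant (4 ^ n) (x $ 3) \<le> (2 * t) * (2 * t) * (2 * t)"
      using t M by (intro mult_mono mult_nonneg_nonneg) (auto simp: majorant_nonneg)
    then have "envelope A n x \<le> 411 * A * t powr (- 7 / 3) * ((2 * t) * (2 * t) * (2 * t))"
      unfolding envelope_def t_def using A by (intro mult_left_mono) auto
    also have "\<dots> = 411 * A * 8 * (t powr (- 7 / 3) * t powr 3)"
      using t by (simp add: powr_numeral power3_eq_cube)
    also have "t powr (- 7 / 3) * t powr 3 = t powr (2 / 3)" unfolding powr_add[symmetric] by simp
    finally show ?thesis using norm_shell_le[of n x] by simp
  qed
  then have "AE x in torus. ennreal (norm (- shell_velocity a n x)) \<le> ennreal (3 * (411 * A * 8) * t powr (2 / 3))"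
    by (intro AE_I2 ennreal_leI) simp
  moreover have [measurable]: "shell_velocity a n \<in> borel_measurable torus"
    by (rule borel_measurable_vec3I) measurable
  have "(\<lambda>x. ennreal (norm (- shell_velocity a n x))) \<in> borel_measurable torus" by measurable
  ultimately show ?thesis unfolding Lp_norm_def t_def by (simp add: esssup_I)
qed

lemma hom_besov_norm_finite:
  assumes C: "0 \<le> C" and p: "0 < p"
    and le: "\<And>n. Lp_norm p (\<lambda>x. - shell_velocity a n x) \<le> ennreal (C * (4 ^ n) powr (- s))"
  shows "hom_besov_norm \<phi> s p (velocity a) < \<infinity>"
proof -
  have "ennreal (lp_lambda q powr s) * Lp_norm p (componentwise (lp_Delta \<phi> q) (velocity a)) \<le> ennreal (C * 128 powr s)" for q
  proof (cases "\<exists>n. 2 * int n + 7 = q")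
    case True
    then obtain n where n: "2 * int n + 7 = q" by blast
    then have "nat ((q - 7) div 2) = n" by auto
    then have "componentwise (lp_Delta \<phi> q) (velocity a) = (\<lambda>x. - shell_velocity a n x)"
      using True by (simp add: lp_Delta_velocity)
    then have "ennreal (lp_lambda q powr s) * Lp_norm p (componentwise (lp_Delta \<phi> q) (velocity a))
      \<le> ennreal (lp_lambda q powr s) * ennreal (C * (4 ^ n) powr (- s))"
      using le by (simp add: mult_left_mono)
    also have "\<dots> = ennreal (lp_lambda q powr s * (C * (4 ^ n) powr (- s)))"
      by (simp flip: ennreal_mult')
    also have "lp_lambda q powr s * (C * (4 ^ n) powr (- s)) = C * 128 powr s"
      unfolding n[symmetric] lp_lambda_level by (simp add: powr_mult powr_minus)
    finally show ?thesis .
  next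
    case False
    then show ?thesis by (simp add: lp_Delta_velocity Lp_norm_zero[OF p])
  qed
  then have "hom_besov_norm \<phi> s p (velocity a) \<le> ennreal (C * 128 powr s)"
    unfolding hom_besov_norm_def by (intro SUP_least)
  then show ?thesis by (rule le_less_trans) simp
qed

lemma hom_besov_norm_real: "1 \<le> p \<Longrightarrow> hom_besov_norm \<phi> (3 / p - 2 / 3) (ereal p) (velocity a) < \<infinity>"
  by (rule hom_besov_norm_finite[OF _ _ Lp_norm_shell_real]) auto

lemma hom_besov_velocity:
  assumes "1 < p" shows "velocity a \<in> hom_besov \<phi> (real_of_ereal (3 / p - 2 / 3)) p"
proof (cases p)
  case (real r)
  then have r: "1 < r" using assms by simp
  have "real_of_ereal (3 / p - 2 / 3) = 3 / r - 2 / 3"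
    unfolding real numeral_eq_ereal using r by simp
  then show ?thesis using hom_besov_norm_real[of r] r torus_field_velocity by (simp add: hom_besov_def real)
next
  case PInf
  have "real_of_ereal (3 / p - 2 / 3) = - (2 / 3)"
    unfolding PInf numeral_eq_ereal by simp
  moreover have "hom_besov_norm \<phi> (- (2 / 3)) \<infinity> (velocity a) < \<infinity>"
    by (rule hom_besov_norm_finite[where C = "3 * (411 * A * 8)"]) (use A Lp_norm_shell_infinity in auto)
  ultimately show ?thesis using torus_field_velocity by (simp add: hom_besov_def PInf)
qed (use assms in simp)

lemma besov_velocity:
  assumes "1 < p" "p < 9 / 2" shows "velocity a \<in> besov \<phi> (3 / p - 2 / 3) (ereal p)"
  using assms hom_besov_norm_real[of p] Lp_norm_velocity[of p] torus_field_velocity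
  by (simp add: besov_def)

end

end

section \<open>Divergence\<close>

text \<open>
  Along each line in direction \<open>i\<close> a derivative over a full period is integrated.
\<close>

lemma torus_integral_partial_zero:
  fixes F :: "real^3 \<Rightarrow> real"
  assumes der: "\<And>x. (F has_derivative D x) (at x)"
    and cont: "continuous_on UNIV (\<lambda>x. D x (axis i 1))" and per: "torus_periodic F"
  shows "(LINT x|torus. D x (axis i 1)) = 0"
proof (rule torus_integral_slice_zero[OF cont])
  fix x :: "real^3"
  define b :: "real^3" where "b = (\<chi> j. if j = i then 0 else x $ j)"
  define path where "path y = b + y *\<^sub>R axis i 1" for y :: real
  have path: "(\<chi> j. if j = i then y else x $ j) = path y" for y
    by (auto simp: path_def b_def vec_eq_iff axis_def)
  have dF: "((\<lambda>y. F (path y)) has_real_derivative D (path y) (axis i 1)) (at y)" for y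
  proof -
    have "(path has_derivative (\<lambda>h. h *\<^sub>R axis i 1)) (at y)"
      unfolding path_def by (auto intro!: derivative_eq_intros)
    from diff_chain_at[OF this der[of "path y"]]
    have "((\<lambda>y. F (path y)) has_derivative (\<lambda>h. D (path y) (h *\<^sub>R axis i 1))) (at y)"
      by (simp add: o_def)
    moreover have "D (path y) (h *\<^sub>R axis i 1) = D (path y) (axis i 1) * h" for h
      using linear_scale[OF has_derivative_linear[OF der[of "path y"]]] by (simp add: mult.commute)
    ultimately show ?thesis by (simp add: has_field_derivative_def)
  qed
  have "continuous_on UNIV path" unfolding path_def by (intro continuous_intros)
  then have "continuous_on UNIV (\<lambda>y. D (path y) (axis i 1))"
    by (rule continuous_on_compose2[OF cont]) auto
  from circle_integral_FTC[OF dF this]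
  have "(LINT y|circle. D (path y) (axis i 1)) = F (path (2 * pi)) - F (path 0)" .
  also have "path (2 * pi) = path 0 + (2 * pi) *\<^sub>R axis i 1" by (simp add: path_def)
  finally show "(LINT y|circle. D (\<chi> j. if j = i then y else x $ j) (axis i 1)) = 0"
    using per unfolding path torus_periodic_def by simp
qed

definition piece_z :: "(nat \<Rightarrow> real) \<Rightarrow> nat \<Rightarrow> nat \<Rightarrow> wave \<times> nat \<Rightarrow> real^3 \<Rightarrow> real" where
  "piece_z a i j X x = amp a X * (wave1 i X (x $ 1)
     * wave2 j X (x $ 2) * deriv (fejer (4 ^ snd X)) (x $ 3))"

lemma has_derivative_coordinate:
  assumes "trig1 K f"
  shows "((\<lambda>x::real^3. f (x $ l)) has_derivative (\<lambda>h. h $ l * deriv f (x $ l))) (at x)"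
  by (rule DERIV_compose_FDERIV[OF trig1_DERIV[OF assms]])
     (rule bounded_linear_imp_has_derivative[OF bounded_linear_vec_nth])

lemma piece_has_derivative:
  "(piece a i j X has_derivative
     (\<lambda>h. piece a (Suc i) j X x * h $ 1 + piece a i (Suc j) X x * h $ 2 + piece_z a i j X x * h $ 3)) (at x)"
proof -
  note d1 = has_derivative_coordinate[OF trig1_derivs[OF prof1_trig1[of "fst X" "4 ^ snd X"], of i], of 1 x]
  note d2 = has_derivative_coordinate[OF trig1_derivs[OF prof2_trig1[of "fst X" "4 ^ snd X"], of j], of 2 x]
  note d3 = has_derivative_coordinate[OF fejer_trig1[of "4 ^ snd X"], of 3 x]
  show ?thesis
    unfolding piece_def[abs_def] piece_z_def
    by (rule has_derivative_eq_rhs[OF has_derivative_mult_right[OF has_derivative_mult[OF has_derivative_mult[OF d1 d2] d3]]])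
      (simp add: fun_eq_iff algebra_simps)
qed

text \<open>
  The integrand is \<open>u \<cdot> \<nabla>\<eta>\<close> for the velocity \<open>u\<close> of one wave. Adding and subtracting
  \<open>\<partial>\<^sub>1 \<partial>\<^sub>2 \<psi> * \<eta>\<close>, where \<open>\<psi>\<close> is the stream function, turns it into a difference of two partial derivatives.
\<close>

lemma piece_divergence_free:
  assumes \<eta>: "test_function \<eta>"
  shows "(LINT x|torus. - piece a 0 1 X x * frechet_derivative \<eta> (at x) (axis 1 1)
     + piece a 1 0 X x * frechet_derivative \<eta> (at x) (axis 2 1)) = 0"
proof -
  have "C_k (Suc 0) \<eta>" and per: "torus_periodic \<eta>" using \<eta> unfolding test_function_def by blast+
  then have diff: "\<And>x. \<eta> differentiable (at x)"
    and cont: "\<And>j. continuous_on UNIV (\<lambda>x. frechet_derivative \<eta> (at x) (axis j 1))" by auto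
  define E where "E x = frechet_derivative \<eta> (at x)" for x
  have dE: "(\<eta> has_derivative E x) (at x)" for x
    unfolding E_def using diff frechet_derivative_works by blast
  have c\<eta>: "continuous_on UNIV \<eta>"
    using diff by (simp add: continuous_on_eq_continuous_at differentiable_imp_continuous_within)
  note c = piece_continuous cont[folded E_def] c\<eta>
  have ax: "axis 1 (1::real) $ (2::3) = 0" "axis 2 (1::real) $ (1::3) = 0" "axis 1 (1::real) $ (3::3) = 0" "axis 2 (1::real) $ (3::3) = 0"
    by (simp_all add: axis_def)
  let ?D = "\<lambda>i j x h. piece a i j X x * E x h
     + (piece a (Suc i) j X x * h $ 1 + piece a i (Suc j) X x * h $ 2 + piece_z a i j X x * h $ 3) * \<eta> x"
  have der: "((\<lambda>x. piece a i j X x * \<eta> x) has_derivative ?D i j x) (at x)" for i j x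
    by (rule has_derivative_mult[OF piece_has_derivative dE])
  have per': "torus_periodic (\<lambda>x. piece a i j X x * \<eta> x)" for i j
    using per piece_periodic[of a i j X] by (simp add: torus_periodic_def)
  have 1: "(LINT x|torus. piece a 0 1 X x * E x (axis 1 1) + piece a 1 1 X x * \<eta> x) = 0"
    using torus_integral_partial_zero[OF der[of 0 1] _ per', of 1]
    by (simp add: ax) (simp add: continuous_intros c)
  have 2: "(LINT x|torus. piece a 1 0 X x * E x (axis 2 1) + piece a 1 1 X x * \<eta> x) = 0"
    using torus_integral_partial_zero[OF der[of 1 0] _ per', of 2]
    by (simp add: ax) (simp add: continuous_intros c)
  have int: "integrable torus (\<lambda>x. piece a i j X x * E x (axis l 1) + piece a 1 1 X x * \<eta> x)" for i j l
    by (intro continuous_integrable_torus continuous_intros c)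
  have "(LINT x|torus. - piece a 0 1 X x * E x (axis 1 1) + piece a 1 0 X x * E x (axis 2 1))
     = (LINT x|torus. (piece a 1 0 X x * E x (axis 2 1) + piece a 1 1 X x * \<eta> x)
         - (piece a 0 1 X x * E x (axis 1 1) + piece a 1 1 X x * \<eta> x))"
    by (intro Bochner_Integration.integral_cong) auto
  also have "\<dots> = 0" unfolding Bochner_Integration.integral_diff[OF int int] 1 2 by simp
  finally show ?thesis by (simp add: E_def)
qed

lemma continuous_bounded_on_torus:
  fixes f :: "real^3 \<Rightarrow> real"
  assumes "continuous_on UNIV f"
  obtains B where "0 \<le> B" "\<And>x. x \<in> space torus \<Longrightarrow> \<bar>f x\<bar> \<le> B"
proof -
  let ?K = "cbox 0 (\<chi> i. 2 * pi) :: (real^3) set"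
  have "compact (f ` ?K)" by (intro compact_continuous_image continuous_on_subset[OF assms]) auto
  then have "bounded (f ` ?K)" by (rule compact_imp_bounded)
  then obtain B where B: "\<And>x. x \<in> ?K \<Longrightarrow> \<bar>f x\<bar> \<le> B"
    unfolding bounded_iff by (auto simp del: mem_box_cart)
  have "\<bar>f x\<bar> \<le> max 0 B" if "x \<in> space torus" for x
    using B[of x] that by (force simp: space_torus mem_box_cart less_imp_le)
  then show ?thesis using that[of "max 0 B"] by auto
qed

context
  fixes a :: "nat \<Rightarrow> real" and A :: real
  assumes a: "\<And>n. \<bar>a n\<bar> \<le> A" and A: "1 \<le> A"
begin

text \<open>
  Each wave is divergence-free, and the series of the pairings with \<open>\<nabla>\<eta>\<close> is dominated by a bounded
  multiple of the integrable sum of the envelopes.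
\<close>

lemma divergence_free_velocity: "divergence_free (velocity a)"
  unfolding divergence_free_def
proof (intro allI impI)
  fix \<eta> assume \<eta>: "test_function \<eta>"
  define d where "d j x = frechet_derivative \<eta> (at x) (axis j 1)" for j x
  have "C_k (Suc 0) \<eta>" using \<eta> unfolding test_function_def by blast
  then have cd: "continuous_on UNIV (d j)" for j by (simp add: d_def[abs_def])
  have "\<exists>B. \<forall>x\<in>space torus. \<bar>d j x\<bar> \<le> B" for j
    by (rule continuous_bounded_on_torus[OF cd[of j]]) blast
  then obtain B where B: "\<And>j x. x \<in> space torus \<Longrightarrow> \<bar>d j x\<bar> \<le> B j" by metis
  define f where "f n x = (\<Sum>j\<in>UNIV. shell_velocity a n x $ j * d j x)" for n x
  have cf: "continuous_on UNIV (f n)" for n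
    unfolding f_def[abs_def] by (intro continuous_on_sum continuous_on_mult shell_velocity_continuous cd)
  have fle: "\<bar>f n x\<bar> \<le> (\<Sum>j\<in>UNIV. B j) * envelope A n x" if "x \<in> space torus" for n x
  proof -
    have "\<bar>f n x\<bar> \<le> (\<Sum>j\<in>UNIV. \<bar>shell_velocity a n x $ j\<bar> * \<bar>d j x\<bar>)"
      unfolding f_def abs_mult[symmetric] by (rule sum_abs)
    also have "\<dots> \<le> (\<Sum>j\<in>UNIV. envelope A n x * B j)"
      by (intro sum_mono mult_mono shell_le[OF a A] B[OF that] envelope_nonneg) (use A in auto)
    finally show ?thesis by (simp add: sum_distrib_right mult.commute)
  qed
  have f0: "(LINT x|torus. f n x) = 0" for n
  proof -
    have "f n x = (\<Sum>w\<in>UNIV. - piece a 0 1 (w, n) x * d 1 x + piece a 1 0 (w, n) x * d 2 x)" for x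
      by (simp add: f_def sum_UNIV3 shell_velocity_simps UNIV_wave algebra_simps)
    then have "(LINT x|torus. f n x)
       = (LINT x|torus. (\<Sum>w\<in>UNIV. - piece a 0 1 (w, n) x * d 1 x + piece a 1 0 (w, n) x * d 2 x))"
      by simp
    also have "\<dots> = (\<Sum>w\<in>UNIV. LINT x|torus. - piece a 0 1 (w, n) x * d 1 x + piece a 1 0 (w, n) x * d 2 x)"
      by (intro Bochner_Integration.integral_sum continuous_integrable_torus continuous_intros piece_continuous cd)
    also have "\<dots> = 0" unfolding d_def using piece_divergence_free[OF \<eta>] by simp
    finally show ?thesis .
  qed
  have "(LINT x|torus. (\<Sum>j\<in>UNIV. velocity a x $ j * d j x)) = (LINT x|torus. (\<Sum>n. f n x))"
  proof (rule integral_cong_AE)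
    have [measurable]: "d j \<in> borel_measurable torus" for j
      by (intro borel_measurable_torusI borel_measurable_continuous_onI cd)
    have [measurable]: "f n \<in> borel_measurable torus" for n
      by (intro borel_measurable_torusI borel_measurable_continuous_onI cf)
    have [measurable]: "(\<lambda>x. velocity a x $ j) \<in> borel_measurable torus" for j
      by (rule velocity_nth_borel)
    show "(\<lambda>x. \<Sum>j\<in>UNIV. velocity a x $ j * d j x) \<in> borel_measurable torus" by measurable
    show "(\<lambda>x. \<Sum>n. f n x) \<in> borel_measurable torus" by measurable
    show "AE x in torus. (\<Sum>j\<in>UNIV. velocity a x $ j * d j x) = (\<Sum>n. f n x)"
      using AE_summable[OF a A]
    proof eventually_elim
      case (elim x)
      have s: "summable (\<lambda>n. shell_velocity a n x $ j)" for j
        by (rule summable_rabs_cancel[OF shell_summable[OF a A elim]])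
      have "(\<Sum>n. f n x) = (\<Sum>j\<in>UNIV. \<Sum>n. shell_velocity a n x $ j * d j x)"
        unfolding f_def by (rule suminf_sum) (intro summable_mult2 s)
      also have "\<dots> = (\<Sum>j\<in>UNIV. velocity a x $ j * d j x)"
        by (simp add: velocity_nth suminf_mult2[OF s])
      finally show ?case by simp
    qed
  qed
  also have "\<dots> = (\<Sum>n. LINT x|torus. f n x)"
  proof -
    have "0 \<le> (\<Sum>j\<in>UNIV. B j)"
    proof (rule sum_nonneg)
      fix j :: 3
      have "(0::real^3) \<in> space torus" by (simp add: space_torus)
      from B[OF this, of j] show "0 \<le> B j" by linarith
    qed
    note d = dominated_series[OF a A cf this fle]
    show ?thesis
      by (rule integral_suminf[OF continuous_integrable_torus[OF cf]]) (use d in simp_all)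
  qed
  also have "\<dots> = 0" by (simp add: f0)
  finally show "(LINT x|torus. (\<Sum>j\<in>UNIV. velocity a x $ j * frechet_derivative \<eta> (at x) (axis j 1))) = 0"
    by (simp add: d_def)
qed

end

section \<open>The energy flux\<close>

text \<open>
  The third wave has scale at most \<open>n\<close>. The part of the sum in which the first wave has too vanishes by
  antisymmetry. In the other part a resonant triad straddles the gap between \<open>n\<close> and \<open>n + 1\<close>,
  and the only one that does consists of \<open>Axial\<close> at scale \<open>n\<close> and the two others at \<open>n + 1\<close>.
\<close>

lemma transfer_sum_resonant:
  fixes a :: "nat \<Rightarrow> real"
  defines "waves \<equiv> \<lambda>N. UNIV \<times> {..<N::nat}"
  assumes N: "Suc (Suc n) \<le> N"
  shows "(\<Sum>X\<in>waves N. \<Sum>Y\<in>waves N. \<Sum>Z\<in>waves (Suc n). transfer a X Y Z)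
     = - 355863040 * 4 powr (- 20 / 3) * kernel_overlap n ^ 3 * a n"
proof -
  let ?t = "transfer a" and ?A = "(Axial, n)" and ?B = "(CosSin, Suc n)" and ?C = "(SinCos, Suc n)"
  let ?L = "waves (Suc n)"
  let ?D = "(waves N - ?L) \<times> waves N \<times> ?L" and ?R = "{(?B, ?C, ?A), (?C, ?B, ?A)}"
  have fin: "finite (waves M)" for M by (simp add: waves_def finite_wave)
  have sub: "?L \<subseteq> waves N" using N by (auto simp: waves_def)
  \<comment> \<open>exchanging the two summation variables changes the sign\<close>
  have low: "(\<Sum>X\<in>?L. \<Sum>Z\<in>?L. ?t X Y Z) = 0" for Y
  proof -
    have "(\<Sum>X\<in>?L. \<Sum>Z\<in>?L. ?t X Y Z) = (\<Sum>X\<in>?L. \<Sum>Z\<in>?L. ?t Z Y X)"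
      by (rule sum.swap)
    also have "\<dots> = (\<Sum>X\<in>?L. \<Sum>Z\<in>?L. - ?t X Y Z)"
    proof (intro sum.cong refl)
      fix X Z show "?t Z Y X = - ?t X Y Z" using transfer_antisym[of a X Y Z] by linarith
    qed
    finally have "(\<Sum>X\<in>?L. \<Sum>Z\<in>?L. ?t X Y Z) = - (\<Sum>X\<in>?L. \<Sum>Z\<in>?L. ?t X Y Z)"
      unfolding sum_negf .
    then show ?thesis by linarith
  qed
  have "(\<Sum>X\<in>waves N. \<Sum>Y\<in>waves N. \<Sum>Z\<in>?L. ?t X Y Z)
     = (\<Sum>X\<in>waves N - ?L. \<Sum>Y\<in>waves N. \<Sum>Z\<in>?L. ?t X Y Z)
       + (\<Sum>X\<in>?L. \<Sum>Y\<in>waves N. \<Sum>Z\<in>?L. ?t X Y Z)"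
    by (rule sum.subset_diff[OF sub fin])
  also have "(\<Sum>X\<in>?L. \<Sum>Y\<in>waves N. \<Sum>Z\<in>?L. ?t X Y Z) = 0"
    by (subst sum.swap) (simp add: low)
  also have "(\<Sum>X\<in>waves N - ?L. \<Sum>Y\<in>waves N. \<Sum>Z\<in>?L. ?t X Y Z)
     = (\<Sum>(X, Y, Z)\<in>?D. ?t X Y Z)"
    by (simp add: sum.cartesian_product)
  also have "\<dots> = (\<Sum>(X, Y, Z)\<in>?R. ?t X Y Z)"
  proof (rule sum.mono_neutral_right)
    show "finite ?D" by (simp add: fin)
    show "?R
      \<subseteq> ?D"
      using N by (auto simp: waves_def)
    show "\<forall>T\<in>?D
       - ?R.
       (case T of (X, Y, Z) \<Rightarrow> ?t X Y Z) = 0"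
    proof
      fix T
      assume T: "T \<in> ?D
       - ?R"
      obtain X Y Z where XYZ: "T = (X, Y, Z)" by (cases T) auto
      have hi: "X \<notin> ?L" and lo: "Z \<in> ?L"
        and ne: "(X, Y, Z) \<noteq> (?B, ?C, ?A)"
          "(X, Y, Z) \<noteq> (?C, ?B, ?A)"
        using T unfolding XYZ by blast+
      have pr: "n < snd X" "snd Z \<le> n" using hi lo by (cases X, auto simp: waves_def)+
      have "?t X Y Z = 0"
      proof (rule ccontr)
        assume "?t X Y Z \<noteq> 0"
        then obtain m where m: "{X, Y, Z} = {(Axial, m), (CosSin, Suc m), (SinCos, Suc m)}"
          by (rule transfer_nonzero)
        have "X \<in> {(Axial, m), (CosSin, Suc m), (SinCos, Suc m)}" "Z \<in> {(Axial, m), (CosSin, Suc m), (SinCos, Suc m)}"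
          using m by blast+
        then have mn: "m = n" "Z = ?A" "X = ?B \<or> X = ?C" using pr by auto
        have "?B \<in> {X, Y, Z}" "?C \<in> {X, Y, Z}"
          unfolding m mn(1) by auto
        then show False using mn ne by auto
      qed
      then show "(case T of (X, Y, Z) \<Rightarrow> ?t X Y Z) = 0" by (simp add: XYZ)
    qed
  qed
  also have "\<dots> = ?t ?B ?C ?A + ?t ?C ?B ?A"
    by simp
  finally show ?thesis by (simp add: transfer_resonant)
qed

lemma matrix_nth: "matrix f $ i $ j = f (axis j 1) $ i"
  by (simp add: matrix_def)

lemma jacobian_nth:
  fixes V :: "real^3 \<Rightarrow> real^3"
  assumes "\<And>i. ((\<lambda>x. V x $ i) has_derivative D i) (at x)"
  shows "jacobian V (at x) $ i $ j = D i (axis j 1)"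
proof -
  have "(V has_derivative (\<lambda>h. \<chi> i. D i h)) (at x)"
    unfolding has_derivative_componentwise_within[of V]
    using assms by (auto simp: Basis_vec_def inner_axis)
  then have "frechet_derivative V (at x) = (\<lambda>h. \<chi> i. D i h)"
    by (rule frechet_derivative_at[symmetric])
  then show ?thesis by (simp add: jacobian_def matrix_nth)
qed

text \<open>
  The entries \<open>\<partial>\<^sub>j V\<^sub>i\<close> for \<open>i\<close> and \<open>j\<close> among the first two coordinates, where \<open>V\<close> is the sum of the velocities
  at scales below \<open>N\<close>.
\<close>

definition low_gradient :: "(nat \<Rightarrow> real) \<Rightarrow> nat \<Rightarrow> 3 \<Rightarrow> 3 \<Rightarrow> real^3 \<Rightarrow> real" where
  "low_gradient a N i j x = (\<Sum>Z\<in>UNIV \<times> {..<N}.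
     if i = 1 then - piece a (if j = 1 then 1 else 0) (if j = 1 then 1 else 2) Z x
     else piece a (if j = 1 then 2 else 1) (if j = 1 then 0 else 1) Z x)"

lemma low_gradient_simps:
  "low_gradient a N 1 1 x = - (\<Sum>Z\<in>UNIV \<times> {..<N}. piece a 1 1 Z x)"
  "low_gradient a N 1 2 x = - (\<Sum>Z\<in>UNIV \<times> {..<N}. piece a 0 2 Z x)"
  "low_gradient a N 2 1 x = (\<Sum>Z\<in>UNIV \<times> {..<N}. piece a 2 0 Z x)"
  "low_gradient a N 2 2 x = (\<Sum>Z\<in>UNIV \<times> {..<N}. piece a 1 1 Z x)"
  by (simp_all add: low_gradient_def sum_negf)

lemma low_gradient_trig3: "trig3 (\<Union>n<N. shell n) (low_gradient a N i j)"
proof -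
  have fin: "finite (\<Union>n<N. shell n)" by (simp add: finite_shell)
  have p: "trig3 (\<Union>n<N. shell n) (piece a k l Z)" if "Z \<in> UNIV \<times> {..<N}" for k l Z
    using that by (cases Z) (auto intro!: spectrum_in_mono[OF piece_trig3 _ fin])
  have m: "trig3 (\<Union>n<N. shell n) (\<lambda>x. - piece a k l Z x)" if "Z \<in> UNIV \<times> {..<N}" for k l Z
    using spectrum_in_real_cmult[OF p[OF that], of "-1"] by simp
  show ?thesis unfolding low_gradient_def[abs_def]
  proof (rule spectrum_in_real_sum[OF fin])
    fix Z :: "wave \<times> nat" assume Z: "Z \<in> UNIV \<times> {..<N}"
    show "trig3 (\<Union>n<N. shell n) (\<lambda>x. if i = 1 then - piece a (if j = 1 then 1 else 0) (if j = 1 then 1 else 2) Z x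
     else piece a (if j = 1 then 2 else 1) (if j = 1 then 0 else 1) Z x)"
      using p[OF Z] m[OF Z] by (cases "i = 1") simp_all
  qed
qed

lemma sum_waves: "(\<Sum>n<N. \<Sum>w\<in>UNIV. g (w, n)) = (\<Sum>Z\<in>UNIV \<times> {..<N}. g Z)" for g :: "wave \<times> nat \<Rightarrow> real"
  by (subst sum.swap) (simp add: sum.cartesian_product)

lemma jacobian_low_velocity:
  assumes V: "\<And>x i. V x $ i = (\<Sum>n<N. shell_velocity a n x $ i)" and ij: "i = 1 \<or> i = 2" "j = 1 \<or> j = 2"
  shows "jacobian V (at x) $ i $ j = low_gradient a N i j x"
proof -
  let ?D = "\<lambda>k l Z h. piece a (Suc k) l Z x * h $ 1 + piece a k (Suc l) Z x * h $ 2 + piece_z a k l Z x * h $ 3"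
  let ?S = "\<lambda>k l x. \<Sum>n<N. \<Sum>w\<in>UNIV. piece a k l (w, n) x" and ?dS = "\<lambda>k l h. \<Sum>n<N. \<Sum>w\<in>UNIV. ?D k l (w, n) h"
  define D where "D i h = (if i = 1 then - ?dS 0 1 h
     else if i = 2 then ?dS 1 0 h else 0)" for i :: 3 and h :: "real^3"
  have "((\<lambda>x. V x $ i) has_derivative D i) (at x)" for i
  proof -
    have s: "((\<lambda>x. ?S k l x) has_derivative (\<lambda>h. ?dS k l h)) (at x)" for k l
      by (intro has_derivative_sum piece_has_derivative)
    have 1: "(\<lambda>x. V x $ 1) = (\<lambda>x. - ?S 0 1 x)"
      and 2: "(\<lambda>x. V x $ 2) = (\<lambda>x. ?S 1 0 x)"
      and 3: "(\<lambda>x. V x $ 3) = (\<lambda>x. 0)"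
      by (simp_all add: V shell_velocity_simps sum_negf)
    have "D 1 = (\<lambda>h. - ?dS 0 1 h)" "D 2 = (\<lambda>h. ?dS 1 0 h)" "D 3 = (\<lambda>h. 0)"
      by (simp_all add: D_def fun_eq_iff)
    then have "((\<lambda>x. V x $ 1) has_derivative D 1) (at x)" "((\<lambda>x. V x $ 2) has_derivative D 2) (at x)" "((\<lambda>x. V x $ 3) has_derivative D 3) (at x)"
      unfolding 1 2 3 using has_derivative_minus[OF s[of 0 1]] s[of 1 0] by (simp_all only: has_derivative_const)
    then show ?thesis using exhaust_3[of i] by auto
  qed
  then have "jacobian V (at x) $ i $ j = D i (axis j 1)" by (rule jacobian_nth)
  also have "\<dots> = low_gradient a N i j x"
  proof -
    show ?thesis using ij
      by (elim disjE; simp add: D_def axis_def low_gradient_simps numeral_2_eq_2 flip: sum_waves)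
  qed
  finally show ?thesis .
qed

lemma radial_multiplier_zero: "radial_multiplier m (\<lambda>x. 0) x = 0"
  by (simp add: radial_multiplier_def fourier_coeff_def)

definition partial_velocity :: "(nat \<Rightarrow> real) \<Rightarrow> nat \<Rightarrow> 3 \<Rightarrow> real^3 \<Rightarrow> real" where
  "partial_velocity a N i x = (\<Sum>n<N. shell_velocity a n x $ i)"

lemma partial_velocity_simps:
  "partial_velocity a N 1 x = - (\<Sum>X\<in>UNIV \<times> {..<N}. piece a 0 1 X x)"
  "partial_velocity a N 2 x = (\<Sum>X\<in>UNIV \<times> {..<N}. piece a 1 0 X x)"
proof -
  show "partial_velocity a N 1 x = - (\<Sum>X\<in>UNIV \<times> {..<N}. piece a 0 1 X x)"
    "partial_velocity a N 2 x = (\<Sum>X\<in>UNIV \<times> {..<N}. piece a 1 0 X x)"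
    unfolding partial_velocity_def shell_velocity_simps sum_waves[symmetric] by (simp_all add: sum_negf)
qed

abbreviation flux_density :: "(nat \<Rightarrow> real) \<Rightarrow> nat \<Rightarrow> (3 \<Rightarrow> real^3 \<Rightarrow> real) \<Rightarrow> real^3 \<Rightarrow> real" where
  "flux_density a N u x \<equiv> (\<Sum>i\<in>{1, 2}. \<Sum>j\<in>{1, 2}. u i x * u j x * low_gradient a N i j x)"

lemma partial_flux:
  "(LINT x|torus. flux_density a N (partial_velocity a M) x)
    = (\<Sum>X\<in>UNIV \<times> {..<M}. \<Sum>Y\<in>UNIV \<times> {..<M}. \<Sum>Z\<in>UNIV \<times> {..<N}. transfer a X Y Z)"
proof -
  let ?W = "\<lambda>M. (UNIV :: wave set) \<times> {..<M::nat}"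
  have pair: "(\<Sum>X\<in>?W M. f X) * (\<Sum>Y\<in>?W M. g Y) * h = (\<Sum>X\<in>?W M. \<Sum>Y\<in>?W M. f X * g Y * h)"
    for f g :: "wave \<times> nat \<Rightarrow> real" and h
    unfolding sum_product by (simp only: sum_distrib_right)
  have prod: "(\<Sum>X\<in>?W M. f X) * (\<Sum>Y\<in>?W M. g Y) * (\<Sum>Z\<in>?W N. h Z) = (\<Sum>X\<in>?W M. \<Sum>Y\<in>?W M. \<Sum>Z\<in>?W N. f X * g Y * h Z)"
    for f g h :: "wave \<times> nat \<Rightarrow> real"
    unfolding pair by (simp only: sum_distrib_left)
  have int: "integrable torus (transfer_density a X Y Z)" for X Y Z
    by (intro continuous_integrable_torus continuous_intros piece_continuous)
  have "flux_density a N (partial_velocity a M) x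
     = (\<Sum>X\<in>?W M. \<Sum>Y\<in>?W M. \<Sum>Z\<in>?W N. transfer_density a X Y Z x)" for x
    unfolding sum_subtractf sum.distrib prod[symmetric]
    by (simp add: partial_velocity_simps low_gradient_simps)
  then have "(LINT x|torus. flux_density a N (partial_velocity a M) x)
     = (LINT x|torus. (\<Sum>X\<in>?W M. \<Sum>Y\<in>?W M. \<Sum>Z\<in>?W N. transfer_density a X Y Z x))" by simp
  also have "\<dots> = (\<Sum>X\<in>?W M. \<Sum>Y\<in>?W M. \<Sum>Z\<in>?W N. transfer a X Y Z)"
    unfolding transfer_def
    by (subst Bochner_Integration.integral_sum, intro Bochner_Integration.integrable_sum int,
        intro sum.cong refl, subst Bochner_Integration.integral_sum, intro Bochner_Integration.integrable_sum int,
        intro sum.cong refl, rule Bochner_Integration.integral_sum, rule int)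
  finally show ?thesis .
qed

context
  fixes a :: "nat \<Rightarrow> real" and A :: real
  assumes a: "\<And>n. \<bar>a n\<bar> \<le> A" and A: "1 \<le> A"
begin

lemma velocity_products_integrable: "integrable torus (\<lambda>x. velocity a x $ i * velocity a x $ j)"
proof (rule Bochner_Integration.integrable_bound)
  show "integrable torus (\<lambda>x. total_envelope A x ^ 2)"
    by (rule total_envelope_integrable[OF a A]) simp
  show "AE x in torus. norm (velocity a x $ i * velocity a x $ j) \<le> norm (total_envelope A x ^ 2)"
    using AE_summable[OF a A]
  proof eventually_elim
    case (elim x)
    have "\<bar>velocity a x $ i\<bar> * \<bar>velocity a x $ j\<bar> \<le> total_envelope A x * total_envelope A x"
      using velocity_le[OF a A elim] by (intro mult_mono) (auto intro: order_trans[OF abs_ge_zero])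
    then show ?case by (simp add: abs_mult power2_eq_square)
  qed
qed measurable

text \<open>
  Dominated convergence: the velocity is bounded by a square integrable sum of envelopes and the
  gradient of the low frequencies is bounded.
\<close>

lemma flux_partial_limit:
  "(\<lambda>M. LINT x|torus. flux_density a N (partial_velocity a M) x)
    \<longlonglongrightarrow> (LINT x|torus. flux_density a N (\<lambda>i x. velocity a x $ i) x)"
proof -
  have cL: "continuous_on UNIV (low_gradient a N i j)" for i j
    by (rule trig3_continuous[OF low_gradient_trig3])
  have "\<exists>B. \<forall>x\<in>space torus. \<bar>low_gradient a N (fst ij) (snd ij) x\<bar> \<le> B" for ij
    by (rule continuous_bounded_on_torus[OF cL[of "fst ij" "snd ij"]]) blast
  then obtain B where B: "\<And>ij x. x \<in> space torus \<Longrightarrow> \<bar>low_gradient a N (fst ij) (snd ij) x\<bar> \<le> B ij" by metis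
  have [measurable]: "low_gradient a N i j \<in> borel_measurable torus" for i j
    by (intro borel_measurable_torusI borel_measurable_continuous_onI cL)
  have [measurable]: "partial_velocity a M i \<in> borel_measurable torus" for M i
    unfolding partial_velocity_def[abs_def] by measurable
  let ?C = "\<Sum>i\<in>{1::3, 2}. \<Sum>j\<in>{1::3, 2}. B (i, j)"
  show ?thesis
  proof (rule integral_dominated_convergence)
    show "integrable torus (\<lambda>x. ?C * total_envelope A x ^ 2)"
      by (intro integrable_mult_right total_envelope_integrable[OF a A]) simp
    show "AE x in torus. (\<lambda>M. flux_density a N (partial_velocity a M) x)
      \<longlonglongrightarrow> flux_density a N (\<lambda>i x. velocity a x $ i) x"
      using AE_summable[OF a A]
    proof eventually_elim
      case (elim x)
      have "(\<lambda>M. partial_velocity a M i x) \<longlonglongrightarrow> velocity a x $ i" for i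
        unfolding partial_velocity_def velocity_nth
        by (rule summable_LIMSEQ[OF summable_rabs_cancel[OF shell_summable[OF a A elim]]])
      then show ?case by (intro tendsto_intros)
    qed
    fix M
    show "AE x in torus. norm (flux_density a N (partial_velocity a M) x)
       \<le> ?C * total_envelope A x ^ 2"
      using AE_summable[OF a A] AE_space
    proof eventually_elim
      case (elim x)
      let ?E = "total_envelope A x"
      have pf: "\<bar>partial_velocity a M i x\<bar> \<le> ?E" for i
        unfolding partial_velocity_def by (rule partial_velocity_le[OF a A elim(1)])
      have E0: "0 \<le> ?E" by (rule order_trans[OF abs_ge_zero pf])
      have "\<bar>partial_velocity a M i x * partial_velocity a M j x * low_gradient a N i j x\<bar> \<le> B (i, j) * ?E ^ 2" for i j
      proof -
        have "\<bar>partial_velocity a M i x\<bar> * \<bar>partial_velocity a M j x\<bar> * \<bar>low_gradient a N i j x\<bar> \<le> ?E * ?E * B (i, j)"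
          using B[OF elim(2), of "(i, j)"] by (intro mult_mono pf) (auto simp: E0)
        then show ?thesis by (simp add: abs_mult power2_eq_square mult_ac)
      qed
      then have "norm (flux_density a N (partial_velocity a M) x)
        \<le> (\<Sum>i\<in>{1::3, 2}. \<Sum>j\<in>{1::3, 2}. B (i, j) * ?E ^ 2)"
        unfolding real_norm_def by (intro order_trans[OF sum_abs] sum_mono) simp
      then show ?case by (simp only: sum_distrib_right)
    qed
  qed measurable
qed

text \<open>
  The cutoff truncates the velocity sharply to \<open>V\<close>, whose gradient it leaves unchanged; by
  self-adjointness it can also be removed from the stress. The flux is therefore the integral of
  \<open>\<Sum>i j. U\<^sub>i U\<^sub>j \<partial>\<^sub>j V\<^sub>i\<close>, and its finite approximations are constant from some point on.
\<close>

lemma energy_flux_velocity: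
  assumes phi: "lp_cutoff \<epsilon> \<phi>" and q: "7 \<le> q"
  shows "energy_flux \<phi> q (velocity a)
    = - 355863040 * 4 powr (- 20 / 3) * kernel_overlap (nat ((q - 7) div 2)) ^ 3 * a (nat ((q - 7) div 2))"
proof -
  define n where "n = nat ((q - 7) div 2)"
  define N where "N = Suc n"
  have lev: "{m. 2 * int m + 7 \<le> q} = {..<N}" using q by (auto simp: N_def n_def)
  let ?V = "componentwise (lp_S \<phi> q) (velocity a)"
  let ?F = "\<lambda>i j x. velocity a x $ i * velocity a x $ j"
  have V: "?V x $ i = (\<Sum>n<N. shell_velocity a n x $ i)" for x i
    by (simp add: componentwise_def lp_S_velocity[OF a A phi] lev)
  \<comment> \<open>the third component of the velocity vanishes, so only the first two indices contribute\<close>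
  have F3: "?F i j = (\<lambda>x. 0)" if "i = 3 \<or> j = 3" for i j
    using that by (auto simp: fun_eq_iff velocity_nth shell_velocity_simps)
  define m where "m r = \<phi> (inverse (lp_lambda q) * r)" for r
  have lam: "0 < lp_lambda q" by (simp add: lp_lambda_def)
  have m1: "m (norm (freq k)) = 1" if k: "k \<in> (\<Union>n<N. shell n)" for k
  proof -
    obtain j where "j < N" "k \<in> shell j" using k by blast
    moreover have "2 * int j + 7 \<le> q" using lev \<open>j < N\<close> by blast
    ultimately show ?thesis unfolding m_def by (simp add: cutoff_on_shell[OF phi])
  qed
  have mR: "m r = 0" if "2 * lp_lambda q < r" for r
  proof -
    have "2 \<le> inverse (lp_lambda q) * r" using that lam by (simp add: field_simps)
    moreover have "0 < \<epsilon>" using phi by (simp add: lp_cutoff_def)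
    ultimately have "2 - 4 * \<epsilon> \<le> inverse (lp_lambda q) * r" by linarith
    then show ?thesis using phi by (simp add: m_def lp_cutoff_def)
  qed
  have S: "lp_S \<phi> q = radial_multiplier m" by (simp add: lp_S_def m_def[abs_def])
  note sa = radial_multiplier_selfadjoint[where m = m, OF velocity_products_integrable low_gradient_trig3 m1 mR]
  have cS: "continuous_on UNIV (radial_multiplier m (?F i j))" for i j by (rule sa(2)) assumption+
  have eqS: "(LINT x|torus. radial_multiplier m (?F i j) x * low_gradient a N k l x)
     = (LINT x|torus. ?F i j x * low_gradient a N k l x)" for i j k l
    by (rule sa(1)) assumption+
  have cL: "continuous_on UNIV (low_gradient a N i j)" for i j
    by (rule trig3_continuous[OF low_gradient_trig3])
  have intS: "integrable torus (\<lambda>x. radial_multiplier m (?F i j) x * low_gradient a N i j x)" for i j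
    by (intro continuous_integrable_torus continuous_on_mult cS cL)
  have intF: "integrable torus (\<lambda>x. ?F i j x * low_gradient a N i j x)" for i j
  proof -
    obtain B where B: "\<And>x. x \<in> space torus \<Longrightarrow> \<bar>low_gradient a N i j x\<bar> \<le> B"
      by (rule continuous_bounded_on_torus[OF cL]) blast
    have [measurable]: "low_gradient a N i j \<in> borel_measurable torus"
      by (intro borel_measurable_torusI borel_measurable_continuous_onI cL)
    show ?thesis
    proof (rule Bochner_Integration.integrable_bound)
      show "integrable torus (\<lambda>x. B * ?F i j x)" by (intro integrable_mult_right velocity_products_integrable)
      show "AE x in torus. norm (?F i j x * low_gradient a N i j x) \<le> norm (B * ?F i j x)"
      proof (rule AE_I2)
        fix x assume "x \<in> space torus"
        from B[OF this] have "\<bar>low_gradient a N i j x\<bar> \<le> \<bar>B\<bar>" by linarith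
        then have "\<bar>?F i j x\<bar> * \<bar>low_gradient a N i j x\<bar> \<le> \<bar>?F i j x\<bar> * \<bar>B\<bar>" by (rule mult_left_mono) simp
        then show "norm (?F i j x * low_gradient a N i j x) \<le> norm (B * ?F i j x)"
          by (simp add: abs_mult mult_ac)
      qed
    qed measurable
  qed
  have "energy_flux \<phi> q (velocity a) = (LINT x|torus. (\<Sum>i\<in>{1, 2}. \<Sum>j\<in>{1, 2}.
      radial_multiplier m (?F i j) x * low_gradient a N i j x))"
    unfolding energy_flux_def
  proof (rule Bochner_Integration.integral_cong[OF refl])
    fix x
    have J: "jacobian ?V (at x) $ i $ j = low_gradient a N i j x" if "i = 1 \<or> i = 2" "j = 1 \<or> j = 2" for i j
      by (rule jacobian_low_velocity[OF V that])
    have z: "radial_multiplier m (?F i j) x = 0" if "i = 3 \<or> j = 3" for i j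
      unfolding F3[OF that] by (rule radial_multiplier_zero)
    show "(\<Sum>i\<in>UNIV. \<Sum>j\<in>UNIV. lp_S \<phi> q (?F i j) x * jacobian ?V (at x) $ i $ j)
       = (\<Sum>i\<in>{1, 2}. \<Sum>j\<in>{1, 2}. radial_multiplier m (?F i j) x * low_gradient a N i j x)"
      using z[of 1 3] z[of 2 3] z[of 3 1] z[of 3 2] z[of 3 3] J[of 1 1] J[of 1 2] J[of 2 1] J[of 2 2]
      by (simp add: S sum_UNIV3)
  qed
  also have "\<dots> = (\<Sum>i\<in>{1, 2}. \<Sum>j\<in>{1, 2}. LINT x|torus. radial_multiplier m (?F i j) x * low_gradient a N i j x)"
    using intS by simp
  also have "\<dots> = (\<Sum>i\<in>{1, 2}. \<Sum>j\<in>{1, 2}. LINT x|torus. ?F i j x * low_gradient a N i j x)"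
    by (simp only: eqS)
  also have "\<dots> = (LINT x|torus. flux_density a N (\<lambda>i x. velocity a x $ i) x)"
    using intF by simp
  also have "\<dots> = - 355863040 * 4 powr (- 20 / 3) * kernel_overlap n ^ 3 * a n"
  proof (rule LIMSEQ_unique[OF flux_partial_limit])
    have "(LINT x|torus. flux_density a N (partial_velocity a M) x)
       = - 355863040 * 4 powr (- 20 / 3) * kernel_overlap n ^ 3 * a n" if "Suc (Suc n) \<le> M" for M
      unfolding partial_flux N_def by (rule transfer_sum_resonant[OF that])
    then show "(\<lambda>M. LINT x|torus. flux_density a N (partial_velocity a M) x)
       \<longlonglongrightarrow> - 355863040 * 4 powr (- 20 / 3) * kernel_overlap n ^ 3 * a n"
      by (intro tendsto_eventually eventually_sequentiallyI[of "Suc (Suc n)"])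
  qed
  finally show ?thesis by (simp add: n_def)
qed

end

text \<open>
  Since the overlap is bounded below, the amplitudes that give flux \<open>c\<close> at every level are bounded.
\<close>

lemma exact_flux_velocity:
  obtains a A where "\<And>n. \<bar>a n\<bar> \<le> A" "1 \<le> A"
    "\<And>\<epsilon> \<phi> q. lp_cutoff \<epsilon> \<phi> \<Longrightarrow> 7 \<le> q \<Longrightarrow> energy_flux \<phi> q (velocity a) = c"
proof -
  define K :: real where "K = 355863040 * 4 powr (- 20 / 3)"
  define a where "a n = - c / (K * kernel_overlap n ^ 3)" for n
  define A where "A = max 1 (\<bar>c\<bar> / (K * (1 / 16) ^ 3))"
  have K: "0 < K" by (simp add: K_def)
  have o: "0 < kernel_overlap n" for n using kernel_overlap_ge[of n] by linarith
  have le: "\<bar>a n\<bar> \<le> A" for n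
  proof -
    have "K * (1 / 16) ^ 3 \<le> K * kernel_overlap n ^ 3"
      using K kernel_overlap_ge[of n] by (intro mult_left_mono power_mono) auto
    then have "\<bar>c\<bar> / (K * kernel_overlap n ^ 3) \<le> \<bar>c\<bar> / (K * (1 / 16) ^ 3)"
      using K by (intro divide_left_mono) (auto simp: o)
    then show ?thesis using K o[of n] by (simp add: a_def A_def abs_mult)
  qed
  have A1: "1 \<le> A" by (simp add: A_def)
  have "energy_flux \<phi> q (velocity a) = c" if "lp_cutoff \<epsilon> \<phi>" "7 \<le> q" for \<epsilon> \<phi> q
  proof -
    let ?n = "nat ((q - 7) div 2)"
    have "energy_flux \<phi> q (velocity a) = - K * kernel_overlap ?n ^ 3 * a ?n"
      unfolding energy_flux_velocity[OF le A1 that] K_def by simp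
    then show ?thesis using K o[of ?n] by (simp add: a_def)
  qed
  then show ?thesis using that le A1 by blast
qed

theorem theorem1:
  fixes c \<delta> :: real
  assumes "\<delta> > 0"
  shows "\<exists>\<epsilon>0>0. \<forall>\<epsilon>. 0 < \<epsilon> \<and> \<epsilon> < \<epsilon>0 \<longrightarrow> (\<forall>\<phi>. lp_cutoff \<epsilon> \<phi> \<longrightarrow>
    (\<exists>U :: real^3 \<Rightarrow> real^3.
       divergence_free U \<and>
       U \<in> besov \<phi> (5 / 6) 2 \<and>
       liminf (\<lambda>n. ereal (energy_flux \<phi> (int n) U)) > ereal (c - \<delta>) \<and>
       limsup (\<lambda>n. ereal (energy_flux \<phi> (int n) U)) < ereal (c + \<delta>) \<and>
       (\<forall>p::real. 1 < p \<and> p < 9 / 2 \<longrightarrow> U \<in> besov \<phi> (3 / p - 2 / 3) (ereal p)) \<and>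
       (\<forall>p::ereal. 1 < p \<longrightarrow> U \<in> hom_besov \<phi> (real_of_ereal (3 / p - 2 / 3)) p)))"
proof (rule exI[of _ 1], intro conjI allI impI)
  \<comment> \<open>the amplitudes depend on \<open>c\<close> alone, so one field serves all cutoffs\<close>
  obtain a A where a: "\<And>n. \<bar>a n\<bar> \<le> A" "1 \<le> A"
    and flux: "\<And>\<epsilon> \<phi> q. lp_cutoff \<epsilon> \<phi> \<Longrightarrow> 7 \<le> q \<Longrightarrow> energy_flux \<phi> q (velocity a) = c"
    by (rule exact_flux_velocity[of c]) blast
  fix \<epsilon> \<phi> assume phi: "lp_cutoff \<epsilon> \<phi>"
  have "(\<lambda>n. ereal (energy_flux \<phi> (int n) (velocity a))) \<longlonglongrightarrow> ereal c"
    by (rule tendsto_eventually, rule eventually_sequentiallyI[of 7]) (simp add: flux[OF phi])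
  then have lim: "liminf (\<lambda>n. ereal (energy_flux \<phi> (int n) (velocity a))) = ereal c"
    "limsup (\<lambda>n. ereal (energy_flux \<phi> (int n) (velocity a))) = ereal c"
    by (simp_all add: lim_imp_Liminf lim_imp_Limsup)
  have besov2: "velocity a \<in> besov \<phi> (5 / 6) 2"
    using besov_velocity[OF a phi, of 2] by simp
  show "\<exists>U :: real^3 \<Rightarrow> real^3.
       divergence_free U \<and>
       U \<in> besov \<phi> (5 / 6) 2 \<and>
       liminf (\<lambda>n. ereal (energy_flux \<phi> (int n) U)) > ereal (c - \<delta>) \<and>
       limsup (\<lambda>n. ereal (energy_flux \<phi> (int n) U)) < ereal (c + \<delta>) \<and>
       (\<forall>p::real. 1 < p \<and> p < 9 / 2 \<longrightarrow> U \<in> besov \<phi> (3 / p - 2 / 3) (ereal p)) \<and>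
       (\<forall>p::ereal. 1 < p \<longrightarrow> U \<in> hom_besov \<phi> (real_of_ereal (3 / p - 2 / 3)) p)"
    using besov2 lim assms divergence_free_velocity[OF a] besov_velocity[OF a phi] hom_besov_velocity[OF a phi]
    by (intro exI[of _ "velocity a"]) auto
qed simp

end
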